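(* Let $V$ be a finite-dimensional real vector space with basis $E$, let $T:V\to V$ be a linear operator, and let $f:E\to\mathbb R$ be monotone, acyclic and canted with respect to $T$. For $t\in\mathbb R$ let $T_t=e^{tf}Te^{-tf}$, and for large $t$ let $\{h_\sigma\}$ ($\sigma$ critical) be the associated orthonormal basis of $W(t)$. Then for all critical $\sigma,\tau\in E$ there is a real constant $a<f(\tau)-f(\sigma)$ such that $$\langle T_t h_\sigma,h_\tau\rangle=e^{t(f(\tau)-f(\sigma))}\,\langle Tk\sigma,\tau\rangle+O(e^{at})\qquad\text{as }t\to+\infty,$$ where $k$ is the idempotent operator on $V$ described in the context.
   Context: Equip $V$ with the inner product for which $E$ is orthonormal, and write $T(\sigma,\tau)=\langle T\tau,\sigma\rangle$ for $\sigma,\tau\in E$. Let $R=\{(\sigma,\tau)\in E\times E:T(\sigma,\tau)\neq0\}$. The function $f$ is monotone if $f(\sigma)\le f(\tau)$ for all $(\sigma,\tau)\in R$. Put $df=\{(\sigma,\tau)\in R:f(\sigma)=f(\tau)\}$, $df^{\sharp}=\{\sigma:(\sigma,\tau)\in df\}$ and $df^{\flat}=\{\tau:(\sigma,\tau)\in df\}$. The function $f$ is acyclic if $df$ is an acyclic pairing on $R$, meaning: (a) each $\sigma\in E$ is the first coordinate of at most one pair in $df$ and each $\tau\in E$ is the second coordinate of at most one pair in $df$; (b) the submatrix of $T$ with rows $df^\sharp$ and columns $df^\flat$ is invertible; (c) the relation $\{(\sigma',\sigma):(\sigma',\tau)\in R\text{ for the }\tau\text{ with }(\sigma,\tau)\in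 df\}$ on $E$ and the relation $\{(\tau,\tau'):(\sigma,\tau')\in R\text{ for the }\sigma\text{ with }(\sigma,\tau)\in df\}$ on $E$ are each contained in a partial order. It is canted if $df^\sharp\cap df^\flat=\emptyset$. Elements of $E\setminus(df^\sharp\cup df^\flat)$ are called critical. $e^{tf}$ is the operator with $e^{tf}\sigma=e^{tf(\sigma)}\sigma$ for $\sigma\in E$. Let $\Delta_t=T_tT_t^*+T_t^*T_t$, with $*$ the adjoint. As $t\to+\infty$, exactly $|E|-2|df|$ eigenvalues of $\Delta_t$ (with multiplicity) tend to $0$ and the rest stay bounded away from $0$; for $t$ large, $W(t)$ is the span of the eigenvectors belonging to the former, and $\pi_t$ is the orthogonal projection onto $W(t)$. For critical $\sigma$ put $g_\sigma=\pi_t\sigma$; for large $t$ these form a basis of $W(t)$. Let $G$ be the Gram matrix $G_{\sigma_1,\sigma_2}=\langle g_{\sigma_1},g_{\sigma_2}\rangle$ and $h_\sigma=\sum_{\sigma'}(G^{-1/2})_{\sigma,\sigma'}g_{\sigma'}$; then $\{h_\sigma\}$ is an orthonormal basis of $W(t)$. $k$ is the idempotent operator on $V$ whose image is $\{v\in V:\langle Tv,\sigma\rangle=0\ \text{for all }\sigma\in df^\sharp\}$ and whose kernel is $\operatorname{span}(df^\flat)$. *)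

theory Defs
  imports
    "HOL-Analysis.Analysis"
    "HOL-Library.Multiset"
    "HOL-Library.Landau_Symbols"
begin

text \<open>
  The space \<open>V\<close> is a type of class \<^class>\<open>euclidean_space\<close>; its distinguished basis \<open>E\<close> is
  \<^term>\<open>Basis\<close>, which is orthonormal for the inner product of the class.
  The function \<open>f\<close> is only ever used on \<^term>\<open>Basis\<close>.
\<close>

section \<open>Matrices with finite index sets\<close>

definition mutually_inverse_on ::
    "'i set \<Rightarrow> 'j set \<Rightarrow> ('i \<Rightarrow> 'j \<Rightarrow> real) \<Rightarrow> ('j \<Rightarrow> 'i \<Rightarrow> real) \<Rightarrow> bool" where
  "mutually_inverse_on I J A B \<longleftrightarrow>
     (\<forall>i\<in>I. \<forall>i'\<in>I. (\<Sum>j\<in>J. A i j * B j i') = (if i = i' then 1 else 0)) \<and>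
     (\<forall>j\<in>J. \<forall>j'\<in>J. (\<Sum>i\<in>I. B j i * A i j') = (if j = j' then 1 else 0))"

definition invertible_on :: "'i set \<Rightarrow> 'j set \<Rightarrow> ('i \<Rightarrow> 'j \<Rightarrow> real) \<Rightarrow> bool" where
  "invertible_on I J A \<longleftrightarrow> (\<exists>B. mutually_inverse_on I J A B)"

definition pos_def_on :: "'i set \<Rightarrow> ('i \<Rightarrow> 'i \<Rightarrow> real) \<Rightarrow> bool" where
  "pos_def_on I A \<longleftrightarrow>
     (\<forall>i\<in>I. \<forall>j\<in>I. A i j = A j i) \<and>
     (\<forall>x. (\<exists>i\<in>I. x i \<noteq> 0) \<longrightarrow> (\<Sum>i\<in>I. \<Sum>j\<in>I. x i * A i j * x j) > 0)"

text \<open>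
  \<open>inv_sqrt_on I G\<close> is \<open>G\<^sup>-\<^sup>1\<^sup>/\<^sup>2\<close>: the positive definite matrix whose square is the inverse of \<open>G\<close>.
  Entries outside \<open>I \<times> I\<close> are fixed to 0 so that it is unique as a function; it is only
  meaningful for positive definite \<open>G\<close>.
\<close>

definition inv_sqrt_on :: "'i set \<Rightarrow> ('i \<Rightarrow> 'i \<Rightarrow> real) \<Rightarrow> 'i \<Rightarrow> 'i \<Rightarrow> real" where
  "inv_sqrt_on I G = (THE S.
     (\<forall>i j. i \<notin> I \<or> j \<notin> I \<longrightarrow> S i j = 0) \<and> pos_def_on I S \<and>
     mutually_inverse_on I I G (\<lambda>i j. \<Sum>l\<in>I. S i l * S l j))"

section \<open>Monotone, acyclic and canted functions\<close>

definition entry :: "('a::euclidean_space \<Rightarrow> 'a) \<Rightarrow> 'a \<Rightarrow> 'a \<Rightarrow> real" where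
  "entry T \<sigma> \<tau> = T \<tau> \<bullet> \<sigma>"

definition supp_rel :: "('a::euclidean_space \<Rightarrow> 'a) \<Rightarrow> ('a \<times> 'a) set" where
  "supp_rel T = {(\<sigma>, \<tau>) \<in> Basis \<times> Basis. entry T \<sigma> \<tau> \<noteq> 0}"

definition monotone_fun :: "('a::euclidean_space \<Rightarrow> 'a) \<Rightarrow> ('a \<Rightarrow> real) \<Rightarrow> bool" where
  "monotone_fun T f \<longleftrightarrow> (\<forall>(\<sigma>, \<tau>) \<in> supp_rel T. f \<sigma> \<le> f \<tau>)"

definition diff_pairs :: "('a::euclidean_space \<Rightarrow> 'a) \<Rightarrow> ('a \<Rightarrow> real) \<Rightarrow> ('a \<times> 'a) set" where
  "diff_pairs T f = {(\<sigma>, \<tau>) \<in> supp_rel T. f \<sigma> = f \<tau>}"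

definition sharp :: "('a \<times> 'a) set \<Rightarrow> 'a set" where
  "sharp M = {\<sigma>. \<exists>\<tau>. (\<sigma>, \<tau>) \<in> M}"

definition flat :: "('a \<times> 'a) set \<Rightarrow> 'a set" where
  "flat M = {\<tau>. \<exists>\<sigma>. (\<sigma>, \<tau>) \<in> M}"

definition acyclic_pairing ::
    "('a::euclidean_space \<Rightarrow> 'a) \<Rightarrow> ('a \<times> 'a) set \<Rightarrow> bool" where
  "acyclic_pairing T M \<longleftrightarrow>
     M \<subseteq> supp_rel T \<and>
     (\<forall>\<sigma> \<tau> \<tau>'. (\<sigma>, \<tau>) \<in> M \<and> (\<sigma>, \<tau>') \<in> M \<longrightarrow> \<tau> = \<tau>') \<and>
     (\<forall>\<sigma> \<sigma>' \<tau>. (\<sigma>, \<tau>) \<in> M \<and> (\<sigma>', \<tau>) \<in> M \<longrightarrow> \<sigma> = \<sigma>') \<and>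
     invertible_on (sharp M) (flat M) (entry T) \<and>
     (\<exists>P. partial_order_on Basis P \<and>
        {(\<sigma>', \<sigma>). \<exists>\<tau>. (\<sigma>, \<tau>) \<in> M \<and> (\<sigma>', \<tau>) \<in> supp_rel T} \<subseteq> P) \<and>
     (\<exists>P. partial_order_on Basis P \<and>
        {(\<tau>, \<tau>'). \<exists>\<sigma>. (\<sigma>, \<tau>) \<in> M \<and> (\<sigma>, \<tau>') \<in> supp_rel T} \<subseteq> P)"

definition acyclic_fun :: "('a::euclidean_space \<Rightarrow> 'a) \<Rightarrow> ('a \<Rightarrow> real) \<Rightarrow> bool" where
  "acyclic_fun T f \<longleftrightarrow> acyclic_pairing T (diff_pairs T f)"

definition canted_fun :: "('a::euclidean_space \<Rightarrow> 'a) \<Rightarrow> ('a \<Rightarrow> real) \<Rightarrow> bool" where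
  "canted_fun T f \<longleftrightarrow> sharp (diff_pairs T f) \<inter> flat (diff_pairs T f) = {}"

definition critical :: "('a::euclidean_space \<Rightarrow> 'a) \<Rightarrow> ('a \<Rightarrow> real) \<Rightarrow> 'a set" where
  "critical T f = Basis - (sharp (diff_pairs T f) \<union> flat (diff_pairs T f))"

text \<open>The idempotent \<open>k\<close>, determined by its image and its kernel.\<close>

definition k_op :: "('a::euclidean_space \<Rightarrow> 'a) \<Rightarrow> ('a \<Rightarrow> real) \<Rightarrow> 'a \<Rightarrow> 'a" where
  "k_op T f = (THE k. linear k \<and> k \<circ> k = k \<and>
     range k = {v. \<forall>\<sigma>\<in>sharp (diff_pairs T f). T v \<bullet> \<sigma> = 0} \<and>
     {v. k v = 0} = span (flat (diff_pairs T f)))"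

section \<open>The deformed operator and its Laplacian\<close>

definition exp_op :: "real \<Rightarrow> ('a::euclidean_space \<Rightarrow> real) \<Rightarrow> 'a \<Rightarrow> 'a" where
  "exp_op t f v = (\<Sum>\<sigma>\<in>Basis. (exp (t * f \<sigma>) * (v \<bullet> \<sigma>)) *\<^sub>R \<sigma>)"

definition deform :: "('a::euclidean_space \<Rightarrow> 'a) \<Rightarrow> ('a \<Rightarrow> real) \<Rightarrow> real \<Rightarrow> 'a \<Rightarrow> 'a" where
  "deform T f t = exp_op t f \<circ> T \<circ> exp_op (- t) f"

definition laplacian :: "('a::euclidean_space \<Rightarrow> 'a) \<Rightarrow> ('a \<Rightarrow> real) \<Rightarrow> real \<Rightarrow> 'a \<Rightarrow> 'a" where
  "laplacian T f t v =
     deform T f t (adjoint (deform T f t) v) + adjoint (deform T f t) (deform T f t v)"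

definition eigenspace :: "('a::euclidean_space \<Rightarrow> 'a) \<Rightarrow> real \<Rightarrow> 'a set" where
  "eigenspace D \<mu> = {v. D v = \<mu> *\<^sub>R v}"

text \<open>
  The eigenvalues of a self-adjoint operator \<open>D\<close>, repeated according to multiplicity
  (geometric and algebraic multiplicity agree) and listed in increasing order; the valid
  indices are \<open>i < DIM('a)\<close>.
\<close>

definition eigenvalue_mset :: "('a::euclidean_space \<Rightarrow> 'a) \<Rightarrow> real multiset" where
  "eigenvalue_mset D =
     (\<Sum>\<mu> \<in> {\<mu>. \<exists>v. v \<noteq> 0 \<and> D v = \<mu> *\<^sub>R v}. replicate_mset (dim (eigenspace D \<mu>)) \<mu>)"

definition nth_eigenvalue :: "('a::euclidean_space \<Rightarrow> 'a) \<Rightarrow> nat \<Rightarrow> real" where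
  "nth_eigenvalue D i = sorted_list_of_multiset (eigenvalue_mset D) ! i"

text \<open>
  \<open>W(t)\<close> is spanned by the eigenvectors of the Laplacian belonging to those eigenvalue branches
  that tend to 0 as \<open>t \<rightarrow> +\<infinity>\<close>.
\<close>

definition vanishing_indices :: "('a::euclidean_space \<Rightarrow> 'a) \<Rightarrow> ('a \<Rightarrow> real) \<Rightarrow> nat set" where
  "vanishing_indices T f =
     {i. i < DIM('a) \<and> ((\<lambda>t. nth_eigenvalue (laplacian T f t) i) \<longlongrightarrow> 0) at_top}"

definition W_space :: "('a::euclidean_space \<Rightarrow> 'a) \<Rightarrow> ('a \<Rightarrow> real) \<Rightarrow> real \<Rightarrow> 'a set" where
  "W_space T f t =
     span (\<Union>i\<in>vanishing_indices T f.
       eigenspace (laplacian T f t) (nth_eigenvalue (laplacian T f t) i))"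

section \<open>The orthonormal basis of \<open>W(t)\<close>\<close>

definition orth_proj :: "'a::euclidean_space set \<Rightarrow> 'a \<Rightarrow> 'a" where
  "orth_proj S v = (THE w. w \<in> S \<and> (\<forall>u\<in>S. orthogonal (v - w) u))"

definition g_vec :: "('a::euclidean_space \<Rightarrow> 'a) \<Rightarrow> ('a \<Rightarrow> real) \<Rightarrow> real \<Rightarrow> 'a \<Rightarrow> 'a" where
  "g_vec T f t \<sigma> = orth_proj (W_space T f t) \<sigma>"

definition gram :: "('a::euclidean_space \<Rightarrow> 'a) \<Rightarrow> ('a \<Rightarrow> real) \<Rightarrow> real \<Rightarrow> 'a \<Rightarrow> 'a \<Rightarrow> real" where
  "gram T f t \<sigma>\<^sub>1 \<sigma>\<^sub>2 = g_vec T f t \<sigma>\<^sub>1 \<bullet> g_vec T f t \<sigma>\<^sub>2"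

definition h_vec :: "('a::euclidean_space \<Rightarrow> 'a) \<Rightarrow> ('a \<Rightarrow> real) \<Rightarrow> real \<Rightarrow> 'a \<Rightarrow> 'a" where
  "h_vec T f t \<sigma> =
     (\<Sum>\<sigma>'\<in>critical T f. inv_sqrt_on (critical T f) (gram T f t) \<sigma> \<sigma>' *\<^sub>R g_vec T f t \<sigma>')"

end

theory Submission
  imports Defs
begin

text \<open>
  Conjugating by \<open>e\<^sup>t\<^sup>f\<close> turns \<open>T\<^sub>t\<close> into \<open>T\<close> and multiplies the \<open>(\<tau>, \<sigma>)\<close> entry of an operator by
  \<open>exp (t * (f \<sigma> - f \<tau>))\<close>. Writing \<open>h\<^sub>\<sigma> = \<pi>\<^sub>t S\<^sub>t \<sigma>\<close>, where \<open>S\<^sub>t\<close> is the inverse square root of the Gram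
  matrix, it therefore suffices that the conjugates of \<open>\<pi>\<^sub>t\<close> and \<open>S\<^sub>t\<close> converge exponentially fast to
  operators \<open>X\<close> and \<open>1\<close> with \<open>\<langle>X T X \<sigma>, \<tau>\<rangle> = \<langle>T k \<sigma>, \<tau>\<rangle>\<close>.

  The conjugate of \<open>T\<^sub>t\<^sup>*\<close> converges to \<open>B\<close>, the adjoint of the part of \<open>T\<close> supported on \<open>df\<close>, so the
  conjugate of the Laplacian converges to \<open>A = T B + B T\<close>. Conjugation may magnify errors by a factor
  \<open>e\<^sup>K\<^sup>t\<close>, but \<open>\<pi>\<^sub>t\<close> is approximated up to \<open>O(e\<^sup>-\<^sup>N\<^sup>t)\<close>, for any given \<open>N\<close>, by a fixed polynomial in the
  Laplacian, and likewise \<open>S\<^sub>t\<close> by a polynomial in the Gram matrix; polynomials commute with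
  conjugation. Hence \<open>X\<close> is a polynomial in \<open>A\<close>. It fixes \<open>k \<sigma>\<close>, which lies in the kernel of \<open>A\<close>, and
  it kills the span of \<open>df\<^sup>\<flat>\<close>, on which \<open>A\<close> is injective.
\<close>

text \<open>The obstacle is that e^(tf) is not orthogonal: norm estimates for the Laplacian say
  nothing directly about its conjugate, and A is not self-adjoint, so the spectral theorem is
  available only before conjugation. The decay that beats the magnification is manufactured. The
  cubic 3x^2 - 2x^3 squares the distance from x to an idempotent commuting with x, so n steps turn a
  rate a into 2^n a; for S_t an iteration gaining a factor e^(at) per step suffices. The starting
  polynomial is the product of 1 - x/w over the nonzero eigenvalues w of the unconjugated limit
  Laplacian. That limit is diagonal in E because df is a matching, and the w are the squares of the
  paired entries of T. The same device explains why X kills the span of df flat: the N-th power of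
  the Laplacian times the projection decays at a rate proportional to N, so for large N its
  conjugate tends to 0 and A^N X = 0. Being a polynomial in A, X preserves that span, where A^N is
  injective; injectivity is where the invertibility of the submatrix of T enters.\<close>

section \<open>Exponential bounds and exponentially fast convergence\<close>

definition expO :: "real \<Rightarrow> (real \<Rightarrow> 'b::real_normed_vector) \<Rightarrow> bool" where
  "expO a u \<longleftrightarrow> (\<exists>K. \<forall>\<^sub>F t in at_top. norm (u t) \<le> K * exp (a * t))"

text \<open>The rate is left existential: only its sign matters, and sums of terms with different
  negative rates stay inside the notion.\<close>

definition esmall :: "(real \<Rightarrow> 'b::real_normed_vector) \<Rightarrow> bool" where
  "esmall u \<longleftrightarrow> (\<exists>a<0. expO a u)"

text \<open>Unlike a bare limit, this provides a definite negative exponent that an iteration can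
  multiply, and it is preserved by the ring operations, hence by polynomials.\<close>

definition econv :: "(real \<Rightarrow> 'b::real_normed_vector) \<Rightarrow> 'b \<Rightarrow> bool" where
  "econv u l \<longleftrightarrow> esmall (\<lambda>t. u t - l)"

text \<open>\<open>expO\<close> is phrased with norms so that it applies to operator-valued
  functions; only the final real-valued estimate is turned into a Landau symbol.\<close>

lemma expO_iff_bigo:
  fixes u :: "real \<Rightarrow> real"
  shows "expO a u \<longleftrightarrow> u \<in> O[at_top](\<lambda>t. exp (a * t))"
  unfolding expO_def bigo_def
proof safe
  fix K assume *: "\<forall>\<^sub>F t in at_top. norm (u t) \<le> K * exp (a * t)"
  show "\<exists>c>0. \<forall>\<^sub>F x in at_top. norm (u x) \<le> c * norm (exp (a * x))"
  proof (intro exI conjI)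
    show "0 < max K 1" by simp
    show "\<forall>\<^sub>F x in at_top. norm (u x) \<le> max K 1 * norm (exp (a * x))"
      using * by eventually_elim (auto intro: order_trans mult_right_mono)
  qed
next
  fix c assume "\<forall>\<^sub>F x in at_top. norm (u x) \<le> c * norm (exp (a * x))"
  then show "\<exists>K. \<forall>\<^sub>F t in at_top. norm (u t) \<le> K * exp (a * t)" by auto
qed

lemma expO_mono: "expO a u \<Longrightarrow> a \<le> b \<Longrightarrow> expO b u"
  unfolding expO_def
proof (elim exE)
  fix K assume *: "\<forall>\<^sub>F t in at_top. norm (u t) \<le> K * exp (a * t)" and "a \<le> b"
  have "\<forall>\<^sub>F t in at_top. norm (u t) \<le> \<bar>K\<bar> * exp (b * t)"
    using * eventually_ge_at_top[of 0]
  proof eventually_elim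
    case (elim t)
    have "K * exp (a * t) \<le> \<bar>K\<bar> * exp (b * t)"
      by (rule mult_mono) (use elim \<open>a \<le> b\<close> in \<open>auto intro: mult_right_mono\<close>)
    then show ?case using elim by linarith
  qed
  then show "\<exists>K. \<forall>\<^sub>F t in at_top. norm (u t) \<le> K * exp (b * t)" by blast
qed

lemma expO_eventually_le:
  assumes "expO a v" "\<forall>\<^sub>F t in at_top. norm (u t) \<le> c * norm (v t)" "0 \<le> c"
  shows "expO a u"
proof -
  obtain K where "\<forall>\<^sub>F t in at_top. norm (v t) \<le> K * exp (a * t)"
    using assms(1) by (auto simp: expO_def)
  with assms(2) have "\<forall>\<^sub>F t in at_top. norm (u t) \<le> (c * K) * exp (a * t)"
  proof eventually_elim
    case (elim t)
    then show ?case using mult_left_mono[OF elim(2) assms(3)] by (simp add: mult.assoc)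
  qed
  then show ?thesis by (auto simp: expO_def)
qed

lemma expO_add: "expO a u \<Longrightarrow> expO a v \<Longrightarrow> expO a (\<lambda>t. u t + v t)"
  unfolding expO_def
proof (elim exE)
  fix K L assume "\<forall>\<^sub>F t in at_top. norm (u t) \<le> K * exp (a * t)"
    "\<forall>\<^sub>F t in at_top. norm (v t) \<le> L * exp (a * t)"
  then have "\<forall>\<^sub>F t in at_top. norm (u t + v t) \<le> (K + L) * exp (a * t)"
  proof eventually_elim
    case (elim t)
    then show ?case using norm_triangle_ineq[of "u t" "v t"] by (simp add: distrib_right)
  qed
  then show "\<exists>K. \<forall>\<^sub>F t in at_top. norm (u t + v t) \<le> K * exp (a * t)" by blast
qed

lemma expO_mult:
  fixes u v :: "real \<Rightarrow> 'b::real_normed_algebra"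
  shows "expO a u \<Longrightarrow> expO b v \<Longrightarrow> expO (a + b) (\<lambda>t. u t * v t)"
  unfolding expO_def
proof (elim exE)
  fix K L assume "\<forall>\<^sub>F t in at_top. norm (u t) \<le> K * exp (a * t)"
    "\<forall>\<^sub>F t in at_top. norm (v t) \<le> L * exp (b * t)"
  then have "\<forall>\<^sub>F t in at_top. norm (u t * v t) \<le> (K * L) * exp ((a + b) * t)"
  proof eventually_elim
    case (elim t)
    have "norm (u t * v t) \<le> norm (u t) * norm (v t)" by (rule norm_mult_ineq)
    also have "\<dots> \<le> (K * exp (a * t)) * (L * exp (b * t))"
      by (rule mult_mono) (use elim order_trans[OF norm_ge_zero elim(1)] in auto)
    also have "\<dots> = (K * L) * exp ((a + b) * t)" by (simp add: exp_add distrib_right)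
    finally show ?case .
  qed
  then show "\<exists>K. \<forall>\<^sub>F t in at_top. norm (u t * v t) \<le> K * exp ((a + b) * t)" by blast
qed

lemma expO_const: "0 \<le> a \<Longrightarrow> expO a (\<lambda>t. c)"
  by (rule expO_mono[of 0]) (auto simp: expO_def)

lemma expO_cong: "\<forall>\<^sub>F t in at_top. u t = v t \<Longrightarrow> expO a u \<Longrightarrow> expO a v"
  by (erule expO_eventually_le[where c = 1]) (auto elim: eventually_mono)

lemma expO_scaleR: "expO a u \<Longrightarrow> expO a (\<lambda>t. c *\<^sub>R u t)"
  by (erule expO_eventually_le[where c = "\<bar>c\<bar>"]) auto

lemma expO_minus: "expO a u \<Longrightarrow> expO a (\<lambda>t. - u t)"
  by (erule expO_eventually_le[where c = 1]) auto

lemma expO_diff: "expO a u \<Longrightarrow> expO a v \<Longrightarrow> expO a (\<lambda>t. u t - v t)"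
  using expO_add[OF _ expO_minus] by fastforce

lemma esmallI: "expO a u \<Longrightarrow> a < 0 \<Longrightarrow> esmall u"
  by (auto simp: esmall_def)

lemma esmall_imp_expO0: "esmall u \<Longrightarrow> expO 0 u"
  by (auto simp: esmall_def intro: expO_mono)

lemma esmall_zero [simp]: "esmall (\<lambda>t. 0)"
  unfolding esmall_def expO_def by (rule exI[of _ "-1"]) (auto intro: exI[of _ 0])

lemma esmall_eventually_le:
  "esmall v \<Longrightarrow> \<forall>\<^sub>F t in at_top. norm (u t) \<le> c * norm (v t) \<Longrightarrow> 0 \<le> c \<Longrightarrow> esmall u"
  by (auto simp: esmall_def intro: expO_eventually_le)

lemma esmall_norm_le:
  "esmall v \<Longrightarrow> \<forall>\<^sub>F t in at_top. norm (u t) \<le> norm (v t) \<Longrightarrow> esmall u"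
  by (rule esmall_eventually_le[where c = 1]) auto

lemma esmall_add: "esmall u \<Longrightarrow> esmall v \<Longrightarrow> esmall (\<lambda>t. u t + v t)"
  unfolding esmall_def
proof (elim exE conjE)
  fix a b :: real assume "a < 0" "b < 0" "expO a u" "expO b v"
  then show "\<exists>a<0. expO a (\<lambda>t. u t + v t)"
    by (intro exI[of _ "max a b"] conjI expO_add) (auto intro: expO_mono)
qed

lemma esmall_minus: "esmall u \<Longrightarrow> esmall (\<lambda>t. - u t)"
  by (auto simp: esmall_def intro: expO_minus)

lemma esmall_diff: "esmall u \<Longrightarrow> esmall v \<Longrightarrow> esmall (\<lambda>t. u t - v t)"
  using esmall_add[OF _ esmall_minus] by fastforce

lemma esmall_scaleR: "esmall u \<Longrightarrow> esmall (\<lambda>t. c *\<^sub>R u t)"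
  by (auto simp: esmall_def intro: expO_scaleR)

lemma esmall_mult_left:
  fixes u v :: "real \<Rightarrow> 'b::real_normed_algebra"
  shows "expO 0 u \<Longrightarrow> esmall v \<Longrightarrow> esmall (\<lambda>t. u t * v t)"
  unfolding esmall_def using expO_mult[of 0 u _ v] by auto

lemma esmall_mult_right:
  fixes u v :: "real \<Rightarrow> 'b::real_normed_algebra"
  shows "esmall u \<Longrightarrow> expO 0 v \<Longrightarrow> esmall (\<lambda>t. u t * v t)"
  unfolding esmall_def using expO_mult[of _ u 0 v] by auto

lemma esmall_sum:
  "finite I \<Longrightarrow> (\<And>i. i \<in> I \<Longrightarrow> esmall (\<lambda>t. u t i)) \<Longrightarrow> esmall (\<lambda>t. \<Sum>i\<in>I. u t i)"
  by (induction I rule: finite_induct) (auto intro: esmall_add)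

lemma esmall_tendsto:
  assumes "esmall u" shows "(u \<longlongrightarrow> 0) at_top"
proof -
  obtain a K where a: "a < 0" and K: "\<forall>\<^sub>F t in at_top. norm (u t) \<le> K * exp (a * t)"
    using assms by (auto simp: esmall_def expO_def)
  have "filterlim (\<lambda>t. a * t) at_bot at_top"
    using a by (auto intro!: filterlim_tendsto_neg_mult_at_bot[OF tendsto_const] filterlim_ident)
  then have "((\<lambda>t. K * exp (a * t)) \<longlongrightarrow> K * 0) at_top"
    by (intro tendsto_intros filterlim_compose[OF exp_at_bot])
  then show ?thesis by (intro Lim_null_comparison[OF K]) simp
qed

lemma esmall_eventually_less: "esmall u \<Longrightarrow> 0 < e \<Longrightarrow> \<forall>\<^sub>F t in at_top. norm (u t) < e"
  using esmall_tendsto[of u] by (auto simp: tendsto_iff dist_norm)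

lemma esmall_const_iff: "esmall (\<lambda>t. c) \<longleftrightarrow> c = 0"
  using esmall_tendsto[of "\<lambda>t. c"] by (auto simp: tendsto_const_iff)

lemma econv_const [simp]: "econv (\<lambda>t. c) c"
  by (simp add: econv_def)

text \<open>The difference of two limits is a constant that decays, hence 0. This is how asymptotics
  become algebraic identities between limit operators.\<close>

lemma econv_unique: "econv u l \<Longrightarrow> econv u m \<Longrightarrow> l = m"
  using esmall_diff[of "\<lambda>t. u t - l" "\<lambda>t. u t - m"] by (simp add: econv_def esmall_const_iff)

lemma econv_zero_iff: "econv u 0 \<longleftrightarrow> esmall u"
  by (simp add: econv_def)

lemma econv_add: "econv u l \<Longrightarrow> econv v m \<Longrightarrow> econv (\<lambda>t. u t + v t) (l + m)"
  using esmall_add[of "\<lambda>t. u t - l" "\<lambda>t. v t - m"] by (simp add: econv_def algebra_simps)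

lemma econv_diff: "econv u l \<Longrightarrow> econv v m \<Longrightarrow> econv (\<lambda>t. u t - v t) (l - m)"
  using esmall_diff[of "\<lambda>t. u t - l" "\<lambda>t. v t - m"] by (simp add: econv_def algebra_simps)

lemma econv_scaleR: "econv u l \<Longrightarrow> econv (\<lambda>t. c *\<^sub>R u t) (c *\<^sub>R l)"
  using esmall_scaleR[of "\<lambda>t. u t - l" c] by (simp add: econv_def algebra_simps)

lemma econv_imp_expO0: "econv u l \<Longrightarrow> expO 0 u"
  using expO_add[OF esmall_imp_expO0 expO_const, of "\<lambda>t. u t - l" l] by (simp add: econv_def)

lemma econv_esmall_diff: "econv u l \<Longrightarrow> esmall (\<lambda>t. u t - v t) \<Longrightarrow> econv v l"
  unfolding econv_def using esmall_diff[of "\<lambda>t. u t - l" "\<lambda>t. u t - v t"] by simp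

lemma econv_mult:
  fixes u v :: "real \<Rightarrow> 'b::real_normed_algebra"
  assumes "econv u l" "econv v m" shows "econv (\<lambda>t. u t * v t) (l * m)"
proof -
  have "esmall (\<lambda>t. u t * (v t - m) + (u t - l) * m)"
    using assms by (intro esmall_add esmall_mult_left esmall_mult_right expO_const econv_imp_expO0[of u l])
      (auto simp: econv_def)
  then show ?thesis by (simp add: econv_def algebra_simps)
qed

lemma econv_power:
  fixes u :: "real \<Rightarrow> 'b::real_normed_algebra_1"
  shows "econv u l \<Longrightarrow> econv (\<lambda>t. u t ^ n) (l ^ n)"
  by (induction n) (auto intro: econv_mult)

section \<open>Approximating a spectral projection by polynomials\<close>

text \<open>The product of the factors 1 - x/\<mu>: it is 1 at 0 and vanishes at every nonzero \<mu>
  of the list. Fed with the nonzero eigenvalues of a diagonalisable operator, it gives the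
  projection onto the kernel.\<close>

primrec vanishing_poly :: "real list \<Rightarrow> 'b::real_normed_algebra_1 \<Rightarrow> 'b" where
  "vanishing_poly [] x = 1"
| "vanishing_poly (\<mu> # l) x = vanishing_poly l x * (1 - (1 / \<mu>) *\<^sub>R x)"

text \<open>Newton's iteration towards an idempotent; it converges quadratically.\<close>

definition purify :: "'b::real_normed_algebra_1 \<Rightarrow> 'b" where
  "purify x = 3 *\<^sub>R (x * x) - 2 *\<^sub>R (x * x * x)"

lemma econv_vanishing_poly:
  "econv u l \<Longrightarrow> econv (\<lambda>t. vanishing_poly ms (u t)) (vanishing_poly ms l)"
  by (induction ms) (auto intro!: econv_mult econv_diff econv_scaleR)

text \<open>The polynomial minus 1 has no constant term, so up to bounded factors it is divisible by
  D, and D P decays. The boundedness claim is carried along for the induction.\<close>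

lemma esmall_vanishing_poly_minus_one:
  fixes D P :: "real \<Rightarrow> 'b::real_normed_algebra_1"
  assumes D: "expO 0 D" and DP: "esmall (\<lambda>t. D t * P t)"
  shows "expO 0 (\<lambda>t. vanishing_poly ms (D t))"
    and "esmall (\<lambda>t. (vanishing_poly ms (D t) - 1) * P t)"
proof (induction ms)
  case (Cons \<mu> ms)
  show "expO 0 (\<lambda>t. vanishing_poly (\<mu> # ms) (D t))"
    using expO_mult[OF Cons.IH(1) expO_diff[OF expO_const[of 0 1] expO_scaleR[OF D, of "1 / \<mu>"]]] by simp
  have "esmall (\<lambda>t. (vanishing_poly ms (D t) - 1) * P t - (1 / \<mu>) *\<^sub>R (vanishing_poly ms (D t) * (D t * P t)))"
    by (intro esmall_diff esmall_scaleR esmall_mult_left Cons.IH DP)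
  then show "esmall (\<lambda>t. (vanishing_poly (\<mu> # ms) (D t) - 1) * P t)"
    by (simp add: algebra_simps)
qed (auto intro: expO_const)

lemma econv_purify: "econv u l \<Longrightarrow> econv (\<lambda>t. (purify ^^ n) (u t)) ((purify ^^ n) l)"
proof (induction n)
  case (Suc n)
  have "econv (\<lambda>t. purify ((purify ^^ n) (u t))) (purify ((purify ^^ n) l))"
    unfolding purify_def[of "(purify ^^ n) _"] using Suc
    by (intro econv_diff econv_scaleR econv_mult) auto
  then show ?case by simp
qed simp

text \<open>Conjugation respects products as soon as \<open>u * v = 1\<close>. The other identity
  \<open>v * u = 1\<close> is assumed only for expressions containing the unit;
  \<open>purify\<close> and \<open>root_iter\<close> have no constant term.\<close>

lemma conj_mult:
  fixes u v :: "'b::ring_1" assumes "u * v = 1"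
  shows "v * (x * y) * u = (v * x * u) * (v * y * u)"
proof -
  have "(v * x * u) * (v * y * u) = v * x * (u * v) * y * u" by (simp only: mult.assoc)
  then show ?thesis by (simp add: assms mult.assoc)
qed

lemma conj_power:
  fixes u v :: "'b::ring_1" assumes "u * v = 1" "v * u = 1"
  shows "v * x ^ n * u = (v * x * u) ^ n"
  by (induction n) (auto simp: assms conj_mult[OF assms(1)])

lemma conj_vanishing_poly:
  assumes "u * v = 1" "v * u = 1"
  shows "v * vanishing_poly ms x * u = vanishing_poly ms (v * x * u)"
  by (induction ms) (auto simp: assms conj_mult[OF assms(1)], simp add: algebra_simps assms)

lemma conj_purify:
  assumes "u * v = 1"
  shows "v * (purify ^^ n) x * u = (purify ^^ n) (v * x * u)"
proof (induction n)
  case (Suc n)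
  have "v * purify y * u = purify (v * y * u)" for y
    unfolding purify_def
    by (simp only: right_diff_distrib left_diff_distrib mult_scaleR_right mult_scaleR_left
        conj_mult[OF assms])
  then show ?case using Suc by simp
qed simp

lemma vanishing_poly_commute:
  "x * p = p * x \<Longrightarrow> vanishing_poly ms x * p = p * vanishing_poly ms x"
proof (induction ms)
  case (Cons \<mu> ms)
  have "(1 - (1 / \<mu>) *\<^sub>R x) * p = p * (1 - (1 / \<mu>) *\<^sub>R x)"
    using Cons.prems by (simp add: algebra_simps)
  then show ?case using Cons by (simp add: mult.assoc) (simp add: mult.assoc[symmetric])
qed simp

lemma purify_commute: "x * p = p * x \<Longrightarrow> (purify ^^ n) x * p = p * (purify ^^ n) x"
proof (induction n)
  case (Suc n)
  have 1: "y * p = p * y \<Longrightarrow> (y * y) * p = p * (y * y)" for y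
    by (metis mult.assoc)
  have 2: "y * p = p * y \<Longrightarrow> (y * y * y) * p = p * (y * y * y)" for y
    by (metis mult.assoc)
  have "y * p = p * y \<Longrightarrow> purify y * p = p * purify y" for y
    unfolding purify_def using 1[of y] 2[of y] by (simp add: algebra_simps)
  then show ?case using Suc by simp
qed simp

text \<open>The derivative 6x - 6x^2 of the cubic vanishes at idempotents, so the expansion around p
  starts with the square of x - p. Commutation of x and p makes the expansion legitimate.\<close>

lemma purify_error:
  fixes x p :: "'b::real_normed_algebra_1"
  assumes pp: "p * p = p" and c: "x * p = p * x"
  shows "purify x - p = (x - p) * (x - p) * (3 *\<^sub>R 1 - 6 *\<^sub>R p - 2 *\<^sub>R (x - p))"
proof -
  define y where "y = x - p"
  have x: "x = p + y" by (simp add: y_def)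
  have yp: "y * p = p * y" using c pp by (simp add: y_def algebra_simps)
  have yp': "y * (p * z) = p * (y * z)" for z by (metis mult.assoc yp)
  have pp': "p * (p * z) = p * z" for z by (metis mult.assoc pp)
  have three: "3 *\<^sub>R z = z + z + z" for z :: 'b
    using scaleR_add_left[of 2 1 z] by (simp add: scaleR_2)
  have six: "6 *\<^sub>R z = z + z + z + z + z + z" for z :: 'b
    using scaleR_add_left[of 3 3 z] by (simp add: three algebra_simps)
  have "purify (p + y) - p = y * y * (3 *\<^sub>R 1 - 6 *\<^sub>R p - 2 *\<^sub>R y)"
    unfolding purify_def
    by (simp add: algebra_simps pp pp' yp yp') (simp add: scaleR_2 three six)
  then show ?thesis by (simp add: x)
qed

text \<open>Each step squares the error up to a bounded factor, so the rate doubles. Idempotence and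
  commutation are required only eventually, as this is all that is known of the spectral
  projection.\<close>

lemma purify_expO:
  assumes a: "a \<le> 0" "expO a (\<lambda>t. q t - p t)" and pb: "expO 0 p"
    and pp: "\<forall>\<^sub>F t in at_top. p t * p t = p t" and c: "\<forall>\<^sub>F t in at_top. q t * p t = p t * q t"
  shows "expO (2 ^ n * a) (\<lambda>t. (purify ^^ n) (q t) - p t)"
proof (induction n)
  case 0 then show ?case using a by simp
next
  case (Suc n)
  let ?x = "\<lambda>t. (purify ^^ n) (q t)"
  have "2 ^ n * a \<le> 0" using a(1) by (simp add: mult_nonneg_nonpos)
  then have x0: "expO 0 (\<lambda>t. ?x t - p t)" using Suc by (rule expO_mono[rotated])
  have "expO 0 (\<lambda>t. 3 *\<^sub>R 1 - 6 *\<^sub>R p t - 2 *\<^sub>R (?x t - p t))"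
    by (intro expO_diff[OF expO_diff] expO_scaleR pb x0 expO_const) simp
  then have "expO (2 ^ n * a + 2 ^ n * a + 0)
      (\<lambda>t. (?x t - p t) * (?x t - p t) * (3 *\<^sub>R 1 - 6 *\<^sub>R p t - 2 *\<^sub>R (?x t - p t)))"
    by (intro expO_mult Suc)
  then have "expO (2 ^ n * a + 2 ^ n * a + 0) (\<lambda>t. purify (?x t) - p t)"
    by (rule expO_cong[rotated])
       (use pp c in eventually_elim, auto simp: purify_error purify_commute)
  then show ?case by (simp add: algebra_simps)
qed

text \<open>Each of the two conjugating factors costs a rate K; the total 2K is the loss that the
  later choices of the number of iterations must beat.\<close>

lemma conj_expO:
  fixes x :: "real \<Rightarrow> 'b::real_normed_algebra_1"
  assumes "expO K u" "expO K v" "expO a x" shows "expO (2 * K + a) (\<lambda>t. v t * x t * u t)"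
  using expO_mult[OF expO_mult[OF assms(2,3)] assms(1)] by (simp add: algebra_simps)

lemma ex_pow2_mult_less:
  fixes a K :: real assumes "a < 0" shows "\<exists>n. K + 2 ^ n * a < 0"
proof -
  obtain n where "K / (- a) < 2 ^ n" using real_arch_pow[of 2] by auto
  then show ?thesis using assms by (intro exI[of _ n]) (simp add: field_simps)
qed

lemma ex_nat_mult_less:
  fixes a K :: real assumes "a < 0" shows "\<exists>n. K + real n * a < 0"
proof -
  obtain n where "K / (- a) < real n" using reals_Archimedean2 by blast
  then show ?thesis using assms by (intro exI[of _ n]) (simp add: field_simps)
qed

text \<open>A polynomial Q(D) that approximates P faster than conjugation magnifies errors has the
  same conjugated limit as P, and the conjugate of Q(D) is Q at the conjugate of D, hence tends to
  Q(A). The second claim compares two limits of the conjugate of D^N P: it decays for large N, and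
  it tends to A^N Q(A).\<close>

lemma projection_conj_econv:
  fixes D P u v :: "real \<Rightarrow> 'b::real_normed_algebra_1"
  assumes uv: "\<And>t. u t * v t = 1" "\<And>t. v t * u t = 1" and uK: "expO K u" and vK: "expO K v"
    and P: "expO 0 P" "\<forall>\<^sub>F t in at_top. P t * P t = P t" "\<forall>\<^sub>F t in at_top. D t * P t = P t * D t"
    and van: "esmall (\<lambda>t. vanishing_poly ms (D t) - P t)"
    and DP: "esmall (\<lambda>t. D t * P t)"
    and conv: "econv (\<lambda>t. v t * D t * u t) A"
  obtains n N where "econv (\<lambda>t. v t * P t * u t) ((purify ^^ n) (vanishing_poly ms A))"
    and "A ^ N * (purify ^^ n) (vanishing_poly ms A) = 0"
proof -
  obtain a where a: "a < 0" "expO a (\<lambda>t. vanishing_poly ms (D t) - P t)"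
    using van by (auto simp: esmall_def)
  \<comment> \<open>The vanishing polynomial alone has error rate a, possibly too weak; n
    purifications sharpen it to 2^n a.\<close>
  obtain n where n: "2 * K + 2 ^ n * a < 0" using ex_pow2_mult_less[OF a(1)] by blast
  let ?Q = "\<lambda>t. (purify ^^ n) (vanishing_poly ms (D t))"
  have "expO (2 ^ n * a) (\<lambda>t. ?Q t - P t)"
  proof (rule purify_expO)
    show "\<forall>\<^sub>F t in at_top. vanishing_poly ms (D t) * P t = P t * vanishing_poly ms (D t)"
      using P(3) by eventually_elim (rule vanishing_poly_commute)
  qed (use a P in auto)
  from conj_expO[OF uK vK this] n
  have "esmall (\<lambda>t. v t * (?Q t - P t) * u t)" by (rule esmallI)
  then have s: "esmall (\<lambda>t. v t * ?Q t * u t - v t * P t * u t)"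
    by (simp only: right_diff_distrib left_diff_distrib)
  have "econv (\<lambda>t. v t * ?Q t * u t) ((purify ^^ n) (vanishing_poly ms A))"
    unfolding conj_purify[OF uv(1)] conj_vanishing_poly[OF uv]
    by (intro econv_purify econv_vanishing_poly conv)
  from econv_esmall_diff[OF this s]
  have X: "econv (\<lambda>t. v t * P t * u t) ((purify ^^ n) (vanishing_poly ms A))" .
  obtain b where b: "b < 0" "expO b (\<lambda>t. D t * P t)" using DP by (auto simp: esmall_def)
  obtain N where N: "2 * K + real N * b < 0" using ex_nat_mult_less[OF b(1)] by blast
  have Nb: "expO (real m * b) (\<lambda>t. (D t ^ m) * P t)" for m
  proof (induction m)
    case 0 then show ?case using P by simp
  next
    case (Suc m)
    \<comment> \<open>As P is idempotent and commutes with D, multiplying D^m P by D P gives D^(m+1)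
      P.\<close>
    have "expO (real m * b + b) (\<lambda>t. ((D t ^ m) * P t) * (D t * P t))"
      by (rule expO_mult[OF Suc b(2)])
    then have "expO (real m * b + b) (\<lambda>t. (D t ^ Suc m) * P t)"
      by (rule expO_cong[rotated])
         (use P(2,3) in eventually_elim, metis mult.assoc power_Suc2)
    then show ?case by (simp add: algebra_simps)
  qed
  have "esmall (\<lambda>t. v t * (D t ^ N * P t) * u t)"
    using conj_expO[OF uK vK Nb] N by (rule esmallI)
  then have "econv (\<lambda>t. v t * (D t ^ N * P t) * u t) 0" by (simp add: econv_zero_iff)
  moreover have "econv (\<lambda>t. v t * (D t ^ N * P t) * u t) (A ^ N * (purify ^^ n) (vanishing_poly ms A))"
    unfolding conj_mult[OF uv(1)] conj_power[OF uv] by (intro econv_mult econv_power conv X)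
  ultimately have "A ^ N * (purify ^^ n) (vanishing_poly ms A) = 0" using econv_unique by blast
  with X that show ?thesis by blast
qed

section \<open>Approximating an inverse square root by polynomials\<close>

text \<open>
  Fixed-point iteration for \<open>y\<close> in \<open>(1 + y)\<^sup>2 (1 + h) = 1\<close>.
\<close>

primrec root_iter :: "'b::real_normed_algebra_1 \<Rightarrow> nat \<Rightarrow> 'b" where
  "root_iter h 0 = 0"
| "root_iter h (Suc n) = (- 1 / 2) *\<^sub>R
     (h + 2 *\<^sub>R (root_iter h n * h) + root_iter h n * root_iter h n + root_iter h n * root_iter h n * h)"

lemma esmall_root_iter: "esmall h \<Longrightarrow> esmall (\<lambda>t. root_iter (h t) n)"
proof (induction n)
  case (Suc n)
  then have *: "esmall (\<lambda>t. root_iter (h t) n)" by blast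
  note b = esmall_imp_expO0[OF Suc.prems] esmall_imp_expO0[OF *]
  show ?case unfolding root_iter.simps
    by (intro esmall_scaleR esmall_add Suc.prems esmall_mult_left b *
        esmall_mult_left[OF _ esmall_mult_left] esmall_mult_right[OF esmall_mult_right])
qed simp

lemma conj_root_iter:
  assumes "u * v = 1"
  shows "v * root_iter h n * u = root_iter (v * h * u) n"
proof (induction n)
  case (Suc n)
  then show ?case unfolding root_iter.simps
    by (simp only: distrib_left distrib_right mult_scaleR_left mult_scaleR_right conj_mult[OF assms] Suc)
qed simp

text \<open>Solve the expanded equation for 2y and subtract the iteration. Since y and the iterate z
  are not assumed to commute, y^2 - z^2 is split as y(y - z) + (y - z)z. Every term of the new error
  contains the old one and a further factor y, z or h, which is the gain per step.\<close>

lemma root_iter_error: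
  fixes y :: "'b::real_normed_algebra_1"
  assumes "(1 + y) * (1 + y) * (1 + h) = 1"
  shows "y - root_iter h (Suc n) = (- 1 / 2) *\<^sub>R (2 *\<^sub>R ((y - root_iter h n) * h)
      + (y * (y - root_iter h n) + (y - root_iter h n) * root_iter h n) * (1 + h))"
proof -
  define z where "z = root_iter h n"
  have "h + 2 *\<^sub>R y + 2 *\<^sub>R (y * h) + y * y + y * y * h = 0"
    using assms by (simp add: algebra_simps scaleR_2)
  then have "2 *\<^sub>R y = - (h + 2 *\<^sub>R (y * h) + y * y + y * y * h)"
    by (simp add: algebra_simps eq_neg_iff_add_eq_0)
  then have y: "y = (- 1 / 2) *\<^sub>R (h + 2 *\<^sub>R (y * h) + y * y + y * y * h)"
    by (metis (no_types, opaque_lifting) divide_minus_left mult_2 scaleR_half_double scaleR_2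
        scaleR_minus_left scaleR_minus_right scaleR_scaleR minus_minus divide_self_if
        nonzero_mult_div_cancel_left scaleR_one times_divide_eq_left zero_neq_numeral mult_1)
  have "y - root_iter h (Suc n) = (- 1 / 2) *\<^sub>R (h + 2 *\<^sub>R (y * h) + y * y + y * y * h)
     - (- 1 / 2) *\<^sub>R (h + 2 *\<^sub>R (z * h) + z * z + z * z * h)"
    using y by (simp add: z_def)
  also have "\<dots> = (- 1 / 2) *\<^sub>R (2 *\<^sub>R ((y - z) * h) + (y * (y - z) + (y - z) * z) * (1 + h))"
    unfolding scaleR_diff_right[symmetric] by (rule arg_cong[where f = "scaleR _"]) (simp add: algebra_simps)
  finally show ?thesis by (simp add: z_def)
qed

text \<open>Write S = 1 + y and G = 1 + h. The N-th iterate approximates y at rate N a, enough to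
  survive conjugation for large N. The conjugated iterate is the iterate at the conjugate of h,
  which decays by the hypothesis on G.\<close>

lemma inverse_root_conj_esmall:
  fixes S G u v :: "real \<Rightarrow> 'b::real_normed_algebra_1"
  assumes uv: "\<And>t. u t * v t = 1" "\<And>t. v t * u t = 1" and uK: "expO K u" and vK: "expO K v"
    and S: "esmall (\<lambda>t. S t - 1)" and G: "esmall (\<lambda>t. G t - 1)"
    and SG: "\<forall>\<^sub>F t in at_top. S t * S t * G t = 1"
    and conv: "econv (\<lambda>t. v t * G t * u t) 1"
  shows "econv (\<lambda>t. v t * S t * u t) 1"
proof -
  obtain a where a: "a < 0" "expO a (\<lambda>t. S t - 1)" "expO a (\<lambda>t. G t - 1)"
  proof -
    obtain a b where "a < 0" "expO a (\<lambda>t. S t - 1)" "b < 0" "expO b (\<lambda>t. G t - 1)"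
      using S G by (auto simp: esmall_def)
    then show thesis by (intro that[of "max a b"]) (auto intro: expO_mono)
  qed
  define y where "y = (\<lambda>t. S t - 1)"
  define h where "h = (\<lambda>t. G t - 1)"
  have y: "expO a y" and h: "expO a h" using a by (auto simp: y_def h_def)
  have yh: "\<forall>\<^sub>F t in at_top. (1 + y t) * (1 + y t) * (1 + h t) = 1"
    using SG by (simp add: y_def h_def)
  have root: "expO a (\<lambda>t. root_iter (h t) n)" for n
  proof (induction n)
    case 0
    have "expO a (\<lambda>t. 0 *\<^sub>R h t)" by (rule expO_scaleR[OF h])
    then show ?case by simp
  next
    case (Suc n)
    have h0: "expO 0 h" and r0: "expO 0 (\<lambda>t. root_iter (h t) n)" using h Suc a by (auto intro: expO_mono)
    show ?case unfolding root_iter.simps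
      using expO_mult[OF r0 h] expO_mult[OF r0 Suc] expO_mult[OF expO_mult[OF r0 Suc] h0]
      by (intro expO_scaleR expO_add h) auto
  qed
  have err: "expO (real n * a) (\<lambda>t. y t - root_iter (h t) n)" for n
  proof (induction n)
    case 0
    then show ?case using y a by (auto intro: expO_mono)
  next
    case (Suc n)
    have "expO 0 h" using h a by (auto intro: expO_mono)
    then have h0: "expO 0 (\<lambda>t. 1 + h t)" by (intro expO_add expO_const) auto
    note i = expO_mult[OF Suc h] expO_mult[OF y Suc, unfolded add.commute[of a]] expO_mult[OF Suc root[of n]]
    have "expO (real n * a + a + 0) (\<lambda>t. (y t * (y t - root_iter (h t) n)
            + (y t - root_iter (h t) n) * root_iter (h t) n) * (1 + h t))"
      by (intro expO_mult[OF expO_add] h0 i)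
    then have "expO (real n * a + a) (\<lambda>t. (- 1 / 2) *\<^sub>R (2 *\<^sub>R ((y t - root_iter (h t) n) * h t)
      + (y t * (y t - root_iter (h t) n) + (y t - root_iter (h t) n) * root_iter (h t) n) * (1 + h t)))"
      using i(1) by (intro expO_scaleR expO_add[OF expO_scaleR]) auto
    then have "expO (real n * a + a) (\<lambda>t. y t - root_iter (h t) (Suc n))"
      by (rule expO_cong[rotated]) (use yh in eventually_elim, simp only: root_iter_error)
    then show ?case by (simp add: algebra_simps)
  qed
  obtain N where N: "2 * K + real N * a < 0" using ex_nat_mult_less[OF a(1)] by blast
  have "esmall (\<lambda>t. v t * (y t - root_iter (h t) N) * u t)"
    using conj_expO[OF uK vK err] N by (rule esmallI)
  moreover have "esmall (\<lambda>t. v t * root_iter (h t) N * u t)"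
    unfolding conj_root_iter[OF uv(1)]
  proof (rule esmall_root_iter)
    have "v t * h t * u t = v t * G t * u t - 1" for t
      by (simp add: h_def algebra_simps uv)
    then show "esmall (\<lambda>t. v t * h t * u t)" using conv by (simp add: econv_def)
  qed
  ultimately have "esmall (\<lambda>t. v t * (y t - root_iter (h t) N) * u t + v t * root_iter (h t) N * u t)"
    by (rule esmall_add)
  moreover have "v t * (y t - root_iter (h t) N) * u t + v t * root_iter (h t) N * u t = v t * S t * u t - 1" for t
    by (simp add: y_def algebra_simps uv)
  ultimately show ?thesis by (simp add: econv_def)
qed

section \<open>The normed algebra of endomorphisms\<close>

text \<open>A type of its own, so that the two approximation results above, stated for an arbitrary
  \<open>real_normed_algebra_1\<close>, apply to linear operators with composition and the operator
  norm.\<close>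

typedef (overloaded) ('a::euclidean_space) endo = "{f :: 'a \<Rightarrow> 'a. linear f}"
  morphisms app Endo
  by (auto intro: linear_zero)

setup_lifting type_definition_endo

lemma linear_app [simp]: "linear (app x)"
  using app by auto

lemma bounded_linear_app [simp]: "bounded_linear (app x)"
  by (simp add: linear_conv_bounded_linear[symmetric])

lemma app_Endo [simp]: "linear f \<Longrightarrow> app (Endo f) = f"
  by (simp add: Endo_inverse)

instantiation endo :: (euclidean_space) real_normed_algebra_1
begin

lift_definition zero_endo :: "'a endo" is "\<lambda>_. 0" by (rule linear_zero)
lift_definition one_endo :: "'a endo" is "\<lambda>v. v" by (rule linear_id[unfolded id_def])
lift_definition plus_endo :: "'a endo \<Rightarrow> 'a endo \<Rightarrow> 'a endo" is "\<lambda>f g v. f v + g v"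
  by (rule linear_compose_add)
lift_definition minus_endo :: "'a endo \<Rightarrow> 'a endo \<Rightarrow> 'a endo" is "\<lambda>f g v. f v - g v"
  by (rule linear_compose_sub)
lift_definition uminus_endo :: "'a endo \<Rightarrow> 'a endo" is "\<lambda>f v. - f v"
  by (rule linear_compose_neg)
lift_definition times_endo :: "'a endo \<Rightarrow> 'a endo \<Rightarrow> 'a endo" is "\<lambda>f g v. f (g v)"
  using linear_compose by (fastforce simp: o_def)
lift_definition scaleR_endo :: "real \<Rightarrow> 'a endo \<Rightarrow> 'a endo" is "\<lambda>c f v. c *\<^sub>R f v"
  by (rule linear_compose_scale_right)
lift_definition norm_endo :: "'a endo \<Rightarrow> real" is onorm .

definition sgn_endo :: "'a endo \<Rightarrow> 'a endo" where
  "sgn_endo x = inverse (norm x) *\<^sub>R x"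
definition dist_endo :: "'a endo \<Rightarrow> 'a endo \<Rightarrow> real" where
  "dist_endo x y = norm (x - y)"
definition uniformity_endo :: "('a endo \<times> 'a endo) filter" where
  "uniformity_endo = (INF e\<in>{0 <..}. principal {(x, y). dist x y < e})"
definition open_endo :: "'a endo set \<Rightarrow> bool" where
  "open_endo S = (\<forall>x\<in>S. \<forall>\<^sub>F (x', y) in uniformity. x' = x \<longrightarrow> y \<in> S)"

instance
proof
  fix x y z :: "'a endo" and a b :: real
  note bl = linear_conv_bounded_linear[THEN iffD1]
  show "dist x y = norm (x - y)" by (rule dist_endo_def)
  show "sgn x = inverse (norm x) *\<^sub>R x" by (rule sgn_endo_def)
  show "x + y + z = x + (y + z)" "x + y = y + x" "0 + x = x" "- x + x = 0" "x - y = x + - y"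
    by (transfer; simp add: fun_eq_iff algebra_simps)+
  show "a *\<^sub>R (x + y) = a *\<^sub>R x + a *\<^sub>R y" "(a + b) *\<^sub>R x = a *\<^sub>R x + b *\<^sub>R x"
    "a *\<^sub>R b *\<^sub>R x = (a * b) *\<^sub>R x" "1 *\<^sub>R x = x"
    by (transfer; simp add: fun_eq_iff algebra_simps)+
  show "x * y * z = x * (y * z)" "1 * x = x" "x * 1 = x" "(x + y) * z = x * z + y * z"
    "a *\<^sub>R x * y = a *\<^sub>R (x * y)"
    by (transfer; simp add: fun_eq_iff)+
  show "x * (y + z) = x * y + x * z" "x * a *\<^sub>R y = a *\<^sub>R (x * y)"
    by (transfer; simp add: fun_eq_iff linear_add linear_scale)+
  show "(0::'a endo) \<noteq> 1"
  proof
    assume "(0::'a endo) = 1"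
    then have "v = 0" for v :: 'a by (transfer, metis)
    then show False using nonzero_Basis nonempty_Basis by blast
  qed
  show "(norm x = 0) = (x = 0)"
    by transfer (simp add: fun_eq_iff onorm_eq_0[OF bl])
  show "norm (x + y) \<le> norm x + norm y"
    by transfer (rule onorm_triangle[OF bl bl])
  show "norm (a *\<^sub>R x) = \<bar>a\<bar> * norm x"
    by transfer (rule onorm_scaleR[OF bl])
  show "norm (x * y) \<le> norm x * norm y"
    by transfer (rule onorm_compose[OF bl bl, unfolded o_def])
  show "norm (1::'a endo) = 1"
    by transfer (rule onorm_id)
qed (rule uniformity_endo_def open_endo_def)+

end

section \<open>Adjoints, matrix entries and entrywise convergence\<close>

lift_definition adj :: "'a::euclidean_space endo \<Rightarrow> 'a endo" is adjoint
  by (rule adjoint_linear)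

lemma app_simps [simp]:
  "app 0 v = 0" "app 1 v = v" "app (x + y) v = app x v + app y v"
  "app (x - y) v = app x v - app y v" "app (- x) v = - app x v"
  "app (x * y) v = app x (app y v)" "app (c *\<^sub>R x) v = c *\<^sub>R app x v"
  by (transfer; simp)+

lemma app_linear [simp]:
  "app x 0 = 0" "app x (v + w) = app x v + app x w" "app x (v - w) = app x v - app x w"
  "app x (- v) = - app x v" "app x (c *\<^sub>R v) = c *\<^sub>R app x v"
  "app x (sum g I) = (\<Sum>i\<in>I. app x (g i))"
  by (simp_all add: linear_0 linear_add linear_diff linear_neg linear_scale linear_sum)

lemma endo_eqI: "(\<And>v. app x v = app y v) \<Longrightarrow> x = y"
  by (simp add: app_inject[symmetric] fun_eq_iff)

lemma endo_eq_Basis: "(\<And>i. i \<in> Basis \<Longrightarrow> app x i = app y i) \<Longrightarrow> x = y"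
  using linear_eq_stdbasis[of "app x" "app y"] by (auto intro: endo_eqI)

lemma norm_app: "norm (app x v) \<le> norm x * norm v"
  by transfer (simp add: onorm linear_conv_bounded_linear)

lemma norm_endo_le: "(\<And>v. norm (app x v) \<le> b * norm v) \<Longrightarrow> norm x \<le> b"
  by transfer (rule onorm_le)

lemma adj_inner: "app (adj x) v \<bullet> w = v \<bullet> app x w"
  by transfer (simp add: adjoint_works inner_commute)

lemma adj_inner_right: "v \<bullet> app (adj x) w = app x v \<bullet> w"
  using adj_inner[of x w v] by (simp add: inner_commute)

definition ent :: "'a::euclidean_space endo \<Rightarrow> 'a \<Rightarrow> 'a \<Rightarrow> real" where
  "ent x i j = app x j \<bullet> i"

lemma ent_simps [simp]:
  "ent 0 i j = 0" "ent (x + y) i j = ent x i j + ent y i j"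
  "ent (x - y) i j = ent x i j - ent y i j" "ent (adj x) i j = ent x j i"
  by (simp_all add: ent_def inner_add_left inner_diff_left adj_inner) (simp add: inner_commute)

lemma endo_eq_ent:
  "(\<And>i j. i \<in> Basis \<Longrightarrow> j \<in> Basis \<Longrightarrow> ent x i j = ent y i j) \<Longrightarrow> x = y"
  by (rule endo_eq_Basis) (auto simp: ent_def intro: euclidean_eqI)

text \<open>With the reverse estimate \<open>abs_ent_le\<close>, this reduces exponential
  convergence of operators to that of their entries, where the factors e^(tf) are explicit.\<close>

lemma norm_le_sum_ent: "norm x \<le> (\<Sum>j\<in>Basis. \<Sum>i\<in>Basis. \<bar>ent x i j\<bar>)"
proof (rule norm_endo_le)
  fix v
  have "app x v = (\<Sum>j\<in>Basis. (v \<bullet> j) *\<^sub>R app x j)"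
    using app_linear(6)[of x "\<lambda>j. (v \<bullet> j) *\<^sub>R j" Basis]
    unfolding euclidean_representation app_linear(5) .
  also have "norm \<dots> \<le> (\<Sum>j\<in>Basis. norm v * (\<Sum>i\<in>Basis. \<bar>ent x i j\<bar>))"
  proof (rule sum_norm_le)
    fix j :: 'a assume "j \<in> Basis"
    then show "norm ((v \<bullet> j) *\<^sub>R app x j) \<le> norm v * (\<Sum>i\<in>Basis. \<bar>ent x i j\<bar>)"
      unfolding norm_scaleR ent_def by (intro mult_mono norm_le_l1 Basis_le_norm) auto
  qed
  also have "\<dots> = (\<Sum>j\<in>Basis. \<Sum>i\<in>Basis. \<bar>ent x i j\<bar>) * norm v"
    unfolding sum_distrib_left[symmetric] by (rule mult.commute)
  finally show "norm (app x v) \<le> (\<Sum>j\<in>Basis. \<Sum>i\<in>Basis. \<bar>ent x i j\<bar>) * norm v" .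
qed

lemma abs_ent_le: "i \<in> Basis \<Longrightarrow> j \<in> Basis \<Longrightarrow> \<bar>ent x i j\<bar> \<le> norm x"
  using norm_app[of x j] Basis_le_norm[of i "app x j"] by (simp add: ent_def)

lemma esmall_ent: "esmall x \<Longrightarrow> i \<in> Basis \<Longrightarrow> j \<in> Basis \<Longrightarrow> esmall (\<lambda>t. ent (x t) i j)"
  by (erule esmall_norm_le) (simp add: abs_ent_le)

lemma esmall_entI:
  assumes "\<And>i j. i \<in> Basis \<Longrightarrow> j \<in> Basis \<Longrightarrow> esmall (\<lambda>t. ent (x t) i j)"
  shows "esmall x"
proof -
  have "esmall (\<lambda>t. \<bar>ent (x t) i j\<bar>)" if "i \<in> Basis" "j \<in> Basis" for i j
    by (rule esmall_norm_le[OF assms[OF that]]) auto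
  then have "esmall (\<lambda>t. \<Sum>j\<in>Basis. \<Sum>i\<in>Basis. \<bar>ent (x t) i j\<bar>)"
    by (intro esmall_sum) auto
  then show ?thesis
    by (rule esmall_norm_le) (auto intro!: always_eventually order_trans[OF norm_le_sum_ent])
qed

lemma econv_entI:
  "(\<And>i j. i \<in> Basis \<Longrightarrow> j \<in> Basis \<Longrightarrow> econv (\<lambda>t. ent (x t) i j) (ent l i j)) \<Longrightarrow> econv x l"
  unfolding econv_def by (rule esmall_entI) simp

lemma econv_ent:
  "econv x l \<Longrightarrow> i \<in> Basis \<Longrightarrow> j \<in> Basis \<Longrightarrow> econv (\<lambda>t. ent (x t) i j) (ent l i j)"
  unfolding econv_def using esmall_ent[of "\<lambda>t. x t - l" i j] by simp

lemma adj_adj: "adj (adj x) = x"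
  by (rule endo_eq_ent) simp

lemma adj_plus: "adj (x + y) = adj x + adj y"
  by (rule endo_eq_ent) simp

lemma adj_mult: "adj (x * y) = adj y * adj x"
proof (rule endo_eqI)
  fix v
  have "app (adj (x * y)) v \<bullet> w = app (adj y * adj x) v \<bullet> w" for w by (simp add: adj_inner)
  then show "app (adj (x * y)) v = app (adj y * adj x) v" using vector_eq_rdot by blast
qed

section \<open>The approximating polynomials on eigenvectors and invariant subspaces\<close>

lemma app_vanishing_poly_eigen:
  "app x e = c *\<^sub>R e \<Longrightarrow> app (vanishing_poly ms x) e = (\<Prod>\<nu>\<leftarrow>ms. 1 - c / \<nu>) *\<^sub>R e"
  by (induction ms) (auto simp: algebra_simps)

lemma app_purify_fixed: "app x v = v \<Longrightarrow> app ((purify ^^ n) x) v = v"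
proof (induction n)
  case (Suc n)
  then show ?case using scaleR_diff_left[of 3 2 v] by (simp add: purify_def)
qed simp

lemma vanishing_poly_invariant:
  assumes "subspace W" "\<And>v. v \<in> W \<Longrightarrow> app x v \<in> W" "v \<in> W"
  shows "app (vanishing_poly ms x) v \<in> W"
  using assms(3)
proof (induction ms arbitrary: v)
  case (Cons \<mu> ms)
  have "v - (1 / \<mu>) *\<^sub>R app x v \<in> W"
    using assms(1,2) Cons.prems by (intro subspace_diff subspace_scale) auto
  from Cons.IH[OF this] show ?case by simp
qed simp

lemma purify_invariant:
  assumes "subspace W" "\<And>v. v \<in> W \<Longrightarrow> app x v \<in> W" "v \<in> W"
  shows "app ((purify ^^ n) x) v \<in> W"
  using assms(3)
proof (induction n arbitrary: v)
  case (Suc n)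
  have "app (purify y) v \<in> W" if "\<And>v. v \<in> W \<Longrightarrow> app y v \<in> W" "v \<in> W" for y v
    unfolding purify_def using that assms(1)
    by (auto intro!: subspace_diff subspace_scale)
  from this[OF Suc.IH Suc.prems] show ?case by simp
qed (use assms in simp)

section \<open>Orthonormal eigenbases\<close>

text \<open>Relative to a subspace U, because the Laplacian is diagonalised on the whole space but
  the Gram matrix only on the span of the critical elements.\<close>

definition orthonormal_basis :: "'a::euclidean_space set \<Rightarrow> 'a set \<Rightarrow> bool" where
  "orthonormal_basis U B \<longleftrightarrow> finite B \<and> (\<forall>e\<in>B. \<forall>e'\<in>B. e \<bullet> e' = (if e = e' then 1 else 0)) \<and> span B = U"

lemma orthonormal_basis_Basis: "orthonormal_basis UNIV Basis"
  by (auto simp: orthonormal_basis_def inner_Basis)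

lemma orthonormal_basis_independent:
  assumes "orthonormal_basis U B" shows "independent B"
proof (rule pairwise_orthogonal_independent)
  show "0 \<notin> B" using assms by (force simp: orthonormal_basis_def)
qed (use assms in \<open>auto simp: orthonormal_basis_def pairwise_def orthogonal_def split: if_splits\<close>)

lemma orthonormal_basis_sum:
  assumes "orthonormal_basis U B" "v \<in> U"
  shows "(\<Sum>e\<in>B. (v \<bullet> e) *\<^sub>R e) = v"
  by (rule orthonormal_basis_expand)
     (use assms in \<open>auto simp: orthonormal_basis_def pairwise_def orthogonal_def norm_eq_1\<close>)

lemma inner_orthonormal_sum:
  assumes "orthonormal_basis U B"
  shows "(\<Sum>e\<in>B. a e *\<^sub>R e) \<bullet> (\<Sum>e\<in>B. b e *\<^sub>R e) = (\<Sum>e\<in>B. a e * b e)"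
proof -
  have "(\<Sum>e\<in>B. a e *\<^sub>R e) \<bullet> (\<Sum>e\<in>B. b e *\<^sub>R e) = (\<Sum>e\<in>B. \<Sum>e'\<in>B. a e * b e' * (e \<bullet> e'))"
    by (simp only: inner_sum_left inner_sum_right inner_scaleR_left inner_scaleR_right mult.assoc sum_distrib_left)
       (subst sum.swap, simp add: mult_ac)
  also have "\<dots> = (\<Sum>e\<in>B. \<Sum>e'\<in>B. if e = e' then a e * b e' else 0)"
    by (intro sum.cong) (use assms in \<open>auto simp: orthonormal_basis_def\<close>)
  also have "\<dots> = (\<Sum>e\<in>B. a e * b e)" using assms by (simp add: orthonormal_basis_def)
  finally show ?thesis .
qed

text \<open>Maximise the Rayleigh quotient on the unit sphere of U, at v with value \<mu>. For w =
  \<mu> v - D v, testing maximality at v + s w gives 0 \<le> 2s|w|^2 + s^2 c for all real s, and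
  small negative s forces w = 0.\<close>

lemma symmetric_eigenvector_exists:
  fixes D :: "'a::euclidean_space \<Rightarrow> 'a"
  assumes D: "linear D" and sym: "\<And>v w. D v \<bullet> w = v \<bullet> D w"
    and U: "subspace U" "D ` U \<subseteq> U" "U \<noteq> {0}"
  obtains v \<mu> where "v \<in> U" "norm v = 1" "D v = \<mu> *\<^sub>R v"
proof -
  let ?S = "sphere 0 1 \<inter> U"
  obtain u where u: "u \<in> U" "u \<noteq> 0" using U subspace_0 by blast
  have "(1 / norm u) *\<^sub>R u \<in> ?S" using u U(1) by (auto simp: subspace_scale)
  then have ne: "?S \<noteq> {}" by blast
  have "compact ?S" by (intro compact_Int_closed closed_subspace U) auto
  moreover have "continuous_on ?S (\<lambda>v. D v \<bullet> v)"
    by (intro continuous_intros linear_continuous_on) (simp add: D linear_conv_bounded_linear[symmetric])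
  ultimately obtain v where v: "v \<in> ?S" and max: "\<And>w. w \<in> ?S \<Longrightarrow> D w \<bullet> w \<le> D v \<bullet> v"
    using continuous_attains_sup[of ?S "\<lambda>v. D v \<bullet> v"] ne by blast
  define \<mu> where "\<mu> = D v \<bullet> v"
  have vU: "v \<in> U" and v1: "v \<bullet> v = 1" using v by (auto simp: norm_eq_1)
  have bound: "D w \<bullet> w \<le> \<mu> * (w \<bullet> w)" if "w \<in> U" for w
  proof (cases "w = 0")
    case False
    have "D ((1 / norm w) *\<^sub>R w) \<bullet> ((1 / norm w) *\<^sub>R w) \<le> \<mu>"
      unfolding \<mu>_def using that False U(1) by (intro max) (auto simp: subspace_scale)
    then have "D w \<bullet> w / (norm w)\<^sup>2 \<le> \<mu>"
      using D by (simp add: linear_scale power2_eq_square)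
    then show ?thesis using False by (simp add: field_simps power2_norm_eq_inner)
  qed (simp add: D linear_0)
  define w where "w = \<mu> *\<^sub>R v - D v"
  have wU: "w \<in> U" unfolding w_def using U vU by (auto intro!: subspace_diff subspace_scale)
  define c where "c = \<mu> * (w \<bullet> w) - D w \<bullet> w"
  have c0: "c \<ge> 0" using bound[OF wU] by (simp add: c_def)
  have q: "0 \<le> 2 * s * (w \<bullet> w) + s\<^sup>2 * c" for s
  proof -
    have e: "D v \<bullet> w = \<mu> * (v \<bullet> w) - w \<bullet> w"
      by (simp add: w_def inner_diff_left inner_diff_right algebra_simps)
    have "v + s *\<^sub>R w \<in> U" using vU wU U(1) by (simp add: subspace_add subspace_scale)
    from bound[OF this] 
    have "D v \<bullet> v + s * (D v \<bullet> w) + s * (D w \<bullet> v) + s\<^sup>2 * (D w \<bullet> w)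
        \<le> \<mu> * (v \<bullet> v + 2 * s * (v \<bullet> w) + s\<^sup>2 * (w \<bullet> w))"
      by (simp add: linear_add[OF D] linear_scale[OF D] inner_add_left inner_add_right
          power2_eq_square algebra_simps inner_commute)
    moreover have "D w \<bullet> v = D v \<bullet> w" using sym by (simp add: inner_commute)
    ultimately show ?thesis by (simp add: e v1 \<mu>_def[symmetric] c_def algebra_simps)
  qed
  have "w \<bullet> w \<le> 0"
  proof (rule ccontr)
    assume n: "\<not> w \<bullet> w \<le> 0"
    define b where "b = w \<bullet> w"
    have b: "b > 0" using n inner_ge_zero[of w] by (simp add: b_def)
    \<comment> \<open>A negative s at which the quadratic is negative; c + 1 rather than c keeps the
      denominator positive when c = 0.\<close>
    have "0 \<le> 2 * (- b / (c + 1)) * b + (- b / (c + 1))\<^sup>2 * c" unfolding b_def by (rule q)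
    also have "\<dots> = (b\<^sup>2 / (c + 1)\<^sup>2) * (- c - 2)"
    proof -
      define d where "d = c + 1"
      have "d > 0" using c0 by (simp add: d_def)
      have "2 * (- b / d) * b + (- b / d)\<^sup>2 * (d - 1) = (b\<^sup>2 / d\<^sup>2) * (- d - 1)"
        using \<open>d > 0\<close> by (simp add: field_simps power2_eq_square)
      then show ?thesis by (simp add: d_def)
    qed
    also have "\<dots> < 0" using b c0 by (intro mult_pos_neg) auto
    finally show False by simp
  qed
  then have "w = 0" using inner_ge_zero[of w] by (metis inner_eq_zero_iff order_antisym)
  then show thesis using that[of v \<mu>] v by (simp add: w_def)
qed

text \<open>Split off one unit eigenvector; by symmetry its orthogonal complement inside U is again
  invariant and has smaller dimension.\<close>

lemma symmetric_eigenbasis_exists: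
  fixes D :: "'a::euclidean_space \<Rightarrow> 'a"
  assumes D: "linear D" and sym: "\<And>v w. D v \<bullet> w = v \<bullet> D w"
    and U: "subspace U" "D ` U \<subseteq> U"
  shows "\<exists>B. orthonormal_basis U B \<and> (\<forall>e\<in>B. \<exists>\<mu>. D e = \<mu> *\<^sub>R e)"
  using U
proof (induction "dim U" arbitrary: U rule: less_induct)
  case less
  show ?case
  proof (cases "U = {0}")
    case True
    then show ?thesis by (intro exI[of _ "{}"]) (simp add: orthonormal_basis_def)
  next
    case False
    obtain v \<mu> where v: "v \<in> U" "norm v = 1" "D v = \<mu> *\<^sub>R v"
      using symmetric_eigenvector_exists[OF D sym less.prems False] .
    have vv: "v \<bullet> v = 1" using v by (simp add: norm_eq_1)
    define U' where "U' = {x \<in> U. x \<bullet> v = 0}"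
    have sub': "subspace U'"
      using less.prems(1) by (auto simp: U'_def subspace_def inner_add_left)
    have inv': "D ` U' \<subseteq> U'"
      using less.prems(2) by (auto simp: U'_def sym v)
    have "v \<notin> U'" by (simp add: U'_def vv)
    moreover have "U' \<subseteq> U" by (auto simp: U'_def)
    ultimately have "U' \<subset> U" using v(1) by blast
    then have "span U' \<subset> span U" by (simp only: span_eq_iff[THEN iffD2, OF sub'] span_eq_iff[THEN iffD2, OF less.prems(1)])
    then have "dim U' < dim U" by (rule dim_psubset)
    from less.hyps[OF this sub' inv'] obtain B where
      B: "orthonormal_basis U' B" "\<forall>e\<in>B. \<exists>\<mu>. D e = \<mu> *\<^sub>R e" by blast
    have BU: "B \<subseteq> U'" using B span_superset by (auto simp: orthonormal_basis_def)
    have "span (insert v B) = U"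
    proof
      show "span (insert v B) \<subseteq> U"
        using BU v less.prems(1) by (intro span_minimal) (auto simp: U'_def)
      show "U \<subseteq> span (insert v B)"
      proof
        fix x assume x: "x \<in> U"
        have "x - (x \<bullet> v) *\<^sub>R v \<in> U'"
          using x v less.prems(1) by (auto simp: U'_def inner_diff_left vv intro!: subspace_diff subspace_scale)
        then have "x - (x \<bullet> v) *\<^sub>R v \<in> span B" using B by (simp add: orthonormal_basis_def)
        then show "x \<in> span (insert v B)" by (auto simp: span_insert)
      qed
    qed
    moreover have "finite (insert v B)" using B by (simp add: orthonormal_basis_def)
    moreover have "\<forall>e\<in>insert v B. \<forall>e'\<in>insert v B. e \<bullet> e' = (if e = e' then 1 else 0)"
      using B BU vv by (auto simp: orthonormal_basis_def U'_def inner_commute)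
    ultimately have "orthonormal_basis U (insert v B)" by (simp add: orthonormal_basis_def)
    then show ?thesis using B v by blast
  qed
qed

section \<open>Operators diagonal in an orthonormal basis\<close>

text \<open>For orthonormal B this is the operator with eigenvalue g e at e, and 0 on the orthogonal
  complement of B. It serves as functional calculus: spectral projections and inverses are obtained
  by changing g.\<close>

definition diag :: "'a::euclidean_space set \<Rightarrow> ('a \<Rightarrow> real) \<Rightarrow> 'a endo" where
  "diag B g = Endo (\<lambda>v. \<Sum>e\<in>B. (g e * (v \<bullet> e)) *\<^sub>R e)"

lemma app_diag: "app (diag B g) v = (\<Sum>e\<in>B. (g e * (v \<bullet> e)) *\<^sub>R e)"
proof -
  have "linear (\<lambda>v. \<Sum>e\<in>B. (g e * (v \<bullet> e)) *\<^sub>R e)"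
    by (intro linear_compose_sum ballI linearI) (auto simp: inner_add_left algebra_simps)
  then show ?thesis by (simp add: diag_def)
qed

lemma diag_symmetric: "app (diag B g) v \<bullet> w = v \<bullet> app (diag B g) w"
  by (simp add: app_diag inner_sum_left inner_sum_right inner_commute mult_ac)

lemma diag_app_basis:
  assumes "orthonormal_basis U B" "e \<in> B"
  shows "app (diag B g) e = g e *\<^sub>R e"
proof -
  have "app (diag B g) e = (\<Sum>e'\<in>B. if e' = e then g e *\<^sub>R e else 0)"
    unfolding app_diag by (intro sum.cong) (use assms in \<open>auto simp: orthonormal_basis_def\<close>)
  then show ?thesis using assms by (simp add: orthonormal_basis_def)
qed

lemma endo_eq_on_basis:
  assumes "orthonormal_basis UNIV B" "\<And>e. e \<in> B \<Longrightarrow> app x e = app y e"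
  shows "x = y"
proof (rule endo_eqI)
  fix v
  have v: "v = (\<Sum>e\<in>B. (v \<bullet> e) *\<^sub>R e)" using orthonormal_basis_sum[OF assms(1)] by simp
  show "app x v = app y v" by (subst (1 2) v) (simp add: assms(2))
qed

lemma inner_diag:
  assumes "orthonormal_basis U B" "e \<in> B"
  shows "app (diag B g) v \<bullet> e = g e * (v \<bullet> e)"
  using assms by (simp add: diag_symmetric diag_app_basis[OF assms])

lemma diag_mult:
  assumes "orthonormal_basis U B" shows "diag B g * diag B h = diag B (\<lambda>e. g e * h e)"
proof (rule endo_eqI)
  fix v
  have "app (diag B g) (app (diag B h) v) = (\<Sum>e\<in>B. (g e * (app (diag B h) v \<bullet> e)) *\<^sub>R e)"
    by (rule app_diag)
  also have "\<dots> = app (diag B (\<lambda>e. g e * h e)) v"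
    unfolding app_diag[of B "\<lambda>e. g e * h e"]
    by (intro sum.cong) (auto simp: inner_diag[OF assms])
  finally show "app (diag B g * diag B h) v = app (diag B (\<lambda>e. g e * h e)) v" by simp
qed

lemma diag_eqI:
  assumes "orthonormal_basis UNIV B" "\<And>e. e \<in> B \<Longrightarrow> app x e = g e *\<^sub>R e"
  shows "x = diag B g"
  by (rule endo_eq_on_basis[OF assms(1)]) (simp add: diag_app_basis[OF assms(1)] assms(2))

lemma norm_diag_le:
  assumes B: "orthonormal_basis UNIV B" and g: "\<And>e. e \<in> B \<Longrightarrow> \<bar>g e\<bar> \<le> c" and c: "0 \<le> c"
  shows "norm (diag B g) \<le> c"
proof (rule norm_endo_le)
  fix v
  have v: "v \<bullet> v = (\<Sum>e\<in>B. (v \<bullet> e) * (v \<bullet> e))"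
    using inner_orthonormal_sum[OF B, of "\<lambda>e. v \<bullet> e" "\<lambda>e. v \<bullet> e"]
    by (simp add: orthonormal_basis_sum[OF B])
  have "(norm (app (diag B g) v))\<^sup>2 = (\<Sum>e\<in>B. (g e * (v \<bullet> e)) * (g e * (v \<bullet> e)))"
    by (simp only: power2_norm_eq_inner app_diag inner_orthonormal_sum[OF B])
  also have "\<dots> \<le> (\<Sum>e\<in>B. c\<^sup>2 * ((v \<bullet> e) * (v \<bullet> e)))"
  proof (rule sum_mono)
    fix e assume "e \<in> B"
    then have "(g e)\<^sup>2 \<le> c\<^sup>2" using g[of e] c by (simp add: abs_le_square_iff[symmetric])
    then have "(g e)\<^sup>2 * (v \<bullet> e)\<^sup>2 \<le> c\<^sup>2 * (v \<bullet> e)\<^sup>2" by (rule mult_right_mono) simp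
    then show "g e * (v \<bullet> e) * (g e * (v \<bullet> e)) \<le> c\<^sup>2 * ((v \<bullet> e) * (v \<bullet> e))"
      by (simp add: power2_eq_square mult_ac)
  qed
  also have "\<dots> = (c * norm v)\<^sup>2"
    by (simp only: sum_distrib_left[symmetric] v[symmetric] power_mult_distrib power2_norm_eq_inner)
  finally show "norm (app (diag B g) v) \<le> c * norm v"
    by (rule power2_le_imp_le) (simp add: c)
qed

section \<open>Eigenvalues of an operator with a given eigenbasis\<close>

lemma inner_eq_zero_of_span:
  assumes "orthonormal_basis U B" "L \<subseteq> B" "v \<in> span L" "e \<in> B - L"
  shows "v \<bullet> e = 0"
proof -
  have "orthogonal e v"
    by (rule orthogonal_to_span[OF assms(3)])
       (use assms in \<open>auto simp: orthonormal_basis_def orthogonal_def\<close>)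
  then show ?thesis by (simp add: orthogonal_def inner_commute)
qed

lemma in_span_iff_Basis:
  assumes "F \<subseteq> Basis"
  shows "v \<in> span F \<longleftrightarrow> (\<forall>i\<in>Basis - F. v \<bullet> i = 0)"
proof
  show "v \<in> span F \<Longrightarrow> \<forall>i\<in>Basis - F. v \<bullet> i = 0"
    using inner_eq_zero_of_span[OF orthonormal_basis_Basis assms] by blast
  assume "\<forall>i\<in>Basis - F. v \<bullet> i = 0"
  then have "(\<Sum>i\<in>Basis. (v \<bullet> i) *\<^sub>R i) \<in> span F"
    by (intro span_sum) (metis DiffI scaleR_zero_left span_base span_scale span_zero)
  then show "v \<in> span F" by (simp add: euclidean_representation)
qed

lemma diag_cong_span:
  assumes "orthonormal_basis U B" "L \<subseteq> B" "v \<in> span L" "\<And>e. e \<in> L \<Longrightarrow> g e = h e"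
  shows "app (diag B g) v = app (diag B h) v"
  unfolding app_diag
proof (intro sum.cong refl)
  fix e assume "e \<in> B"
  then show "(g e * (v \<bullet> e)) *\<^sub>R e = (h e * (v \<bullet> e)) *\<^sub>R e"
    using assms inner_eq_zero_of_span[OF assms(1-3), of e] by (cases "e \<in> L") auto
qed

lemma diag_one: "orthonormal_basis UNIV B \<Longrightarrow> diag B (\<lambda>_. 1) = 1"
  by (rule diag_eqI[symmetric]) auto

lemma diag_in_span:
  assumes "\<And>e. e \<in> B - L \<Longrightarrow> g e = 0"
  shows "app (diag B g) v \<in> span L"
  unfolding app_diag
proof (rule span_sum)
  fix e assume "e \<in> B"
  then show "(g e * (v \<bullet> e)) *\<^sub>R e \<in> span L"
    using assms[of e] by (cases "e \<in> L") (auto intro: span_scale span_base span_zero)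
qed

lemma eigenspace_diag:
  assumes B: "orthonormal_basis UNIV B"
  shows "eigenspace (app (diag B \<nu>)) \<mu> = span {e \<in> B. \<nu> e = \<mu>}"
proof
  show "eigenspace (app (diag B \<nu>)) \<mu> \<subseteq> span {e \<in> B. \<nu> e = \<mu>}"
  proof
    fix v assume "v \<in> eigenspace (app (diag B \<nu>)) \<mu>"
    then have v: "app (diag B \<nu>) v = \<mu> *\<^sub>R v" by (simp add: eigenspace_def)
    have "\<nu> e = \<mu> \<or> v \<bullet> e = 0" if "e \<in> B" for e
      using inner_diag[OF B that, of \<nu> v] by (auto simp: v)
    then have "(\<Sum>e\<in>B. (v \<bullet> e) *\<^sub>R e) \<in> span {e \<in> B. \<nu> e = \<mu>}"
      by (intro span_sum) (metis (mono_tags, lifting) mem_Collect_eq scale_eq_0_iff span_base span_scale span_zero)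
    then show "v \<in> span {e \<in> B. \<nu> e = \<mu>}" by (simp add: orthonormal_basis_sum[OF B])
  qed
  show "span {e \<in> B. \<nu> e = \<mu>} \<subseteq> eigenspace (app (diag B \<nu>)) \<mu>"
  proof (rule span_minimal)
    show "{e \<in> B. \<nu> e = \<mu>} \<subseteq> eigenspace (app (diag B \<nu>)) \<mu>"
      by (auto simp: eigenspace_def diag_app_basis[OF B])
    show "subspace (eigenspace (app (diag B \<nu>)) \<mu>)"
      by (auto simp: eigenspace_def subspace_def scaleR_add_right)
  qed
qed

text \<open>The dimension of the eigenspace of \<mu> is the number of e in B with value \<mu>, so
  the multiplicities in the definition agree with counting along the eigenbasis.\<close>

lemma eigenvalue_mset_diag:
  assumes B: "orthonormal_basis UNIV B"
  shows "eigenvalue_mset (app (diag B \<nu>)) = image_mset \<nu> (mset_set B)"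
proof -
  let ?D = "app (diag B \<nu>)"
  have fin: "finite B" and ind: "independent B"
    using B orthonormal_basis_independent[OF B] by (auto simp: orthonormal_basis_def)
  have z: "0 \<notin> B" using B by (force simp: orthonormal_basis_def)
  have ev: "{\<mu>. \<exists>v. v \<noteq> 0 \<and> ?D v = \<mu> *\<^sub>R v} = \<nu> ` B"
  proof safe
    fix \<mu> v assume "v \<noteq> 0" "?D v = \<mu> *\<^sub>R v"
    then have "v \<in> span {e \<in> B. \<nu> e = \<mu>}" by (simp add: eigenspace_diag[OF B, symmetric] eigenspace_def)
    then have "{e \<in> B. \<nu> e = \<mu>} \<noteq> {}" using \<open>v \<noteq> 0\<close> by (auto simp del: Collect_empty_eq)
    then show "\<mu> \<in> \<nu> ` B" by auto
  next
    fix e assume "e \<in> B"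
    then show "\<exists>v. v \<noteq> 0 \<and> ?D v = \<nu> e *\<^sub>R v"
      using z by (intro exI[of _ e]) (auto simp: diag_app_basis[OF B])
  qed
  have dim: "dim (eigenspace ?D \<mu>) = card {e \<in> B. \<nu> e = \<mu>}" for \<mu>
    unfolding eigenspace_diag[OF B] dim_span
    by (rule dim_eq_card_independent) (rule independent_mono[OF ind], auto)
  show ?thesis
  proof (rule multiset_eqI)
    fix x
    have "count (eigenvalue_mset ?D) x = (\<Sum>\<mu>\<in>\<nu> ` B. if \<mu> = x then card {e \<in> B. \<nu> e = x} else 0)"
      unfolding eigenvalue_mset_def ev count_sum by (intro sum.cong) (auto simp: dim)
    also have "\<dots> = card {e \<in> B. \<nu> e = x}"
      using fin by (auto simp: card_eq_0_iff)
    also have "\<dots> = count (image_mset \<nu> (mset_set B)) x"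
      using fin by (simp add: count_image_mset) (rule arg_cong[where f = card], auto)
    finally show "count (eigenvalue_mset ?D) x = count (image_mset \<nu> (mset_set B)) x" .
  qed
qed

text \<open>In a sorted list the entries below c form a prefix.\<close>

lemma sorted_nth_less_iff:
  assumes "sorted xs" "i < length xs"
  shows "xs ! i < (c::'b::linorder) \<longleftrightarrow> i < length (filter (\<lambda>x. x < c) xs)"
  using assms
proof (induction xs arbitrary: i)
  case (Cons x xs)
  show ?case
  proof (cases "x < c")
    case True
    then show ?thesis using Cons by (cases i) auto
  next
    case False
    then have "\<forall>y\<in>set (x # xs). \<not> y < c" using Cons.prems by auto
    then have "filter (\<lambda>x. x < c) (x # xs) = []" by (simp only: filter_empty_conv) 
    moreover have "\<not> (x # xs) ! i < c"
      using \<open>\<forall>y\<in>set (x # xs). \<not> y < c\<close> nth_mem[OF Cons.prems(2)] by blast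
    ultimately show ?thesis by simp
  qed
qed simp

text \<open>The eigenvalues below a threshold c fill exactly the first k positions of the sorted
  list. This exchanges the description of W(t) by indices for one by a spectral cutoff.\<close>

lemma nth_eigenvalue_diag:
  fixes \<nu> :: "'a::euclidean_space \<Rightarrow> real" and c :: real
  assumes B: "orthonormal_basis UNIV B"
  defines "k \<equiv> card {e \<in> B. \<nu> e < c}"
  shows "i < DIM('a) \<Longrightarrow> nth_eigenvalue (app (diag B \<nu>)) i \<in> \<nu> ` B"
    and "i < DIM('a) \<Longrightarrow> nth_eigenvalue (app (diag B \<nu>)) i < c \<longleftrightarrow> i < k"
    and "k \<le> DIM('a)"
    and "(\<Union>i<k. eigenspace (app (diag B \<nu>)) (nth_eigenvalue (app (diag B \<nu>)) i))
           = (\<Union>\<mu>\<in>\<nu> ` {e \<in> B. \<nu> e < c}. eigenspace (app (diag B \<nu>)) \<mu>)"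
proof -
  define xs where "xs = sorted_list_of_multiset (eigenvalue_mset (app (diag B \<nu>)))"
  have fin: "finite B" using B by (auto simp: orthonormal_basis_def)
  have mset: "mset xs = image_mset \<nu> (mset_set B)"
    by (simp add: xs_def eigenvalue_mset_diag[OF B])
  have "sorted xs" by (simp add: xs_def)
  have "card B = DIM('a)"
    using orthonormal_basis_independent[OF B] B dim_eq_card_independent[of B] dim_span[of B]
    by (simp add: orthonormal_basis_def)
  then have len: "length xs = DIM('a)" using arg_cong[OF mset, of size] by simp
  have set: "set xs = \<nu> ` B" using arg_cong[OF mset, of set_mset] fin by simp
  have "length (filter (\<lambda>x. x < c) xs) = size (filter_mset (\<lambda>x. x < c) (image_mset \<nu> (mset_set B)))"
    by (metis mset mset_filter size_mset)
  also have "\<dots> = k" using fin by (simp add: filter_mset_image_mset k_def)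
  finally have k: "length (filter (\<lambda>x. x < c) xs) = k" .
  have nth: "nth_eigenvalue (app (diag B \<nu>)) i = xs ! i" for i
    by (simp add: nth_eigenvalue_def xs_def)
  show "i < DIM('a) \<Longrightarrow> nth_eigenvalue (app (diag B \<nu>)) i \<in> \<nu> ` B"
    using nth_mem[of i xs] by (simp add: nth len set)
  show less: "i < DIM('a) \<Longrightarrow> nth_eigenvalue (app (diag B \<nu>)) i < c \<longleftrightarrow> i < k" for i
    using sorted_nth_less_iff[OF \<open>sorted xs\<close>, of i c] by (simp add: nth len k)
  show kD: "k \<le> DIM('a)" using k len length_filter_le[of "\<lambda>x. x < c" xs] by simp
  have "(!) xs ` {..<k} = \<nu> ` {e \<in> B. \<nu> e < c}"
  proof safe
    fix i assume "i < k"
    then have "xs ! i < c" "xs ! i \<in> \<nu> ` B"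
      using less[of i] nth_mem[of i xs] kD by (auto simp: nth len set)
    then show "xs ! i \<in> \<nu> ` {e \<in> B. \<nu> e < c}" by auto
  next
    fix e assume e: "e \<in> B" "\<nu> e < c"
    then have "\<nu> e \<in> set xs" by (simp add: set)
    then obtain i where "i < length xs" "xs ! i = \<nu> e" by (auto simp: in_set_conv_nth)
    then show "\<nu> e \<in> (!) xs ` {..<k}" using less[of i] e by (auto simp: nth len intro!: image_eqI[of _ _ i])
  qed
  then show "(\<Union>i<k. eigenspace (app (diag B \<nu>)) (nth_eigenvalue (app (diag B \<nu>)) i))
           = (\<Union>\<mu>\<in>\<nu> ` {e \<in> B. \<nu> e < c}. eigenspace (app (diag B \<nu>)) \<mu>)"
    by (metis (no_types, lifting) SUP_cong image_image nth)
qed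

lemma span_Union_eigenspace_diag:
  assumes B: "orthonormal_basis UNIV B"
  shows "span (\<Union>\<mu>\<in>\<nu> ` {e \<in> B. \<nu> e < c}. eigenspace (app (diag B \<nu>)) \<mu>) = span {e \<in> B. \<nu> e < c}"
proof
  have "eigenspace (app (diag B \<nu>)) \<mu> \<subseteq> span {e \<in> B. \<nu> e < c}" if "\<mu> \<in> \<nu> ` {e \<in> B. \<nu> e < c}" for \<mu>
    unfolding eigenspace_diag[OF B] by (rule span_mono) (use that in auto)
  then show "span (\<Union>\<mu>\<in>\<nu> ` {e \<in> B. \<nu> e < c}. eigenspace (app (diag B \<nu>)) \<mu>) \<subseteq> span {e \<in> B. \<nu> e < c}"
    by (intro span_minimal UN_least) auto
  show "span {e \<in> B. \<nu> e < c} \<subseteq> span (\<Union>\<mu>\<in>\<nu> ` {e \<in> B. \<nu> e < c}. eigenspace (app (diag B \<nu>)) \<mu>)"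
    by (rule span_mono) (auto simp: eigenspace_diag[OF B] intro: span_base)
qed

section \<open>Orthogonal projections\<close>

lemma orth_proj_eqI:
  assumes "subspace S" "w \<in> S" "\<And>u. u \<in> S \<Longrightarrow> orthogonal (v - w) u"
  shows "orth_proj S v = w"
  unfolding orth_proj_def
proof (rule the_equality)
  show "w \<in> S \<and> (\<forall>u\<in>S. orthogonal (v - w) u)" using assms by blast
  fix w' assume w': "w' \<in> S \<and> (\<forall>u\<in>S. orthogonal (v - w') u)"
  then have d: "w - w' \<in> S" using assms by (auto intro: subspace_diff)
  then have "(v - w') \<bullet> (w - w') - (v - w) \<bullet> (w - w') = 0"
    using w' assms(3) by (simp add: orthogonal_def)
  then have "(w - w') \<bullet> (w - w') = 0" by (simp add: inner_diff_left inner_diff_right inner_commute)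
  then show "w' = w" by simp
qed

lemma orth_proj_diag:
  assumes B: "orthonormal_basis UNIV B" and L: "L \<subseteq> B"
  shows "orth_proj (span L) = app (diag B (indicator L))"
proof
  fix v
  show "orth_proj (span L) v = app (diag B (indicator L)) v"
  proof (rule orth_proj_eqI)
    show "app (diag B (indicator L)) v \<in> span L" by (rule diag_in_span) auto
    fix u assume u: "u \<in> span L"
    have "app (diag B (indicator L)) u = app (diag B (\<lambda>_. 1)) u"
      by (rule diag_cong_span[OF B L u]) auto
    then have "app (diag B (indicator L)) u = u" by (simp add: diag_one[OF B])
    then show "orthogonal (v - app (diag B (indicator L)) v) u"
      by (simp add: orthogonal_def inner_diff_left diag_symmetric)
  qed simp
qed

section \<open>Perturbation of a diagonal operator\<close>

lemma card_add_le_of_span_Int: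
  fixes X Y :: "'a::euclidean_space set"
  assumes "independent X" "independent Y" "\<And>v. v \<in> span X \<Longrightarrow> v \<in> span Y \<Longrightarrow> v = 0"
  shows "card X + card Y \<le> DIM('a)"
proof -
  have "span X \<inter> span Y \<subseteq> {0}" using assms(3) by blast
  then have "dim (span X \<inter> span Y) = 0" by (simp only: dim_eq_0)
  moreover have "dim (span X) = card X" "dim (span Y) = card Y"
    by (simp_all only: dim_span dim_eq_card_independent[OF assms(1)] dim_eq_card_independent[OF assms(2)])
  ultimately have "dim {x + y |x y. x \<in> span X \<and> y \<in> span Y} = card X + card Y"
    using dim_sums_Int[OF subspace_span[of X] subspace_span[of Y]] by linarith
  then show ?thesis using dim_subset_UNIV[of "{x + y |x y. x \<in> span X \<and> y \<in> span Y}"] by linarith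
qed

lemma symmetric_eq_diag:
  assumes "adj D = D"
  obtains B \<nu> where "orthonormal_basis UNIV B" "D = diag B \<nu>"
proof -
  have "\<exists>B. orthonormal_basis UNIV B \<and> (\<forall>e\<in>B. \<exists>\<mu>. app D e = \<mu> *\<^sub>R e)"
    by (rule symmetric_eigenbasis_exists) (use adj_inner[of D] assms in auto)
  then obtain B where B: "orthonormal_basis UNIV B" "\<forall>e\<in>B. \<exists>\<mu>. app D e = \<mu> *\<^sub>R e" by blast
  then obtain \<nu> where "\<forall>e\<in>B. app D e = \<nu> e *\<^sub>R e" by metis
  then show thesis using that B diag_eqI[OF B(1)] by blast
qed

text \<open>Eigenvalues of D below m/2 must lie close to the eigenvalue 0 of D0. Their number is
  found by two dimension counts: the low eigenvectors of D meet the span of \<open>Basis - C\<close>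
  only in 0, and the remaining ones meet the span of C only in 0. The bound m/4 is what produces the
  factor 1/2 in both.\<close>

lemma diag_perturbation:
  fixes D D0 :: "'a::euclidean_space endo"
  assumes B: "orthonormal_basis UNIV B" and D: "D = diag B \<nu>" and pos: "\<And>e. e \<in> B \<Longrightarrow> 0 \<le> \<nu> e"
    and D0: "D0 = diag Basis \<mu>" and C: "C \<subseteq> Basis"
    and \<mu>0: "\<And>i. i \<in> C \<Longrightarrow> \<mu> i = 0" and \<mu>m: "\<And>i. i \<in> Basis - C \<Longrightarrow> m \<le> \<mu> i" and m: "m > 0"
    and small: "norm (D - D0) \<le> m / 4"
  shows "\<And>e. e \<in> B \<Longrightarrow> \<nu> e < m / 2 \<Longrightarrow> \<nu> e \<le> norm (D - D0)"
    and "card {e \<in> B. \<nu> e < m / 2} = card C"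
proof -
  note OB = orthonormal_basis_Basis
  have inv: "\<bar>1 / x\<bar> \<le> 1 / d" if "0 < d" "d \<le> \<bar>x\<bar>" for x d :: real
    using that by (simp add: frac_le)
  define \<epsilon> where "\<epsilon> = norm (D - D0)"
  have \<epsilon>: "0 \<le> \<epsilon>" "\<epsilon> \<le> m / 4" using small by (auto simp: \<epsilon>_def)
  have diff: "norm (app D v - app D0 v) \<le> \<epsilon> * norm v" for v
    using norm_app[of "D - D0" v] by (simp add: \<epsilon>_def)
  show low: "\<nu> e \<le> norm (D - D0)" if e: "e \<in> B" "\<nu> e < m / 2" for e
  proof (rule ccontr)
    assume "\<not> \<nu> e \<le> norm (D - D0)"
    then have gt: "\<nu> e > \<epsilon>" by (simp add: \<epsilon>_def)
    have ne: "norm e = 1" using B e by (auto simp: orthonormal_basis_def norm_eq_1)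
    \<comment> \<open>Bounds from below the distance of \<open>\<nu> e\<close> to the spectrum of
      D0, contained in {0} and [m, \<infinity>). Since \<delta> > \<epsilon>, inverting
      \<open>D0 - \<nu> e\<close> in \<open>(D0 - \<nu> e) e = (D0 - D) e\<close> contradicts |e| =
      1.\<close>
    define \<delta> where "\<delta> = min (\<nu> e) (m - \<nu> e)"
    have \<delta>: "\<delta> > \<epsilon>" using gt e \<epsilon> m by (auto simp: \<delta>_def)
    have sep: "\<bar>\<mu> i - \<nu> e\<bar> \<ge> \<delta>" if "i \<in> Basis" for i
      using \<mu>0[of i] \<mu>m[of i] that gt \<epsilon> e by (cases "i \<in> C") (auto simp: \<delta>_def)
    have "app (diag Basis (\<lambda>i. 1 / (\<mu> i - \<nu> e)) * diag Basis (\<lambda>i. \<mu> i - \<nu> e)) e = app (diag Basis (\<lambda>_. 1)) e"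
      unfolding diag_mult[OF OB]
    proof (rule diag_cong_span[OF OB order_refl])
      fix i :: 'a assume "i \<in> Basis"
      then have "\<mu> i - \<nu> e \<noteq> 0" using sep[of i] \<delta> \<epsilon>(1) by linarith
      then show "1 / (\<mu> i - \<nu> e) * (\<mu> i - \<nu> e) = 1" by simp
    qed simp
    moreover have "app (diag Basis (\<lambda>i. \<mu> i - \<nu> e)) e = app D0 e - app D e"
    proof -
      have "D0 - \<nu> e *\<^sub>R 1 = diag Basis (\<lambda>i. \<mu> i - \<nu> e)"
        by (rule diag_eqI[OF OB]) (simp add: D0 diag_app_basis[OF OB] scaleR_diff_left)
      then have "diag Basis (\<lambda>i. \<mu> i - \<nu> e) = D0 - \<nu> e *\<^sub>R 1" by (rule sym)
      then show ?thesis by (simp add: D diag_app_basis[OF B e(1)])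
    qed
    ultimately have "e = app (diag Basis (\<lambda>i. 1 / (\<mu> i - \<nu> e))) (app D0 e - app D e)"
      by (simp add: diag_one[OF OB])
    then have "norm e \<le> norm (diag Basis (\<lambda>i. 1 / (\<mu> i - \<nu> e))) * norm (app D0 e - app D e)"
      using norm_app[of "diag Basis (\<lambda>i. 1 / (\<mu> i - \<nu> e))" "app D0 e - app D e"] by simp
    also have "\<dots> \<le> (1 / \<delta>) * \<epsilon>"
    proof (rule mult_mono)
      show "norm (diag Basis (\<lambda>i. 1 / (\<mu> i - \<nu> e))) \<le> 1 / \<delta>"
        using sep \<delta> \<epsilon> by (intro norm_diag_le[OF OB] inv) auto
      show "norm (app D0 e - app D e) \<le> \<epsilon>" using diff[of e] ne by (simp add: norm_minus_commute)
    qed (use \<delta> \<epsilon> in auto)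
    also have "\<dots> < 1" using \<delta> \<epsilon> by simp
    finally show False using ne by simp
  qed
  define L where "L = {e \<in> B. \<nu> e < m / 2}"
  have L: "L \<subseteq> B" by (auto simp: L_def)
  have fin: "finite B" "finite C" using B C finite_subset[OF C] by (auto simp: orthonormal_basis_def)
  have ind: "independent B" by (rule orthonormal_basis_independent[OF B])
  have cB: "card B = DIM('a)"
    using ind B dim_eq_card_independent[of B] dim_span[of B] by (simp add: orthonormal_basis_def)
  have half: "v = 0" if "norm v \<le> norm v / 2" for v :: 'a using that by simp
  have "card L + card (Basis - C) \<le> DIM('a)"
  proof (rule card_add_le_of_span_Int)
    show "independent L" by (rule independent_mono[OF ind L])
    show "independent (Basis - C)" by (rule independent_mono[OF independent_Basis]) auto
    \<comment> \<open>Here |D v| \<le> \<epsilon>|v| but |D0 v| \<ge> m|v|, while the two images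
      differ by at most \<epsilon>|v|.\<close>
    fix v assume v: "v \<in> span L" "v \<in> span (Basis - C)"
    have "app D v = app (diag B (\<lambda>e. if e \<in> L then \<nu> e else 0)) v"
      unfolding D by (rule diag_cong_span[OF B L v(1)]) auto
    also have "norm \<dots> \<le> \<epsilon> * norm v"
    proof (rule order_trans[OF norm_app mult_right_mono])
      show "norm (diag B (\<lambda>e. if e \<in> L then \<nu> e else 0)) \<le> \<epsilon>"
        using pos low \<epsilon> by (intro norm_diag_le[OF B]) (auto simp: L_def \<epsilon>_def)
    qed simp
    finally have 1: "norm (app D v) \<le> \<epsilon> * norm v" .
    have "app (diag Basis (\<lambda>i. if i \<in> C then 0 else 1 / \<mu> i) * D0) v = app (diag Basis (\<lambda>_. 1)) v"
      unfolding D0 diag_mult[OF OB] 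
    proof (rule diag_cong_span[OF OB _ v(2)])
      fix i assume "i \<in> Basis - C"
      then show "(if i \<in> C then 0 else 1 / \<mu> i) * \<mu> i = 1" using \<mu>m[of i] m by simp
    qed auto
    then have "norm v = norm (app (diag Basis (\<lambda>i. if i \<in> C then 0 else 1 / \<mu> i)) (app D0 v))"
      by (simp add: diag_one[OF OB])
    also have "\<dots> \<le> (1 / m) * norm (app D0 v)"
    proof (rule order_trans[OF norm_app mult_right_mono])
      show "norm (diag Basis (\<lambda>i. if i \<in> C then 0 else 1 / \<mu> i)) \<le> 1 / m"
      proof (rule norm_diag_le[OF OB])
        fix i :: 'a assume "i \<in> Basis"
        then show "\<bar>if i \<in> C then 0 else 1 / \<mu> i\<bar> \<le> 1 / m"
          using inv[OF m, of "\<mu> i"] \<mu>m[of i] m by auto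
      qed (use m in simp)
    qed simp
    also have "\<dots> \<le> (1 / m) * (m / 4 * norm v + m / 4 * norm v)"
    proof (rule mult_left_mono)
      have "\<epsilon> * norm v \<le> m / 4 * norm v" using \<epsilon> by (intro mult_right_mono) auto
      then show "norm (app D0 v) \<le> m / 4 * norm v + m / 4 * norm v"
        using 1 diff[of v] norm_triangle_ineq2[of "app D0 v" "app D v"]
        by (simp add: norm_minus_commute)
    qed (use m in simp)
    also have "\<dots> = norm v / 2" using m by (simp add: field_simps)
    finally show "v = 0" by (rule half)
  qed
  moreover have "card (B - L) + card C \<le> DIM('a)"
  proof (rule card_add_le_of_span_Int)
    show "independent (B - L)" by (rule independent_mono[OF ind]) auto
    show "independent C" by (rule independent_mono[OF independent_Basis C])
    \<comment> \<open>Here D0 v = 0, so |D v| \<le> \<epsilon>|v|, but |D v| \<ge> (m/2)|v|.\<close>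
    fix v assume v: "v \<in> span (B - L)" "v \<in> span C"
    have "app D0 v = app (diag Basis (\<lambda>_. 0)) v"
      unfolding D0 by (rule diag_cong_span[OF OB C v(2)]) (simp add: \<mu>0)
    then have D0v: "app D0 v = 0" by (simp add: app_diag)
    have "app (diag B (\<lambda>e. if e \<in> L then 0 else 1 / \<nu> e) * D) v = app (diag B (\<lambda>_. 1)) v"
      unfolding D diag_mult[OF B] by (rule diag_cong_span[OF B _ v(1)]) (use m in \<open>auto simp: L_def split: if_splits\<close>)
    then have "norm v = norm (app (diag B (\<lambda>e. if e \<in> L then 0 else 1 / \<nu> e)) (app D v))"
      by (simp add: diag_one[OF B])
    also have "\<dots> \<le> (2 / m) * norm (app D v)"
    proof (rule order_trans[OF norm_app mult_right_mono])
      show "norm (diag B (\<lambda>e. if e \<in> L then 0 else 1 / \<nu> e)) \<le> 2 / m"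
      proof (rule norm_diag_le[OF B])
        fix e assume "e \<in> B"
        then show "\<bar>if e \<in> L then 0 else 1 / \<nu> e\<bar> \<le> 2 / m"
          using inv[of "m / 2" "\<nu> e"] m by (auto simp: L_def)
      qed (use m in simp)
    qed simp
    also have "\<dots> \<le> (2 / m) * (m / 4 * norm v)"
    proof (rule mult_left_mono)
      have "\<epsilon> * norm v \<le> m / 4 * norm v" using \<epsilon> by (intro mult_right_mono) auto
      then show "norm (app D v) \<le> m / 4 * norm v" using diff[of v] by (simp add: D0v)
    qed (use m in simp)
    also have "\<dots> = norm v / 2" using m by (simp add: field_simps)
    finally show "v = 0" by (rule half)
  qed
  moreover have "card (Basis - C) = DIM('a) - card C" "card C \<le> DIM('a)"
    using C fin by (auto simp: card_Diff_subset intro: card_mono)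
  moreover have "card (B - L) = DIM('a) - card L" "card L \<le> DIM('a)"
    using card_Diff_subset[OF finite_subset[OF L fin(1)] L] card_mono[OF fin(1) L] cB by simp_all
  ultimately show "card {e \<in> B. \<nu> e < m / 2} = card C" by (simp add: L_def)
qed

section \<open>Inverse square roots of positive definite matrices\<close>

text \<open>Matrices indexed by C become operators that vanish on the orthogonal complement of span
  C, so that operator methods apply to them; the identity matrix becomes the projection onto span
  C.\<close>

definition matrix_op :: "'a::euclidean_space set \<Rightarrow> ('a \<Rightarrow> 'a \<Rightarrow> real) \<Rightarrow> 'a endo" where
  "matrix_op C M = Endo (\<lambda>v. \<Sum>i\<in>C. (\<Sum>j\<in>C. M i j * (v \<bullet> j)) *\<^sub>R i)"

lemma app_matrix_op: "app (matrix_op C M) v = (\<Sum>i\<in>C. (\<Sum>j\<in>C. M i j * (v \<bullet> j)) *\<^sub>R i)"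
proof -
  have "linear (\<lambda>v. \<Sum>i\<in>C. (\<Sum>j\<in>C. M i j * (v \<bullet> j)) *\<^sub>R i)"
    by (intro linear_compose_sum ballI linearI)
       (auto simp: inner_add_left algebra_simps sum.distrib scaleR_add_left sum_distrib_left)
  then show ?thesis by (simp add: matrix_op_def)
qed

lemma sum_Basis_subset:
  assumes "C \<subseteq> Basis" "k \<in> Basis"
  shows "(\<Sum>i\<in>C. c i *\<^sub>R i) \<bullet> k = (if k \<in> C then c k else 0)"
proof -
  have "(\<Sum>i\<in>C. c i *\<^sub>R i) \<bullet> k = (\<Sum>i\<in>C. if i = k then c k else 0)"
    unfolding inner_sum_left
    by (intro sum.cong) (use assms in \<open>auto simp: inner_Basis\<close>)
  then show ?thesis using finite_subset[OF assms(1)] by simp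
qed

lemma ent_matrix_op:
  assumes "C \<subseteq> Basis" "i \<in> Basis" "j \<in> Basis"
  shows "ent (matrix_op C M) i j = (if i \<in> C \<and> j \<in> C then M i j else 0)"
proof -
  have "(\<Sum>l\<in>C. M i l * (j \<bullet> l)) = (\<Sum>l\<in>C. if l = j then M i j else 0)"
    by (intro sum.cong) (use assms in \<open>auto simp: inner_Basis\<close>)
  also have "\<dots> = (if j \<in> C then M i j else 0)" using finite_subset[OF assms(1)] by simp
  finally show ?thesis using assms by (simp add: ent_def app_matrix_op sum_Basis_subset)
qed

lemma matrix_op_mult:
  assumes C: "C \<subseteq> Basis"
  shows "matrix_op C M * matrix_op C N = matrix_op C (\<lambda>i j. \<Sum>l\<in>C. M i l * N l j)"
proof (rule endo_eqI)
  fix v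
  have "app (matrix_op C M) (app (matrix_op C N) v)
      = (\<Sum>i\<in>C. (\<Sum>l\<in>C. M i l * (\<Sum>j\<in>C. N l j * (v \<bullet> j))) *\<^sub>R i)"
    unfolding app_matrix_op[of C M]
    by (rule sum.cong[OF refl], rule arg_cong2[where f = scaleR, OF _ refl], rule sum.cong[OF refl])
       (use C in \<open>auto simp: app_matrix_op sum_Basis_subset subset_iff\<close>)
  also have "\<dots> = (\<Sum>i\<in>C. (\<Sum>j\<in>C. (\<Sum>l\<in>C. M i l * N l j) * (v \<bullet> j)) *\<^sub>R i)"
  proof (rule sum.cong[OF refl], rule arg_cong2[where f = scaleR, OF _ refl])
    fix i
    show "(\<Sum>l\<in>C. M i l * (\<Sum>j\<in>C. N l j * (v \<bullet> j))) = (\<Sum>j\<in>C. (\<Sum>l\<in>C. M i l * N l j) * (v \<bullet> j))"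
      unfolding sum_distrib_left sum_distrib_right by (subst sum.swap) (simp add: mult.assoc)
  qed
  finally show "app (matrix_op C M * matrix_op C N) v = app (matrix_op C (\<lambda>i j. \<Sum>l\<in>C. M i l * N l j)) v"
    by (simp add: app_matrix_op[of C "\<lambda>i j. \<Sum>l\<in>C. M i l * N l j"])
qed

lemma matrix_op_eq_iff:
  assumes C: "C \<subseteq> Basis"
  shows "matrix_op C M = matrix_op C N \<longleftrightarrow> (\<forall>i\<in>C. \<forall>j\<in>C. M i j = N i j)"
proof
  assume e: "matrix_op C M = matrix_op C N"
  show "\<forall>i\<in>C. \<forall>j\<in>C. M i j = N i j"
  proof (intro ballI)
    fix i j assume "i \<in> C" "j \<in> C"
    then show "M i j = N i j"
      using arg_cong[OF e, of "\<lambda>x. ent x i j"] C by (auto simp: ent_matrix_op subset_iff)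
  qed
next
  assume "\<forall>i\<in>C. \<forall>j\<in>C. M i j = N i j"
  then show "matrix_op C M = matrix_op C N"
    by (intro endo_eq_ent) (simp add: ent_matrix_op[OF C])
qed

lemma inner_matrix_op: "app (matrix_op C M) v \<bullet> w = (\<Sum>i\<in>C. \<Sum>j\<in>C. (w \<bullet> i) * M i j * (v \<bullet> j))"
proof -
  have "app (matrix_op C M) v \<bullet> w = (\<Sum>i\<in>C. (\<Sum>j\<in>C. M i j * (v \<bullet> j)) * (w \<bullet> i))"
    by (simp add: app_matrix_op inner_sum_left) (simp add: inner_commute)
  then show ?thesis by (simp add: sum_distrib_left sum_distrib_right mult_ac)
qed

lemma matrix_op_symmetric:
  assumes "pos_def_on C M" shows "adj (matrix_op C M) = matrix_op C M"
proof (rule endo_eqI)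
  fix v
  have "app (adj (matrix_op C M)) v \<bullet> w = app (matrix_op C M) v \<bullet> w" for w
    unfolding adj_inner inner_commute[of v] inner_matrix_op
    by (subst sum.swap) (use assms in \<open>auto simp: pos_def_on_def mult_ac intro!: sum.cong\<close>)
  then show "app (adj (matrix_op C M)) v = app (matrix_op C M) v"
    using vector_eq_rdot by blast
qed

lemma orthonormal_basis_subset_Basis: "C \<subseteq> Basis \<Longrightarrow> orthonormal_basis (span C) C"
  using finite_subset[OF _ finite_Basis] by (auto simp: orthonormal_basis_def inner_Basis subset_iff)

lemma matrix_op_in_span: "app (matrix_op C M) v \<in> span C"
  unfolding app_matrix_op by (intro span_sum span_scale span_base)

lemma matrix_op_pos:
  assumes C: "C \<subseteq> Basis" and M: "pos_def_on C M" and v: "v \<in> span C" "v \<noteq> 0"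
  shows "app (matrix_op C M) v \<bullet> v > 0"
proof -
  have "\<exists>i\<in>C. v \<bullet> i \<noteq> 0"
  proof (rule ccontr)
    assume "\<not> (\<exists>i\<in>C. v \<bullet> i \<noteq> 0)"
    then have "(\<Sum>i\<in>C. (v \<bullet> i) *\<^sub>R i) = 0" by simp
    then show False using orthonormal_basis_sum[OF orthonormal_basis_subset_Basis[OF C] v(1)] v(2) by simp
  qed
  then show ?thesis using M unfolding inner_matrix_op pos_def_on_def by blast
qed

lemma pos_def_onI_matrix_op:
  assumes C: "C \<subseteq> Basis" and sym: "adj (matrix_op C M) = matrix_op C M"
    and pos: "\<And>v. v \<in> span C \<Longrightarrow> v \<noteq> 0 \<Longrightarrow> app (matrix_op C M) v \<bullet> v > 0"
  shows "pos_def_on C M"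
  unfolding pos_def_on_def
proof (intro conjI ballI allI impI)
  fix i j assume "i \<in> C" "j \<in> C"
  then show "M i j = M j i"
    using arg_cong[OF sym, of "\<lambda>x. ent x i j"] C by (auto simp: ent_matrix_op subset_iff)
next
  fix x :: "'a \<Rightarrow> real" assume x: "\<exists>i\<in>C. x i \<noteq> 0"
  define v where "v = (\<Sum>i\<in>C. x i *\<^sub>R i)"
  have vi: "v \<bullet> i = x i" if "i \<in> C" for i
    using that C by (auto simp: v_def sum_Basis_subset subset_iff)
  have "v \<in> span C" unfolding v_def by (intro span_sum span_scale span_base)
  moreover have "v \<noteq> 0" using x vi by force
  ultimately have "0 < app (matrix_op C M) v \<bullet> v" by (rule pos)
  then show "0 < (\<Sum>i\<in>C. \<Sum>j\<in>C. x i * M i j * x j)" by (simp add: inner_matrix_op vi)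
qed

lemma mutually_inverse_on_iff_matrix_op:
  assumes C: "C \<subseteq> Basis"
  shows "mutually_inverse_on C C M N \<longleftrightarrow>
    matrix_op C M * matrix_op C N = matrix_op C (\<lambda>i j. if i = j then 1 else 0) \<and>
    matrix_op C N * matrix_op C M = matrix_op C (\<lambda>i j. if i = j then 1 else 0)"
  unfolding mutually_inverse_on_def matrix_op_mult[OF C] matrix_op_eq_iff[OF C] by blast

lemma matrix_op_delta:
  assumes C: "C \<subseteq> Basis"
  shows "matrix_op C (\<lambda>i j. if i = j then 1 else 0) = diag Basis (indicator C)"
proof (rule endo_eq_ent)
  fix i j :: 'a assume ij: "i \<in> Basis" "j \<in> Basis"
  then have "ent (diag Basis (indicator C)) i j = (if i = j \<and> i \<in> C then 1 else 0)"
    by (auto simp: ent_def diag_app_basis[OF orthonormal_basis_Basis] inner_Basis)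
  then show "ent (matrix_op C (\<lambda>i j. if i = j then 1 else 0)) i j = ent (diag Basis (indicator C)) i j"
    by (auto simp: ent_matrix_op[OF C ij])
qed

lemma indicator_mult_matrix_op:
  assumes C: "C \<subseteq> Basis"
  shows "diag Basis (indicator C) * matrix_op C M = matrix_op C M"
    "matrix_op C M * diag Basis (indicator C) = matrix_op C M"
proof -
  have fin: "finite C" by (rule finite_subset[OF C finite_Basis])
  show "diag Basis (indicator C) * matrix_op C M = matrix_op C M"
    "matrix_op C M * diag Basis (indicator C) = matrix_op C M"
    unfolding matrix_op_delta[OF C, symmetric] matrix_op_mult[OF C] matrix_op_eq_iff[OF C]
    using fin by (auto simp: if_distrib[of "\<lambda>x. x * _"] if_distrib[of "\<lambda>x. _ * x"] cong: if_cong)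
qed

lemma diag_eq_matrix_op:
  assumes C: "C \<subseteq> Basis" and B: "B \<subseteq> span C"
  shows "diag B g = matrix_op C (ent (diag B g))"
proof (rule endo_eq_ent)
  fix i j :: 'a assume ij: "i \<in> Basis" "j \<in> Basis"
  have z: "e \<bullet> k = 0" if "e \<in> B" "k \<in> Basis - C" for e k
    using inner_eq_zero_of_span[OF orthonormal_basis_Basis C _ that(2)] that B by blast
  have "ent (diag B g) i j = 0" if "i \<notin> C \<or> j \<notin> C"
    unfolding ent_def app_diag inner_sum_left using ij that z
    by (intro sum.neutral) (auto simp: inner_commute)
  then show "ent (diag B g) i j = ent (matrix_op C (ent (diag B g))) i j"
    by (simp add: ent_matrix_op[OF C ij])
qed

text \<open>With z = s - r, equality of squares reads s z + z r = 0. Pairing with an eigenvector e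
  of the symmetric z gives \<nu>(<s e, e> + <r e, e>) = 0, and positivity forces \<nu> = 0.\<close>

lemma inv_sqrt_unique:
  assumes C: "C \<subseteq> Basis" and S: "pos_def_on C S" and R: "pos_def_on C R"
    and eq: "matrix_op C S * matrix_op C S = matrix_op C R * matrix_op C R"
  shows "matrix_op C S = matrix_op C R"
proof (rule ccontr)
  define s r z where "s = matrix_op C S" and "r = matrix_op C R" and "z = s - r"
  assume "matrix_op C S \<noteq> matrix_op C R"
  then have "z \<noteq> 0" by (simp add: z_def s_def r_def)
  have "s * z + z * r = 0" using eq by (simp add: z_def s_def r_def algebra_simps)
  then have sz: "app s (app z v) + app z (app r v) = 0" for v
    by (metis app_simps(1,3,6))
  have adj: "adj s = s" "adj r = r" using matrix_op_symmetric S R by (auto simp: s_def r_def)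
  have "adj z = z"
    by (rule endo_eq_ent) (metis adj ent_simps(3,4) z_def)
  then obtain B \<nu> where B: "orthonormal_basis UNIV B" and z: "z = diag B \<nu>"
    by (rule symmetric_eq_diag)
  have "\<exists>e\<in>B. \<nu> e \<noteq> 0"
  proof (rule ccontr)
    assume "\<not> (\<exists>e\<in>B. \<nu> e \<noteq> 0)"
    then have "z = 0" unfolding z by (intro endo_eqI) (simp add: app_diag)
    then show False using \<open>z \<noteq> 0\<close> by simp
  qed
  then obtain e where e: "e \<in> B" "\<nu> e \<noteq> 0" by blast
  have ze: "app z e = \<nu> e *\<^sub>R e" using diag_app_basis[OF B e(1)] by (simp add: z)
  have "e \<noteq> 0" using B e by (force simp: orthonormal_basis_def)
  \<comment> \<open>Positivity is known only on span C; e lies there because it is a multiple of its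
    image under z.\<close>
  have "app z e \<in> span C" by (simp add: z_def s_def r_def span_diff matrix_op_in_span)
  then have "(1 / \<nu> e) *\<^sub>R app z e \<in> span C" by (rule span_scale)
  then have "e \<in> span C" using e by (simp add: ze)
  then have p: "app s e \<bullet> e > 0" "app r e \<bullet> e > 0"
    using matrix_op_pos[OF C] S R \<open>e \<noteq> 0\<close> by (auto simp: s_def r_def)
  have "app z (app r e) \<bullet> e = \<nu> e * (app r e \<bullet> e)"
    using inner_diag[OF B e(1)] by (simp add: z)
  then have "\<nu> e * (app s e \<bullet> e + app r e \<bullet> e) = (app s (app z e) + app z (app r e)) \<bullet> e"
    by (simp add: ze inner_add_left algebra_simps)
  then show False using e p by (simp add: sz)
qed

text \<open>Justifies the definite description. A witness comes from diagonalising G on span C and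
  taking eigenvalues 1/sqrt \<nu>; uniqueness of positive roots applies because two candidates have
  squares inverse to the same G.\<close>

lemma inv_sqrt_on:
  assumes C: "C \<subseteq> Basis" and G: "pos_def_on C G"
  shows "pos_def_on C (inv_sqrt_on C G)"
    and "matrix_op C (inv_sqrt_on C G) * matrix_op C (inv_sqrt_on C G) * matrix_op C G = diag Basis (indicator C)"
    and "matrix_op C G * (matrix_op C (inv_sqrt_on C G) * matrix_op C (inv_sqrt_on C G)) = diag Basis (indicator C)"
proof -
  let ?Q = "\<lambda>S. (\<forall>i j. i \<notin> C \<or> j \<notin> C \<longrightarrow> S i j = 0) \<and> pos_def_on C S \<and>
     mutually_inverse_on C C G (\<lambda>i j. \<Sum>l\<in>C. S i l * S l j)"
  let ?I = "diag Basis (indicator C)"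
  have inv_iff: "mutually_inverse_on C C G (\<lambda>i j. \<Sum>l\<in>C. S i l * S l j) \<longleftrightarrow>
      matrix_op C G * (matrix_op C S * matrix_op C S) = ?I \<and> matrix_op C S * matrix_op C S * matrix_op C G = ?I" for S
    by (simp only: mutually_inverse_on_iff_matrix_op[OF C] matrix_op_mult[OF C, symmetric] matrix_op_delta[OF C])
  define g where "g = matrix_op C G"
  have gs: "adj g = g" by (simp add: g_def matrix_op_symmetric[OF G])
  have "\<exists>B. orthonormal_basis (span C) B \<and> (\<forall>e\<in>B. \<exists>\<mu>. app g e = \<mu> *\<^sub>R e)"
    by (rule symmetric_eigenbasis_exists)
       (use adj_inner[of g] gs matrix_op_in_span in \<open>auto simp: g_def\<close>)
  then obtain B \<nu> where B: "orthonormal_basis (span C) B" and \<nu>: "\<And>e. e \<in> B \<Longrightarrow> app g e = \<nu> e *\<^sub>R e"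
    by metis
  have BC: "B \<subseteq> span C" using B span_superset[of B] by (simp add: orthonormal_basis_def)
  have nz: "e \<noteq> 0" "e \<bullet> e = 1" if "e \<in> B" for e using B that by (force simp: orthonormal_basis_def)+
  have pos: "\<nu> e > 0" if "e \<in> B" for e
    using matrix_op_pos[OF C G, of e] \<nu>[OF that] nz[OF that] BC that by (auto simp: g_def)
  \<comment> \<open>B spans only span C, so agreement on B gives equality only for operators that
    factor through the projection onto span C.\<close>
  have eqI: "x = y" if "\<And>e. e \<in> B \<Longrightarrow> app x e = app y e" "x = x * ?I" "y = y * ?I" for x y :: "'a endo"
  proof (rule endo_eqI)
    fix v
    have "app ?I v \<in> span C" by (rule diag_in_span) auto
    then have "app ?I v = (\<Sum>e\<in>B. (app ?I v \<bullet> e) *\<^sub>R e)"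
      by (rule orthonormal_basis_sum[OF B, symmetric])
    moreover have "app x (\<Sum>e\<in>B. (app ?I v \<bullet> e) *\<^sub>R e) = app y (\<Sum>e\<in>B. (app ?I v \<bullet> e) *\<^sub>R e)"
      using that(1) by simp
    ultimately have "app (x * ?I) v = app (y * ?I) v" by simp
    then show "app x v = app y v" using that(2,3) by simp
  qed
  have dI: "diag B h = diag B h * ?I" for h
    using diag_eq_matrix_op[OF C BC, of h] indicator_mult_matrix_op(2)[OF C] by metis
  have g: "g = diag B \<nu>"
    by (rule eqI[OF _ _ dI])
       (simp_all add: \<nu> diag_app_basis[OF B], simp add: g_def indicator_mult_matrix_op[OF C])
  have I: "?I = diag B (\<lambda>_. 1)"
  proof (rule eqI[OF _ _ dI])
    fix e assume e: "e \<in> B"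
    have "app ?I e = app (diag Basis (\<lambda>_. 1)) e"
      by (rule diag_cong_span[OF orthonormal_basis_Basis C]) (use e BC in auto)
    then show "app ?I e = app (diag B (\<lambda>_. 1)) e"
      by (simp add: diag_one[OF orthonormal_basis_Basis] diag_app_basis[OF B e])
  next
    show "?I = ?I * ?I" 
      unfolding diag_mult[OF orthonormal_basis_Basis]
      by (rule arg_cong[where f = "diag Basis"]) (auto simp: indicator_def)
  qed
  define h where "h = (\<lambda>e. 1 / sqrt (\<nu> e))"
  \<comment> \<open>Entries outside C are set to 0, as the description in \<open>inv_sqrt_on\<close>
    demands.\<close>
  define S where "S = (\<lambda>i j. if i \<in> C \<and> j \<in> C then ent (diag B h) i j else 0)"
  have S: "matrix_op C S = diag B h"
    by (subst diag_eq_matrix_op[OF C BC]) (simp add: matrix_op_eq_iff[OF C] S_def)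
  have h: "h e * h e * \<nu> e = 1" "h e > 0" if "e \<in> B" for e
    using pos[OF that] by (auto simp: h_def)
  have hB: "diag B (\<lambda>e. h e * h e * \<nu> e) = diag B (\<lambda>_. 1)"
    by (rule endo_eqI) (simp add: app_diag h cong: sum.cong)
  have "pos_def_on C S"
  proof (rule pos_def_onI_matrix_op[OF C])
    have "app (adj (diag B h)) v \<bullet> w = app (diag B h) v \<bullet> w" for v w
      unfolding adj_inner diag_symmetric ..
    then show "adj (matrix_op C S) = matrix_op C S"
      unfolding S using vector_eq_rdot by (intro endo_eqI) blast
    fix v assume v: "v \<in> span C" "v \<noteq> 0"
    have "app (diag B h) v \<bullet> v = (\<Sum>e\<in>B. h e * (v \<bullet> e)\<^sup>2)"
      by (simp add: app_diag inner_sum_left power2_eq_square) (simp add: inner_commute mult_ac)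
    also have "\<dots> > 0"
    proof -
      have "\<exists>e\<in>B. v \<bullet> e \<noteq> 0"
      proof (rule ccontr)
        assume "\<not> (\<exists>e\<in>B. v \<bullet> e \<noteq> 0)"
        then have "(\<Sum>e\<in>B. (v \<bullet> e) *\<^sub>R e) = 0" by simp
        then show False using orthonormal_basis_sum[OF B v(1)] v(2) by simp
      qed
      then obtain e where e: "e \<in> B" "v \<bullet> e \<noteq> 0" by blast
      show ?thesis
        by (rule sum_pos2[OF _ e(1)]) (use B e h(2) in \<open>auto simp: orthonormal_basis_def less_imp_le\<close>)
    qed
    finally show "app (matrix_op C S) v \<bullet> v > 0" by (simp add: S)
  qed
  moreover have "matrix_op C G * (matrix_op C S * matrix_op C S) = ?I"
    "matrix_op C S * matrix_op C S * matrix_op C G = ?I"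
    unfolding g_def[symmetric] S g I diag_mult[OF B] hB[symmetric] by (simp_all only: mult.commute)
  ultimately have QS: "?Q S" unfolding inv_iff by (simp add: S_def)
  have "?Q (inv_sqrt_on C G)"
    unfolding inv_sqrt_on_def
  proof (rule theI[where P = ?Q, OF QS])
    fix R assume R: "?Q R"
    let ?s = "matrix_op C S" and ?r = "matrix_op C R"
    have "?s * ?s = ?s * ?s * (g * (?r * ?r))"
      using R unfolding inv_iff g_def by (simp add: mult.assoc indicator_mult_matrix_op[OF C])
    also have "\<dots> = (?s * ?s * g) * (?r * ?r)" by (simp only: mult.assoc)
    also have "\<dots> = ?r * ?r"
      using QS unfolding inv_iff g_def by (simp add: mult.assoc[symmetric] indicator_mult_matrix_op[OF C])
    finally have "matrix_op C R = matrix_op C S"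
      using inv_sqrt_unique[OF C] QS R by metis
    then have "\<forall>i\<in>C. \<forall>j\<in>C. R i j = S i j" by (simp add: matrix_op_eq_iff[OF C])
    then show "R = S" using R by (intro ext) (auto simp: S_def)
  qed
  then show "pos_def_on C (inv_sqrt_on C G)"
    and "matrix_op C (inv_sqrt_on C G) * matrix_op C (inv_sqrt_on C G) * matrix_op C G = ?I"
    and "matrix_op C G * (matrix_op C (inv_sqrt_on C G) * matrix_op C (inv_sqrt_on C G)) = ?I"
    unfolding inv_iff by blast+
qed

lemma pos_def_on_nonneg:
  assumes "pos_def_on C M" shows "0 \<le> app (matrix_op C M) v \<bullet> v"
proof (cases "\<exists>i\<in>C. v \<bullet> i \<noteq> 0")
  case True
  then show ?thesis using assms unfolding inner_matrix_op pos_def_on_def by (blast intro: less_imp_le)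
next
  case False
  then show ?thesis by (simp add: inner_matrix_op)
qed

text \<open>From S^2 - 1 = -S^2 (G - 1) one first gets |S^2| \<le> 2 and then |S^2 - 1| \<le> 2|G -
  1|. Since S^2 - 1 = (S + 1)(S - 1) and S is nonnegative, S + 1 does not shrink vectors, so the
  bound passes to S - 1.\<close>

lemma norm_inverse_root_minus_one:
  assumes S: "\<And>v. 0 \<le> app S v \<bullet> v" and SG: "S * S * G = 1" and G: "norm (G - 1) \<le> 1 / 2"
  shows "norm (S - 1) \<le> 2 * norm (G - 1)"
proof -
  have e: "S * S - 1 = - (S * S * (G - 1))" using SG by (simp add: algebra_simps)
  have "norm (S * S) \<le> norm (1 :: 'a endo) + norm (S * S - 1)"
    using norm_triangle_ineq[of 1 "S * S - 1"] by simp
  also have "norm (S * S - 1) \<le> norm (S * S) * (1 / 2)"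
    unfolding e norm_minus_cancel
    by (rule order_trans[OF norm_mult_ineq mult_left_mono[OF G norm_ge_zero]])
  finally have S2: "norm (S * S) \<le> 2" by simp
  have "norm (S * S - 1) \<le> norm (S * S) * norm (G - 1)"
    unfolding e norm_minus_cancel by (rule norm_mult_ineq)
  also have "\<dots> \<le> 2 * norm (G - 1)" by (rule mult_right_mono[OF S2 norm_ge_zero])
  finally have K: "norm (S * S - 1) \<le> 2 * norm (G - 1)" .
  show ?thesis
  proof (rule norm_endo_le)
    fix v
    define x where "x = app (S - 1) v"
    have "norm x * norm x \<le> (app S x + x) \<bullet> x"
      using S[of x] by (simp add: inner_add_left power2_norm_eq_inner[symmetric] power2_eq_square)
    also have "\<dots> \<le> norm (app S x + x) * norm x" by (rule norm_cauchy_schwarz)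
    finally have "norm x \<le> norm (app S x + x)" by (cases "norm x = 0") auto
    also have "app S x + x = app (S * S - 1) v" by (simp add: x_def)
    also have "norm \<dots> \<le> 2 * norm (G - 1) * norm v"
      by (rule order_trans[OF norm_app mult_right_mono[OF K norm_ge_zero]])
    finally show "norm (app (S - 1) v) \<le> 2 * norm (G - 1) * norm v" by (simp add: x_def)
  qed
qed


section \<open>Canted functions\<close>

locale canted_setting =
  fixes T :: "'a::euclidean_space \<Rightarrow> 'a" and f :: "'a \<Rightarrow> real"
  assumes lin: "linear T" and mono: "monotone_fun T f"
    and acyc: "acyclic_fun T f" and cant: "canted_fun T f"
begin

abbreviation "M \<equiv> diff_pairs T f"
abbreviation "S \<equiv> sharp M"
abbreviation "F \<equiv> flat M"
abbreviation "C \<equiv> critical T f"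

lemma subsets: "S \<subseteq> Basis" "F \<subseteq> Basis" "C \<subseteq> Basis"
  by (auto simp: sharp_def flat_def critical_def diff_pairs_def supp_rel_def)

lemma disjoint: "S \<inter> F = {}" "C \<inter> S = {}" "C \<inter> F = {}" "Basis = C \<union> S \<union> F"
  using cant subsets(1,2) by (auto simp: canted_fun_def critical_def)

lemma finite_M: "finite M"
  by (rule finite_subset[of _ "Basis \<times> Basis"]) (auto simp: diff_pairs_def supp_rel_def)

lemma M_unique: "(s, t) \<in> M \<Longrightarrow> (s, t') \<in> M \<Longrightarrow> t = t'" "(s, t) \<in> M \<Longrightarrow> (s', t) \<in> M \<Longrightarrow> s = s'"
  using acyc unfolding acyclic_fun_def acyclic_pairing_def by blast+

lemma M_entry: "(s, t) \<in> M \<Longrightarrow> entry T s t \<noteq> 0"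
  by (auto simp: diff_pairs_def supp_rel_def)

section \<open>The deformed operators as elements of the algebra\<close>

definition "T_endo = Endo T"

definition "T_lim = matrix_op Basis (\<lambda>i j. if (i, j) \<in> M then entry T i j else 0)"

definition "scal t = diag Basis (\<lambda>e. exp (t * f e))"

definition "T_deform t = scal t * T_endo * scal (- t)"

definition "lap t = T_deform t * adj (T_deform t) + adj (T_deform t) * T_deform t"

definition "lap_lim = T_lim * adj T_lim + adj T_lim * T_lim"

text \<open>The limit of the Laplacian conjugated by \<open>e\<^sup>-\<^sup>t\<^sup>f\<close>.\<close>

definition "conj_lap_lim = T_endo * adj T_lim + adj T_lim * T_endo"

definition "crit_proj = diag Basis (indicator C)"

text \<open>The projection written \<pi>_t in the overview. That \<open>app\<close> recovers
  \<open>orth_proj\<close> from it is proved in \<open>W_proj_properties\<close> for t with a small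
  perturbation.\<close>

definition "W_proj t = Endo (orth_proj (W_space T f t))"

lemma app_T_endo: "app T_endo = T"
  by (simp add: T_endo_def lin)

lemma ent_T_endo: "ent T_endo i j = entry T i j"
  by (simp add: ent_def entry_def app_T_endo)

lemma ent_T_lim: "i \<in> Basis \<Longrightarrow> j \<in> Basis \<Longrightarrow> ent T_lim i j = (if (i, j) \<in> M then entry T i j else 0)"
  by (simp add: T_lim_def ent_matrix_op)

lemma scal_mult: "scal s * scal t = scal (s + t)"
  by (simp add: scal_def diag_mult[OF orthonormal_basis_Basis] distrib_right exp_add)

lemma scal_zero: "scal 0 = 1"
  by (simp add: scal_def diag_one[OF orthonormal_basis_Basis])

lemma scal_inverse: "scal t * scal (- t) = 1" "scal (- t) * scal t = 1"
  by (simp_all add: scal_mult scal_zero)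

lemma scal_crit_proj: "scal t * crit_proj = crit_proj * scal t"
  by (simp add: scal_def crit_proj_def diag_mult[OF orthonormal_basis_Basis] mult.commute)

lemma ent_scal:
  assumes "i \<in> Basis" "j \<in> Basis"
  shows "ent (scal s * x * scal t) i j = exp (s * f i + t * f j) * ent x i j"
  using assms by (simp add: ent_def scal_def inner_diag[OF orthonormal_basis_Basis]
      diag_app_basis[OF orthonormal_basis_Basis] exp_add)

lemma expO_scal:
  obtains K where "expO K scal" "expO K (\<lambda>t. scal (- t))"
proof -
  define K where "K = (\<Sum>e\<in>Basis. \<bar>f e\<bar>)"
  have K: "\<bar>f e\<bar> \<le> K" if "e \<in> Basis" for e
    unfolding K_def by (rule member_le_sum) (use that in auto)
  have K0: "norm (scal s) \<le> exp (K * \<bar>s\<bar>)" for s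
    unfolding scal_def
  proof (rule norm_diag_le[OF orthonormal_basis_Basis])
    fix e :: 'a assume "e \<in> Basis"
    have "s * f e \<le> \<bar>f e\<bar> * \<bar>s\<bar>" by (metis abs_ge_self abs_mult mult.commute)
    also have "\<dots> \<le> K * \<bar>s\<bar>" by (rule mult_right_mono[OF K]) (use \<open>e \<in> Basis\<close> in auto)
    finally show "\<bar>exp (s * f e)\<bar> \<le> exp (K * \<bar>s\<bar>)" by simp
  qed simp
  have "\<forall>\<^sub>F t in at_top. norm (scal t) \<le> 1 * exp (K * t)"
    "\<forall>\<^sub>F t in at_top. norm (scal (- t)) \<le> 1 * exp (K * t)"
    using eventually_ge_at_top[of 0] by (eventually_elim, use K0 in \<open>metis abs_minus_cancel abs_of_nonneg mult_1\<close>)+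
  then have "expO K scal" "expO K (\<lambda>t. scal (- t))" unfolding expO_def by blast+
  then show thesis by (rule that)
qed

lemma exp_op_eq: "exp_op t f = app (scal t)"
  by (rule ext) (simp add: exp_op_def scal_def app_diag)

lemma deform_eq: "deform T f t = app (T_deform t)"
  by (rule ext) (simp add: deform_def exp_op_eq T_deform_def app_T_endo)

lemma laplacian_eq: "laplacian T f t = app (lap t)"
  by (rule ext) (simp add: laplacian_def deform_eq lap_def adj.rep_eq)

section \<open>Limits of the deformed operators and of their conjugates\<close>

lemma conj_T_deform: "scal (- t) * T_deform t * scal t = T_endo"
proof -
  have "scal (- t) * T_deform t * scal t = (scal (- t) * scal t) * T_endo * (scal (- t) * scal t)"
    by (simp only: T_deform_def mult.assoc)
  then show ?thesis by (simp add: scal_inverse)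
qed

text \<open>Monotonicity makes the exponent negative on the support of T except where f i = f j, and
  there the pair belongs to df. The factor c is 1 for T_t and 2 for its conjugated adjoint.\<close>

lemma econv_exp_entry:
  assumes "i \<in> Basis" "j \<in> Basis" "c > 0"
  shows "econv (\<lambda>t. exp (c * (f i - f j) * t) * entry T i j) (if (i, j) \<in> M then entry T i j else 0)"
proof (cases "entry T i j \<noteq> 0 \<and> f i \<noteq> f j")
  case True
  then have "(i, j) \<in> supp_rel T" using assms by (simp add: supp_rel_def)
  then have "f i \<le> f j" using mono by (auto simp: monotone_fun_def)
  then have neg: "c * (f i - f j) < 0" using True assms by (intro mult_pos_neg) auto
  have "esmall (\<lambda>t. exp (c * (f i - f j) * t) * entry T i j)"
    by (rule esmallI[OF _ neg]) (auto simp: expO_def abs_mult intro!: exI[of _ "\<bar>entry T i j\<bar>"])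
  then show ?thesis using True by (simp add: diff_pairs_def econv_zero_iff)
next
  case False
  then show ?thesis using assms by (auto simp: diff_pairs_def supp_rel_def)
qed

lemma econv_T_deform: "econv T_deform T_lim"
proof (rule econv_entI)
  fix i j :: 'a assume ij: "i \<in> Basis" "j \<in> Basis"
  have "ent (T_deform t) i j = exp (1 * (f i - f j) * t) * entry T i j" for t
    unfolding T_deform_def ent_scal[OF ij] ent_T_endo by (simp add: algebra_simps)
  then show "econv (\<lambda>t. ent (T_deform t) i j) (ent T_lim i j)"
    using econv_exp_entry[OF ij, of 1] by (simp add: ent_T_lim[OF ij])
qed

lemma econv_adj_T_deform: "econv (\<lambda>t. adj (T_deform t)) (adj T_lim)"
  by (rule econv_entI) (simp add: econv_ent[OF econv_T_deform])

text \<open>The adjoint of T_t already carries e^(-tf) on the left and e^(tf) on the right, so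
  conjugation doubles the exponents instead of cancelling them.\<close>

lemma econv_conj_adj_T_deform: "econv (\<lambda>t. scal (- t) * adj (T_deform t) * scal t) (adj T_lim)"
proof (rule econv_entI)
  fix i j :: 'a assume ij: "i \<in> Basis" "j \<in> Basis"
  have "ent (scal (- t) * adj (T_deform t) * scal t) i j = exp (2 * (f j - f i) * t) * entry T j i" for t
    unfolding ent_scal[OF ij] ent_simps T_deform_def ent_scal[OF ij(2,1)] ent_T_endo mult.assoc[symmetric] exp_add[symmetric]
    by (simp add: algebra_simps)
  then show "econv (\<lambda>t. ent (scal (- t) * adj (T_deform t) * scal t) i j) (ent (adj T_lim) i j)"
    using econv_exp_entry[OF ij(2,1), of 2] by (simp add: ent_T_lim ij)
qed

lemma econv_lap: "econv lap lap_lim"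
  unfolding lap_def[abs_def] lap_lim_def by (intro econv_add econv_mult econv_T_deform econv_adj_T_deform)

lemma econv_conj_lap: "econv (\<lambda>t. scal (- t) * lap t * scal t) conj_lap_lim"
proof -
  have "scal (- t) * lap t * scal t = T_endo * (scal (- t) * adj (T_deform t) * scal t)
      + (scal (- t) * adj (T_deform t) * scal t) * T_endo" for t
    unfolding lap_def distrib_left distrib_right conj_mult[OF scal_inverse(1)] conj_T_deform ..
  then show ?thesis unfolding conj_lap_lim_def
    by (simp only:) (intro econv_add econv_mult econv_const econv_conj_adj_T_deform)
qed

lemma adj_lap: "adj (lap t) = lap t"
  by (simp add: lap_def adj_plus adj_mult adj_adj)

lemma lap_nonneg: "0 \<le> app (lap t) v \<bullet> v"
proof -
  have "app (lap t) v \<bullet> v = app (adj (T_deform t)) v \<bullet> app (adj (T_deform t)) v + app (T_deform t) v \<bullet> app (T_deform t) v"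
    using adj_inner_right[of v "T_deform t" "app (T_deform t) v"] adj_inner_right[of v "adj (T_deform t)" "app (adj (T_deform t)) v"]
    by (simp add: lap_def inner_add_left inner_add_right adj_adj inner_commute)
  then show ?thesis by simp
qed

section \<open>The spectrum of the limit Laplacian\<close>

lemma app_T_lim:
  assumes "(s, t) \<in> M"
  shows "app T_lim t = entry T s t *\<^sub>R s" "app (adj T_lim) s = entry T s t *\<^sub>R t"
proof -
  have B: "s \<in> Basis" "t \<in> Basis" using assms by (auto simp: diff_pairs_def supp_rel_def)
  show "app T_lim t = entry T s t *\<^sub>R s"
  proof (rule euclidean_eqI)
    fix i :: 'a assume i: "i \<in> Basis"
    show "app T_lim t \<bullet> i = entry T s t *\<^sub>R s \<bullet> i"
      using ent_T_lim[OF i B(2)] assms M_unique(2)[OF assms, of i] i B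
      by (auto simp: ent_def inner_Basis)
  qed
  show "app (adj T_lim) s = entry T s t *\<^sub>R t"
  proof (rule euclidean_eqI)
    fix i :: 'a assume i: "i \<in> Basis"
    have "app (adj T_lim) s \<bullet> i = ent T_lim s i" using ent_simps(4)[of T_lim i] by (simp add: ent_def)
    then show "app (adj T_lim) s \<bullet> i = entry T s t *\<^sub>R t \<bullet> i"
      using ent_T_lim[OF B(1) i] assms M_unique(1)[OF assms, of i] i B
      by (auto simp: inner_Basis)
  qed
qed

lemma app_T_lim_zero:
  assumes "e \<in> Basis"
  shows "e \<notin> F \<Longrightarrow> app T_lim e = 0" "e \<notin> S \<Longrightarrow> app (adj T_lim) e = 0"
proof -
  show "app T_lim e = 0" if "e \<notin> F"
  proof (rule euclidean_eqI)
    fix i :: 'a assume i: "i \<in> Basis"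
    show "app T_lim e \<bullet> i = 0 \<bullet> i"
      using ent_T_lim[OF i assms] that by (auto simp: ent_def flat_def)
  qed
  show "app (adj T_lim) e = 0" if "e \<notin> S"
  proof (rule euclidean_eqI)
    fix i :: 'a assume i: "i \<in> Basis"
    have "app (adj T_lim) e \<bullet> i = ent T_lim e i" using ent_simps(4)[of T_lim i] by (simp add: ent_def)
    then show "app (adj T_lim) e \<bullet> i = 0 \<bullet> i"
      using ent_T_lim[OF assms i] that by (auto simp: sharp_def)
  qed
qed

definition "weights = (\<lambda>(s, t). (entry T s t)\<^sup>2) ` M"

definition "weight e = app lap_lim e \<bullet> e"

text \<open>A positive lower bound for the nonzero eigenvalues of \<open>lap_lim\<close>; the
  inserted 1 keeps the minimum meaningful when df is empty.\<close>

definition "gap = Min (insert 1 weights)"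

lemma finite_weights: "finite weights"
  by (simp add: weights_def finite_M)

lemma gap_pos: "gap > 0"
  using finite_weights M_entry by (auto simp: gap_def weights_def)

text \<open>As f is canted, e lies in exactly one of C, S and F. On C both products vanish, and on S
  or F exactly one survives; it goes to the partner of e and back, which multiplies e by the squared
  entry.\<close>

lemma app_lap_lim:
  assumes "e \<in> Basis"
  shows "app lap_lim e = weight e *\<^sub>R e" and "e \<in> C \<Longrightarrow> weight e = 0"
    and "e \<notin> C \<Longrightarrow> weight e \<in> weights" and "e \<notin> C \<Longrightarrow> gap \<le> weight e"
proof -
  have ee: "e \<bullet> e = 1" using assms by simp
  have *: "(e \<in> C \<longrightarrow> app lap_lim e = 0) \<and> (e \<notin> C \<longrightarrow> (\<exists>w\<in>weights. app lap_lim e = w *\<^sub>R e))"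
  proof -
    consider "e \<in> C" | s where "(s, e) \<in> M" | t where "(e, t) \<in> M"
    proof -
      have "e \<in> C \<or> e \<in> S \<or> e \<in> F" using assms disjoint(4) by blast
      then show thesis using that by (auto simp: sharp_def flat_def)
    qed
    then show ?thesis
    proof cases
      case 1
      then have "e \<notin> F" "e \<notin> S" using disjoint by auto
      with 1 show ?thesis by (simp add: lap_lim_def app_T_lim_zero[OF assms])
    next
      case 2
      then have "e \<in> F" by (auto simp: flat_def)
      then have "e \<notin> C" "e \<notin> S" using disjoint by auto
      moreover have "app lap_lim e = (entry T s e)\<^sup>2 *\<^sub>R e"
        using app_T_lim_zero(2)[OF assms \<open>e \<notin> S\<close>] app_T_lim[OF 2] by (simp add: lap_lim_def power2_eq_square)
      ultimately show ?thesis using 2 by (force simp: weights_def)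
    next
      case 3
      then have "e \<in> S" by (auto simp: sharp_def)
      then have "e \<notin> C" "e \<notin> F" using disjoint by auto
      moreover have "app lap_lim e = (entry T e t)\<^sup>2 *\<^sub>R e"
        using app_T_lim_zero(1)[OF assms \<open>e \<notin> F\<close>] app_T_lim[OF 3] by (simp add: lap_lim_def power2_eq_square)
      ultimately show ?thesis using 3 by (force simp: weights_def)
    qed
  qed
  then show "app lap_lim e = weight e *\<^sub>R e" "e \<in> C \<Longrightarrow> weight e = 0"
    by (auto simp: weight_def ee)
  show w: "weight e \<in> weights" if "e \<notin> C" using * that by (auto simp: weight_def ee)
  show "gap \<le> weight e" if "e \<notin> C" using w[OF that] finite_weights by (simp add: gap_def)
qed

lemma lap_lim_diag: "lap_lim = diag Basis weight"
  by (rule diag_eqI[OF orthonormal_basis_Basis]) (rule app_lap_lim(1))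

lemma app_crit_proj: "e \<in> Basis \<Longrightarrow> app crit_proj e = (if e \<in> C then e else 0)"
  by (simp add: crit_proj_def diag_app_basis[OF orthonormal_basis_Basis])

lemma inner_crit_proj: "e \<in> Basis \<Longrightarrow> app crit_proj v \<bullet> e = (if e \<in> C then v \<bullet> e else 0)"
  by (simp add: crit_proj_def inner_diag[OF orthonormal_basis_Basis])

lemma crit_proj_crit_proj: "crit_proj * crit_proj = crit_proj"
  by (rule endo_eq_Basis) (simp add: app_crit_proj)

lemma crit_proj_lap_lim: "crit_proj * lap_lim = 0"
  by (rule endo_eq_Basis) (auto simp: app_crit_proj app_lap_lim)

lemma norm_crit_proj: "norm crit_proj \<le> 1"
  unfolding crit_proj_def by (rule norm_diag_le[OF orthonormal_basis_Basis]) (auto simp: indicator_def)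

definition "factors = sorted_list_of_set weights"

lemma vanishing_poly_lap_lim: "vanishing_poly factors lap_lim = crit_proj"
proof (rule endo_eq_Basis)
  fix e :: 'a assume e: "e \<in> Basis"
  show "app (vanishing_poly factors lap_lim) e = app crit_proj e"
  proof (cases "e \<in> C")
    case True
    have "(\<Prod>\<nu>\<leftarrow>xs. 1 - 0 / \<nu>) = (1 :: real)" for xs by (induction xs) auto
    then show ?thesis
      using app_vanishing_poly_eigen[OF app_lap_lim(1)[OF e], of factors] app_lap_lim(2)[OF e True] app_crit_proj[OF e] True by simp
  next
    case False
    have "weight e \<in> set factors" "weight e \<noteq> 0"
      using app_lap_lim(3,4)[OF e False] gap_pos finite_weights by (auto simp: factors_def)
    then have "(\<Prod>\<nu>\<leftarrow>factors. 1 - weight e / \<nu>) = 0"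
      by (auto simp: prod_list_zero_iff intro!: image_eqI[of _ _ "weight e"])
    then show ?thesis
      using app_vanishing_poly_eigen[OF app_lap_lim(1)[OF e], of factors] app_crit_proj[OF e] False by simp
  qed
qed

section \<open>The small eigenvalues of the deformed Laplacian\<close>

lemma esmall_lap: "esmall (\<lambda>t. lap t - lap_lim)"
  using econv_lap by (simp add: econv_def)

lemma eventually_lap_close: "\<forall>\<^sub>F t in at_top. norm (lap t - lap_lim) \<le> gap / 4"
  using esmall_eventually_less[OF esmall_lap, of "gap / 4"] gap_pos by (auto elim: eventually_mono)

lemma lap_eigenbasis:
  assumes "norm (lap t - lap_lim) \<le> gap / 4"
  obtains B \<nu> where "orthonormal_basis UNIV B" "lap t = diag B \<nu>" "\<forall>e\<in>B. 0 \<le> \<nu> e"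
    "\<forall>e\<in>B. \<nu> e < gap / 2 \<longrightarrow> \<nu> e \<le> norm (lap t - lap_lim)"
    "card {e \<in> B. \<nu> e < gap / 2} = card C"
proof -
  obtain B \<nu> where B: "orthonormal_basis UNIV B" "lap t = diag B \<nu>"
    using symmetric_eq_diag[OF adj_lap] .
  have pos: "0 \<le> \<nu> e" if "e \<in> B" for e
    using lap_nonneg[of t e] that B(1) by (simp add: B(2) diag_app_basis[OF B(1)] orthonormal_basis_def)
  have *: "\<And>i. i \<in> C \<Longrightarrow> weight i = 0" "\<And>i. i \<in> Basis - C \<Longrightarrow> gap \<le> weight i"
    using app_lap_lim subsets by auto
  note d = diag_perturbation[OF B pos lap_lim_diag subsets(3) * gap_pos assms]
  show thesis by (rule that[OF B]) (use pos d in auto)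
qed

lemma card_C_le: "card C \<le> DIM('a)"
  by (rule card_mono[OF finite_Basis subsets(3)])

text \<open>For large t the first |C| eigenvalues are bounded by the perturbation norm, which tends
  to 0, whereas all others are at least gap/2.\<close>

lemma vanishing_indices_eq: "vanishing_indices T f = {..<card C}"
proof (intro set_eqI iffI)
  fix i assume i: "i \<in> {..<card C}"
  have "\<forall>\<^sub>F t in at_top. norm (nth_eigenvalue (app (lap t)) i) \<le> norm (lap t - lap_lim)"
    using eventually_lap_close
  proof eventually_elim
    case (elim t)
    obtain B \<nu> where B: "orthonormal_basis UNIV B" "lap t = diag B \<nu>" "\<forall>e\<in>B. 0 \<le> \<nu> e"
      "\<forall>e\<in>B. \<nu> e < gap / 2 \<longrightarrow> \<nu> e \<le> norm (lap t - lap_lim)"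
      "card {e \<in> B. \<nu> e < gap / 2} = card C"
      using lap_eigenbasis[OF elim] .
    have iD: "i < DIM('a)" using i card_C_le by simp
    obtain e where e: "e \<in> B" "nth_eigenvalue (app (lap t)) i = \<nu> e"
      using nth_eigenvalue_diag(1)[OF B(1) iD, of \<nu>] by (auto simp: B(2))
    moreover have "nth_eigenvalue (app (lap t)) i < gap / 2"
      using nth_eigenvalue_diag(2)[OF B(1) iD, of \<nu> "gap / 2"] i unfolding B(2,5) by simp
    ultimately show ?case using B(3,4) by simp
  qed
  then have "((\<lambda>t. nth_eigenvalue (app (lap t)) i) \<longlongrightarrow> 0) at_top"
    by (rule Lim_null_comparison) (use esmall_tendsto[OF esmall_lap] tendsto_norm_zero in blast)
  then show "i \<in> vanishing_indices T f" using i card_C_le by (simp add: vanishing_indices_def laplacian_eq)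
next
  fix i assume "i \<in> vanishing_indices T f"
  then have i: "i < DIM('a)" and lim: "((\<lambda>t. nth_eigenvalue (app (lap t)) i) \<longlongrightarrow> 0) at_top"
    by (auto simp: vanishing_indices_def laplacian_eq)
  have "\<forall>\<^sub>F t in at_top. nth_eigenvalue (app (lap t)) i < gap / 2"
    using order_tendstoD(2)[OF lim, of "gap / 2"] gap_pos by simp
  \<comment> \<open>The property does not depend on t, so holding eventually means holding.\<close>
  with eventually_lap_close have "\<forall>\<^sub>F t :: real in at_top. i < card C"
  proof eventually_elim
    case (elim t)
    obtain B \<nu> where B: "orthonormal_basis UNIV B" "lap t = diag B \<nu>"
      "card {e \<in> B. \<nu> e < gap / 2} = card C"
      using lap_eigenbasis[OF elim(1)] by metis
    then show ?case using nth_eigenvalue_diag(2)[OF B(1) i, of \<nu> "gap / 2"] elim(2) by simp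
  qed
  then show "i \<in> {..<card C}" by simp
qed

text \<open>In an eigenbasis of the Laplacian, W(t) is spanned by the eigenvectors with eigenvalue
  below gap/2, so all claims become statements about functions on that basis.\<close>

lemma W_proj_properties:
  assumes t: "norm (lap t - lap_lim) \<le> gap / 4"
  shows "app (W_proj t) = orth_proj (W_space T f t)" and "W_proj t * W_proj t = W_proj t" and "adj (W_proj t) = W_proj t"
    and "lap t * W_proj t = W_proj t * lap t" and "norm (W_proj t) \<le> 1" and "norm (lap t * W_proj t) \<le> norm (lap t - lap_lim)"
    and "norm (crit_proj * (1 - W_proj t)) \<le> 2 / gap * norm (lap t - lap_lim)"
proof -
  obtain B \<nu> where B: "orthonormal_basis UNIV B" "lap t = diag B \<nu>" "\<forall>e\<in>B. 0 \<le> \<nu> e"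
    "\<forall>e\<in>B. \<nu> e < gap / 2 \<longrightarrow> \<nu> e \<le> norm (lap t - lap_lim)"
    "card {e \<in> B. \<nu> e < gap / 2} = card C"
    using lap_eigenbasis[OF t] .
  define L where "L = {e \<in> B. \<nu> e < gap / 2}"
  have "W_space T f t = span (\<Union>i<card C. eigenspace (app (diag B \<nu>)) (nth_eigenvalue (app (diag B \<nu>)) i))"
    by (simp add: W_space_def vanishing_indices_eq laplacian_eq B(2))
  also have "\<dots> = span L"
    using nth_eigenvalue_diag(4)[OF B(1), of \<nu> "gap / 2"] span_Union_eigenspace_diag[OF B(1), of \<nu> "gap / 2"]
    unfolding B(5) L_def by simp
  finally have W: "orth_proj (W_space T f t) = app (diag B (indicator L))"
    using orth_proj_diag[OF B(1), of L] by (simp add: L_def)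
  have W_proj: "W_proj t = diag B (indicator L)"
    unfolding W_proj_def W by (simp add: app_inverse)
  show "app (W_proj t) = orth_proj (W_space T f t)" by (simp add: W_proj W)
  show "W_proj t * W_proj t = W_proj t" unfolding W_proj diag_mult[OF B(1)]
    by (rule arg_cong[where f = "diag B"]) (auto simp: indicator_def)
  show "adj (W_proj t) = W_proj t"
  proof (rule endo_eqI)
    fix v
    have "app (adj (W_proj t)) v \<bullet> w = app (W_proj t) v \<bullet> w" for w by (simp add: adj_inner W_proj diag_symmetric)
    then show "app (adj (W_proj t)) v = app (W_proj t) v" using vector_eq_rdot by blast
  qed
  show "lap t * W_proj t = W_proj t * lap t" unfolding W_proj B(2) diag_mult[OF B(1)] by (simp only: mult.commute)
  show "norm (W_proj t) \<le> 1" unfolding W_proj by (rule norm_diag_le[OF B(1)]) (auto simp: indicator_def)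
  show "norm (lap t * W_proj t) \<le> norm (lap t - lap_lim)"
    unfolding W_proj B(2) diag_mult[OF B(1)]
    by (rule norm_diag_le[OF B(1)]) (use B(2,3,4) in \<open>auto simp: indicator_def L_def\<close>)
  \<comment> \<open>The inverse of the Laplacian off W(t). As \<open>crit_proj\<close> annihilates
    \<open>lap_lim\<close>, it lets the perturbation be factored out of
    \<open>crit_proj * (1 - W_proj t)\<close>.\<close>
  define R where "R = diag B (\<lambda>e. if e \<in> L then 0 else 1 / \<nu> e)"
  have "lap t * R = 1 - W_proj t"
    unfolding R_def W_proj B(2) diag_mult[OF B(1)] 
  proof (rule diag_eqI[OF B(1), symmetric])
    fix e assume "e \<in> B"
    then have "e \<notin> L \<Longrightarrow> \<nu> e \<noteq> 0" using gap_pos by (auto simp: L_def)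
    then show "app (1 - diag B (indicator L)) e = (\<nu> e * (if e \<in> L then 0 else 1 / \<nu> e)) *\<^sub>R e"
      using \<open>e \<in> B\<close> by (auto simp: diag_app_basis[OF B(1)])
  qed
  then have "crit_proj * (1 - W_proj t) = crit_proj * lap t * R" by (simp only: mult.assoc)
  also have "\<dots> = crit_proj * (lap t - lap_lim) * R" by (simp add: right_diff_distrib crit_proj_lap_lim)
  finally have e: "crit_proj * (1 - W_proj t) = crit_proj * (lap t - lap_lim) * R" .
  have "norm R \<le> 2 / gap"
    unfolding R_def
  proof (rule norm_diag_le[OF B(1)])
    fix e assume "e \<in> B"
    then show "\<bar>if e \<in> L then 0 else 1 / \<nu> e\<bar> \<le> 2 / gap"
      using frac_le[of 1 1 "gap / 2" "\<nu> e"] gap_pos B(3) by (auto simp: L_def)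
  qed (use gap_pos in simp)
  then have "norm (crit_proj * (lap t - lap_lim) * R) \<le> (1 * norm (lap t - lap_lim)) * (2 / gap)"
    by (intro order_trans[OF norm_mult_ineq] mult_mono order_trans[OF norm_mult_ineq] norm_crit_proj) auto
  then show "norm (crit_proj * (1 - W_proj t)) \<le> 2 / gap * norm (lap t - lap_lim)" by (simp add: e mult.commute)
qed

lemma expO_P: "expO 0 W_proj"
  unfolding expO_def using eventually_lap_close
  by (intro exI[of _ 1]) (auto elim!: eventually_mono intro: W_proj_properties(5))

lemma esmall_lap_W_proj: "esmall (\<lambda>t. lap t * W_proj t)"
  by (rule esmall_norm_le[OF esmall_lap])
     (use eventually_lap_close in \<open>auto elim!: eventually_mono intro: W_proj_properties(6)\<close>)

text \<open>With q the polynomial at the Laplacian, p the projection and c its limit, split q - p as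
  (q - 1)p + (q - c)(1 - p) + c(1 - p). The first term decays because the polynomial is 1 at 0, the
  second because q tends to c, the third by the estimate with \<open>R\<close>.\<close>

lemma esmall_vanishing_poly_W_proj: "esmall (\<lambda>t. vanishing_poly factors (lap t) - W_proj t)"
proof -
  have "esmall (\<lambda>t. crit_proj * (1 - W_proj t))"
    by (rule esmall_eventually_le[OF esmall_lap eventually_mono[OF eventually_lap_close W_proj_properties(7)]])
       (use gap_pos in auto)
  moreover have "esmall (\<lambda>t. vanishing_poly factors (lap t) - crit_proj)"
    using econv_vanishing_poly[OF econv_lap, of factors] by (simp add: vanishing_poly_lap_lim econv_def)
  then have "esmall (\<lambda>t. (vanishing_poly factors (lap t) - crit_proj) * (1 - W_proj t))"
    by (rule esmall_mult_right) (intro expO_diff expO_P expO_const, simp)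
  moreover have "esmall (\<lambda>t. (vanishing_poly factors (lap t) - 1) * W_proj t)"
    by (rule esmall_vanishing_poly_minus_one(2)[OF econv_imp_expO0[OF econv_lap] esmall_lap_W_proj])
  ultimately have "esmall (\<lambda>t. (vanishing_poly factors (lap t) - 1) * W_proj t
      + ((vanishing_poly factors (lap t) - crit_proj) * (1 - W_proj t) + crit_proj * (1 - W_proj t)))"
    by (intro esmall_add)
  moreover have "(q - 1) * p + ((q - c) * (1 - p) + c * (1 - p)) = q - p" for q p c :: "'a endo"
    by (simp add: algebra_simps)
  ultimately show ?thesis by simp
qed

lemma econv_W_proj: "econv W_proj crit_proj"
  by (rule econv_esmall_diff[OF econv_vanishing_poly[OF econv_lap, of factors, unfolded vanishing_poly_lap_lim]
        esmall_vanishing_poly_W_proj])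

section \<open>The idempotent k\<close>

text \<open>The S-components of T v are the submatrix of condition (b) applied to the coordinates of
  v; a left inverse recovers v from them.\<close>

lemma span_F_eq_zero:
  assumes v: "v \<in> span F" and Tv: "\<And>s. s \<in> S \<Longrightarrow> T v \<bullet> s = 0"
  shows "v = 0"
proof (rule euclidean_eqI)
  obtain N where N: "mutually_inverse_on S F (entry T) N"
    using acyc by (auto simp: acyclic_fun_def acyclic_pairing_def invertible_on_def)
  have fin: "finite F" "finite S" using subsets finite_subset[OF _ finite_Basis] by auto
  have "v = (\<Sum>\<tau>\<in>F. (v \<bullet> \<tau>) *\<^sub>R \<tau>)"
    using orthonormal_basis_sum[OF orthonormal_basis_subset_Basis[OF subsets(2)] v] by simp
  then have "T v = T (\<Sum>\<tau>\<in>F. (v \<bullet> \<tau>) *\<^sub>R \<tau>)" by (rule arg_cong)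
  also have "\<dots> = (\<Sum>\<tau>\<in>F. (v \<bullet> \<tau>) *\<^sub>R T \<tau>)"
    by (simp add: linear_sum[OF lin] linear_scale[OF lin])
  finally have Tv': "T v \<bullet> s = (\<Sum>\<tau>\<in>F. entry T s \<tau> * (v \<bullet> \<tau>))" for s
    by (simp add: inner_sum_left entry_def mult.commute)
  fix i :: 'a assume i: "i \<in> Basis"
  show "v \<bullet> i = 0 \<bullet> i"
  proof (cases "i \<in> F")
    case True
    have "0 = (\<Sum>s\<in>S. N i s * (T v \<bullet> s))" by (simp add: Tv)
    also have "\<dots> = (\<Sum>\<tau>\<in>F. (\<Sum>s\<in>S. N i s * entry T s \<tau>) * (v \<bullet> \<tau>))"
      unfolding Tv' sum_distrib_left sum_distrib_right by (subst sum.swap) (simp add: mult.assoc)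
    also have "\<dots> = (\<Sum>\<tau>\<in>F. if i = \<tau> then v \<bullet> \<tau> else 0)"
      using N True by (intro sum.cong) (auto simp: mutually_inverse_on_def)
    also have "\<dots> = v \<bullet> i" using fin True by simp
    finally show ?thesis by simp
  next
    case False
    then show ?thesis using v i in_span_iff_Basis[OF subsets(2)] by simp
  qed
qed

lemma k_op_exists:
  "\<exists>k. linear k \<and> k \<circ> k = k \<and> range k = {v. \<forall>\<sigma>\<in>S. T v \<bullet> \<sigma> = 0} \<and> {v. k v = 0} = span F"
proof -
  obtain N where N: "mutually_inverse_on S F (entry T) N"
    using acyc by (auto simp: acyclic_fun_def acyclic_pairing_def invertible_on_def)
  have fin: "finite F" "finite S" using subsets finite_subset[OF _ finite_Basis] by auto
  \<comment> \<open>The vector of span F whose image under T has the same S-components as T v;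
    subtracting it from v is k.\<close>
  define c where "c = (\<lambda>v. \<Sum>\<tau>\<in>F. (\<Sum>s\<in>S. N \<tau> s * (T v \<bullet> s)) *\<^sub>R \<tau>)"
  define k where "k = (\<lambda>v. v - c v)"
  have "linear c" unfolding c_def
    by (intro linear_compose_sum ballI linearI)
       (auto simp: linear_add[OF lin] linear_scale[OF lin] inner_add_left algebra_simps sum.distrib
          scaleR_add_left sum_distrib_left)
  then have lk: "linear k" unfolding k_def by (intro linear_compose_sub linear_id[unfolded id_def])
  have cF: "c v \<in> span F" for v unfolding c_def by (intro span_sum span_scale span_base)
  have Tc: "T (c v) \<bullet> s = T v \<bullet> s" if s: "s \<in> S" for v s
  proof -
    have "T (c v) \<bullet> s = (\<Sum>\<tau>\<in>F. (\<Sum>s'\<in>S. N \<tau> s' * (T v \<bullet> s')) * entry T s \<tau>)"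
      by (simp add: c_def linear_sum[OF lin] linear_scale[OF lin] inner_sum_left entry_def)
    also have "\<dots> = (\<Sum>s'\<in>S. (\<Sum>\<tau>\<in>F. entry T s \<tau> * N \<tau> s') * (T v \<bullet> s'))"
      unfolding sum_distrib_right by (subst sum.swap) (simp add: mult_ac)
    also have "\<dots> = (\<Sum>s'\<in>S. if s = s' then T v \<bullet> s' else 0)"
      using N s by (intro sum.cong) (auto simp: mutually_inverse_on_def)
    also have "\<dots> = T v \<bullet> s" using fin s by simp
    finally show ?thesis .
  qed
  have kR: "T (k v) \<bullet> s = 0" if "s \<in> S" for v s
    using Tc[OF that] by (simp add: k_def linear_diff[OF lin] inner_diff_left)
  have kid: "k v = v" if "\<forall>s\<in>S. T v \<bullet> s = 0" for v
    using that by (simp add: k_def c_def)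
  have "k \<circ> k = k" using kid kR by (auto simp: fun_eq_iff)
  moreover have "range k = {v. \<forall>\<sigma>\<in>S. T v \<bullet> \<sigma> = 0}"
  proof safe
    fix v assume "\<forall>s\<in>S. T v \<bullet> s = 0"
    then show "v \<in> range k" using kid[of v] by (metis rangeI)
  qed (use kR in auto)
  moreover have "{v. k v = 0} = span F"
  proof safe
    fix v assume "k v = 0"
    then show "v \<in> span F" using cF[of v] by (simp add: k_def)
  next
    fix v assume "v \<in> span F"
    then have "k v \<in> span F" using cF by (simp add: k_def span_diff)
    then show "k v = 0" using kR by (rule span_F_eq_zero)
  qed
  ultimately show ?thesis using lk by blast
qed

text \<open>An idempotent is determined by range and kernel: with k' another candidate, k' fixes k v
  and kills v - k v, so k' v = k v.\<close>

lemma k_op: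
  shows "s \<in> S \<Longrightarrow> T (k_op T f v) \<bullet> s = 0" and "k_op T f v - v \<in> span F"
proof -
  let ?Q = "\<lambda>k. linear k \<and> k \<circ> k = k \<and> range k = {v. \<forall>\<sigma>\<in>S. T v \<bullet> \<sigma> = 0} \<and> {v. k v = 0} = span F"
  have "\<exists>!k. ?Q k"
  proof (rule ex_ex1I[OF k_op_exists])
    fix k k' assume k: "?Q k" and k': "?Q k'"
    show "k = k'"
    proof
      fix v
      have "k v \<in> range k'" using k k' by auto
      then obtain y where "k v = k' y" by blast
      moreover have "k' (k' y) = k' y" using k' by (simp only: fun_eq_iff o_apply)
      ultimately have "k' (k v) = k v" by simp
      moreover have "k (v - k v) = 0" using k by (auto simp: linear_diff fun_eq_iff)
      then have "k' (v - k v) = 0" using k k' by blast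
      then have "k' v = k' (k v)" using k' by (auto simp: linear_diff)
      ultimately show "k v = k' v" by simp
    qed
  qed
  then have Q: "?Q (k_op T f)" unfolding k_op_def by (rule theI')
  then have "k_op T f v \<in> {v. \<forall>\<sigma>\<in>S. T v \<bullet> \<sigma> = 0}" by blast
  then show "s \<in> S \<Longrightarrow> T (k_op T f v) \<bullet> s = 0" by blast
  have "k_op T f (k_op T f v - v) = 0" using Q by (auto simp: linear_diff fun_eq_iff)
  then show "k_op T f v - v \<in> span F" using Q by blast
qed

section \<open>The limit of the conjugated projection\<close>

lemma adj_T_lim_in_span: "app (adj T_lim) v \<in> span F"
proof -
  have "app (adj T_lim) v \<bullet> i = 0" if "i \<in> Basis - F" for i
    using app_T_lim_zero(1)[of i] that by (simp add: adj_inner)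
  then show ?thesis using in_span_iff_Basis[OF subsets(2)] by blast
qed

lemma adj_T_lim_zero:
  assumes "\<And>s. s \<in> S \<Longrightarrow> v \<bullet> s = 0" shows "app (adj T_lim) v = 0"
proof (rule euclidean_eqI)
  fix i :: 'a assume i: "i \<in> Basis"
  have "app (adj T_lim) v \<bullet> i = v \<bullet> app T_lim i" by (rule adj_inner)
  also have "\<dots> = 0"
  proof (cases "i \<in> F")
    case True
    then obtain s where s: "(s, i) \<in> M" by (auto simp: flat_def)
    then have "s \<in> S" by (auto simp: sharp_def)
    then show ?thesis by (simp add: app_T_lim(1)[OF s] assms)
  next
    case False
    then show ?thesis using app_T_lim_zero(1)[OF i] by simp
  qed
  finally show "app (adj T_lim) v \<bullet> i = 0 \<bullet> i" by simp
qed

text \<open>Vectors of span F have no S-components, so \<open>adj T_lim\<close> kills them and A v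
  is \<open>adj T_lim\<close> applied to T v. If that is 0, the nonzero paired entries force the
  S-components of T v to vanish, and \<open>span_F_eq_zero\<close> applies.\<close>

lemma conj_lap_lim_span_F:
  assumes v: "v \<in> span F"
  shows "app conj_lap_lim v \<in> span F" and "app conj_lap_lim v = 0 \<Longrightarrow> v = 0"
proof -
  have "v \<bullet> s = 0" if "s \<in> S" for s
    using v that in_span_iff_Basis[OF subsets(2)] disjoint subsets by blast
  then have "app (adj T_lim) v = 0" by (rule adj_T_lim_zero)
  then have A: "app conj_lap_lim v = app (adj T_lim) (T v)" by (simp add: conj_lap_lim_def app_T_endo linear_0[OF lin])
  then show "app conj_lap_lim v \<in> span F" by (simp add: adj_T_lim_in_span)
  assume "app conj_lap_lim v = 0"
  then have z: "app (adj T_lim) (T v) = 0" by (simp add: A)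
  show "v = 0"
  proof (rule span_F_eq_zero[OF v])
    fix s assume "s \<in> S"
    then obtain t where t: "(s, t) \<in> M" by (auto simp: sharp_def)
    have "0 = app (adj T_lim) (T v) \<bullet> t" by (simp add: z)
    also have "\<dots> = entry T s t * (T v \<bullet> s)" by (simp add: adj_inner app_T_lim(1)[OF t])
    finally show "T v \<bullet> s = 0" using M_entry[OF t] by simp
  qed
qed

text \<open>Both k \<sigma> and T(k \<sigma>) lack S-components: the first because k changes
  \<sigma> only inside span F, the second by the choice of the range of k. So
  \<open>adj T_lim\<close> kills both.\<close>

lemma conj_lap_lim_k:
  assumes "\<sigma> \<in> C" shows "app conj_lap_lim (k_op T f \<sigma>) = 0"
proof -
  have "k_op T f \<sigma> \<bullet> s = 0" if s: "s \<in> S" for s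
  proof -
    have "s \<in> Basis" "s \<notin> F" "s \<noteq> \<sigma>" "\<sigma> \<in> Basis"
      using s assms disjoint subsets by blast+
    then have "(k_op T f \<sigma> - \<sigma>) \<bullet> s = 0" "\<sigma> \<bullet> s = 0"
      using k_op(2)[of \<sigma>] in_span_iff_Basis[OF subsets(2)] by (auto simp: inner_Basis)
    then show ?thesis by (simp add: inner_diff_left)
  qed
  then have "app (adj T_lim) (k_op T f \<sigma>) = 0" by (rule adj_T_lim_zero)
  moreover have "app (adj T_lim) (T (k_op T f \<sigma>)) = 0" by (rule adj_T_lim_zero) (rule k_op(1))
  ultimately show ?thesis by (simp add: conj_lap_lim_def app_T_endo linear_0[OF lin])
qed

text \<open>On the invariant span F, A^N X = 0 with A^N injective gives X = 0. Then X \<sigma> = X(k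
  \<sigma>) because k \<sigma> - \<sigma> lies in span F.\<close>

lemma limit_projection:
  obtains X where "econv (\<lambda>t. scal (- t) * W_proj t * scal t) X"
    and "\<And>v. v \<in> span F \<Longrightarrow> app X v = 0" and "\<And>\<sigma>. \<sigma> \<in> C \<Longrightarrow> app X \<sigma> = k_op T f \<sigma>"
proof -
  obtain K where K: "expO K scal" "expO K (\<lambda>t. scal (- t))" by (rule expO_scal)
  have P2: "\<forall>\<^sub>F t in at_top. W_proj t * W_proj t = W_proj t" "\<forall>\<^sub>F t in at_top. lap t * W_proj t = W_proj t * lap t"
    by (rule eventually_mono[OF eventually_lap_close W_proj_properties(2)], assumption)
       (rule eventually_mono[OF eventually_lap_close W_proj_properties(4)], assumption)
  obtain n N where conv: "econv (\<lambda>t. scal (- t) * W_proj t * scal t) ((purify ^^ n) (vanishing_poly factors conj_lap_lim))"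
    and AN: "conj_lap_lim ^ N * (purify ^^ n) (vanishing_poly factors conj_lap_lim) = 0"
    by (rule projection_conj_econv[OF scal_inverse K expO_P P2 esmall_vanishing_poly_W_proj esmall_lap_W_proj econv_conj_lap])
  define X where "X = (purify ^^ n) (vanishing_poly factors conj_lap_lim)"
  have X_F: "app X v \<in> span F" if "v \<in> span F" for v
    unfolding X_def
    by (intro purify_invariant vanishing_poly_invariant subspace_span conj_lap_lim_span_F(1) that)
  have power_inj: "app (conj_lap_lim ^ m) v = 0 \<Longrightarrow> v \<in> span F \<Longrightarrow> v = 0" for m v
  proof (induction m arbitrary: v)
    case (Suc m)
    have "app (conj_lap_lim ^ m) (app conj_lap_lim v) = 0" using Suc.prems(1) by (simp only: power_Suc2 app_simps)
    then have "app conj_lap_lim v = 0" using Suc.IH conj_lap_lim_span_F(1) Suc.prems(2) by blast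
    then show ?case using conj_lap_lim_span_F(2) Suc.prems(2) by blast
  qed simp
  have zero: "app X v = 0" if "v \<in> span F" for v
  proof (rule power_inj)
    show "app (conj_lap_lim ^ N) (app X v) = 0"
      using arg_cong[OF AN, of "\<lambda>x. app x v"] by (simp add: X_def)
  qed (rule X_F[OF that])
  have "app X \<sigma> = k_op T f \<sigma>" if "\<sigma> \<in> C" for \<sigma>
  proof -
    have "(\<Prod>\<nu>\<leftarrow>xs. 1 - 0 / \<nu>) = (1 :: real)" for xs by (induction xs) auto
    then have "app (vanishing_poly factors conj_lap_lim) (k_op T f \<sigma>) = k_op T f \<sigma>"
      using app_vanishing_poly_eigen[of conj_lap_lim "k_op T f \<sigma>" 0 factors] conj_lap_lim_k[OF that] by simp
    then have "app X (k_op T f \<sigma>) = k_op T f \<sigma>" unfolding X_def by (rule app_purify_fixed)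
    moreover have "app X (k_op T f \<sigma> - \<sigma>) = 0" by (rule zero[OF k_op(2)])
    ultimately show ?thesis by simp
  qed
  with conv zero that show thesis unfolding X_def by blast
qed

section \<open>The Gram matrix\<close>

text \<open>The Gram matrix, extended by the identity on the noncritical coordinates so that it is
  close to 1 on the whole space.\<close>

definition "gram_op t = crit_proj * W_proj t * crit_proj + (1 - crit_proj)"

definition "inv_sqrt_gram t = matrix_op C (inv_sqrt_on C (gram T f t)) + (1 - crit_proj)"

lemma crit_proj_one_minus: "crit_proj * (1 - crit_proj) = 0" "(1 - crit_proj) * crit_proj = 0" "(1 - crit_proj) * (1 - crit_proj) = 1 - crit_proj"
  by (simp_all add: algebra_simps crit_proj_crit_proj)

lemma esmall_gram_op: "esmall (\<lambda>t. gram_op t - 1)"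
proof -
  have "econv gram_op (crit_proj * crit_proj * crit_proj + (1 - crit_proj))"
    unfolding gram_op_def[abs_def] by (intro econv_add econv_mult econv_W_proj econv_const)
  then show ?thesis by (simp add: crit_proj_crit_proj econv_def)
qed

text \<open>The projection is self-adjoint and idempotent, so inner products of projected vectors
  are its own entries.\<close>

lemma gram_eq:
  assumes t: "norm (lap t - lap_lim) \<le> gap / 4"
  shows "matrix_op C (gram T f t) = crit_proj * W_proj t * crit_proj"
proof (rule endo_eq_ent)
  fix i j :: 'a assume ij: "i \<in> Basis" "j \<in> Basis"
  have PP: "app (W_proj t) (app (W_proj t) v) = app (W_proj t) v" for v
    using arg_cong[OF W_proj_properties(2)[OF t], of "\<lambda>x. app x v"] by simp
  have "gram T f t i j = app (W_proj t) i \<bullet> app (W_proj t) j"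
    by (simp add: gram_def g_vec_def W_proj_properties(1)[OF t])
  also have "\<dots> = app (W_proj t) j \<bullet> i"
    using adj_inner[of "W_proj t" "app (W_proj t) j" i] by (simp add: W_proj_properties(3)[OF t] PP inner_commute)
  finally have g: "gram T f t i j = app (W_proj t) j \<bullet> i" .
  show "ent (matrix_op C (gram T f t)) i j = ent (crit_proj * W_proj t * crit_proj) i j"
    unfolding ent_matrix_op[OF subsets(3) ij] g using ij by (simp add: ent_def inner_crit_proj app_crit_proj)
qed

lemma crit_proj_span_C: "v \<in> span C \<Longrightarrow> app crit_proj v = v"
  using diag_cong_span[OF orthonormal_basis_Basis subsets(3), of v "indicator C" "\<lambda>_. 1"]
  by (simp add: crit_proj_def diag_one[OF orthonormal_basis_Basis])

lemma eventually_gram_pos_def: "\<forall>\<^sub>F t in at_top. pos_def_on C (gram T f t)"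
  using eventually_lap_close esmall_eventually_less[OF esmall_gram_op zero_less_one]
proof eventually_elim
  case (elim t)
  show ?case
  proof (rule pos_def_onI_matrix_op[OF subsets(3)])
    show "adj (matrix_op C (gram T f t)) = matrix_op C (gram T f t)"
      by (rule endo_eq_ent) (simp add: ent_matrix_op[OF subsets(3)] gram_def inner_commute)
    fix v assume v: "v \<in> span C" "v \<noteq> 0"
    have "app (matrix_op C (gram T f t)) v = app (gram_op t) v"
      by (simp add: gram_eq[OF elim(1)] gram_op_def crit_proj_span_C[OF v(1)])
    also have "\<dots> = v + app (gram_op t - 1) v" by simp
    finally have e: "app (matrix_op C (gram T f t)) v \<bullet> v = v \<bullet> v + app (gram_op t - 1) v \<bullet> v"
      by (simp only: inner_add_left)
    have "\<bar>app (gram_op t - 1) v \<bullet> v\<bar> \<le> norm (app (gram_op t - 1) v) * norm v" by (rule Cauchy_Schwarz_ineq2)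
    also have "\<dots> \<le> (norm (gram_op t - 1) * norm v) * norm v"
      by (rule mult_right_mono[OF norm_app norm_ge_zero])
    also have "\<dots> < (1 * norm v) * norm v" using elim(2) v(2) by (intro mult_strict_right_mono) auto
    finally show "0 < app (matrix_op C (gram T f t)) v \<bullet> v"
      unfolding e by (simp add: dot_square_norm power2_eq_square)
  qed
qed

lemma inv_sqrt_gram_properties:
  assumes t: "norm (lap t - lap_lim) \<le> gap / 4" and pd: "pos_def_on C (gram T f t)"
  shows "adj (inv_sqrt_gram t) = inv_sqrt_gram t" and "0 \<le> app (inv_sqrt_gram t) v \<bullet> v" and "inv_sqrt_gram t * inv_sqrt_gram t * gram_op t = 1"
    and "\<sigma> \<in> C \<Longrightarrow> h_vec T f t \<sigma> = app (W_proj t) (app (inv_sqrt_gram t) \<sigma>)"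
proof -
  note iS = inv_sqrt_on[OF subsets(3) pd]
  let ?s = "matrix_op C (inv_sqrt_on C (gram T f t))" and ?g = "matrix_op C (gram T f t)"
  have adj1: "adj (1 - crit_proj) = 1 - crit_proj"
  proof (rule endo_eq_ent)
    fix i j :: 'a assume "i \<in> Basis" "j \<in> Basis"
    then show "ent (adj (1 - crit_proj)) i j = ent (1 - crit_proj) i j"
      unfolding ent_simps(4) by (auto simp: ent_def app_crit_proj inner_Basis inner_diff_left)
  qed
  show "adj (inv_sqrt_gram t) = inv_sqrt_gram t"
    by (simp add: inv_sqrt_gram_def adj_plus adj1 matrix_op_symmetric[OF iS(1)])
  have "app (1 - crit_proj) v = app (1 - crit_proj) (app (1 - crit_proj) v)"
    using arg_cong[OF crit_proj_one_minus(3), of "\<lambda>x. app x v"] by simp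
  then have "app (1 - crit_proj) v \<bullet> v = app (1 - crit_proj) v \<bullet> app (1 - crit_proj) v"
    using adj_inner[of "1 - crit_proj" "app (1 - crit_proj) v" v] by (simp only: adj1)
  then have "0 \<le> app (1 - crit_proj) v \<bullet> v" by simp
  then show "0 \<le> app (inv_sqrt_gram t) v \<bullet> v"
    using pos_def_on_nonneg[OF iS(1), of v] unfolding inv_sqrt_gram_def app_simps(3) inner_add_left by linarith
  have z: "m * (1 - crit_proj) = 0" "(1 - crit_proj) * m = 0" if "m = matrix_op C N" for m N
    using indicator_mult_matrix_op[OF subsets(3), of N] by (simp_all add: that crit_proj_def algebra_simps)
  have "inv_sqrt_gram t * inv_sqrt_gram t = ?s * ?s + (1 - crit_proj)"
    using z[OF refl] by (simp add: inv_sqrt_gram_def distrib_left distrib_right crit_proj_one_minus(3))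
  moreover have "(?s * ?s + (1 - crit_proj)) * (?g + (1 - crit_proj)) = ?s * ?s * ?g + (1 - crit_proj)"
    using z[OF refl] by (simp add: distrib_left distrib_right crit_proj_one_minus(3) mult.assoc)
  moreover have "gram_op t = ?g + (1 - crit_proj)" by (simp add: gram_op_def gram_eq[OF t])
  ultimately show "inv_sqrt_gram t * inv_sqrt_gram t * gram_op t = 1"
    using iS(2) by (simp add: crit_proj_def)
  assume \<sigma>: "\<sigma> \<in> C"
  have fin: "finite C" by (rule finite_subset[OF subsets(3) finite_Basis])
  have "app ?s \<sigma> = (\<Sum>\<sigma>'\<in>C. inv_sqrt_on C (gram T f t) \<sigma> \<sigma>' *\<^sub>R \<sigma>')"
    unfolding app_matrix_op
  proof (rule sum.cong[OF refl])
    fix i assume i: "i \<in> C"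
    have "(\<Sum>j\<in>C. inv_sqrt_on C (gram T f t) i j * (\<sigma> \<bullet> j))
        = (\<Sum>j\<in>C. if j = \<sigma> then inv_sqrt_on C (gram T f t) i \<sigma> else 0)"
      using \<sigma> subsets(3) by (intro sum.cong) (auto simp: inner_Basis subset_iff)
    \<comment> \<open>Symmetry turns the column of the matrix, which the operator produces, into the
      row used in \<open>h_vec\<close>.\<close>
    also have "\<dots> = inv_sqrt_on C (gram T f t) \<sigma> i"
      using iS(1) fin \<sigma> i by (simp add: pos_def_on_def)
    finally show "(\<Sum>j\<in>C. inv_sqrt_on C (gram T f t) i j * (\<sigma> \<bullet> j)) *\<^sub>R i
        = inv_sqrt_on C (gram T f t) \<sigma> i *\<^sub>R i" by simp
  qed
  moreover have "app (1 - crit_proj) \<sigma> = 0" using \<sigma> subsets(3) by (auto simp: app_crit_proj)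
  ultimately have "app (inv_sqrt_gram t) \<sigma> = (\<Sum>\<sigma>'\<in>C. inv_sqrt_on C (gram T f t) \<sigma> \<sigma>' *\<^sub>R \<sigma>')"
    unfolding inv_sqrt_gram_def app_simps(3) by simp
  then show "h_vec T f t \<sigma> = app (W_proj t) (app (inv_sqrt_gram t) \<sigma>)"
    by (simp add: h_vec_def g_vec_def W_proj_properties(1)[OF t, symmetric])
qed

lemma esmall_inv_sqrt_gram: "esmall (\<lambda>t. inv_sqrt_gram t - 1)"
proof (rule esmall_eventually_le[OF esmall_gram_op, where c = 2])
  have "\<forall>\<^sub>F t in at_top. norm (gram_op t - 1) < 1 / 2"
    by (rule esmall_eventually_less[OF esmall_gram_op]) simp
  with eventually_lap_close eventually_gram_pos_def
  show "\<forall>\<^sub>F t in at_top. norm (inv_sqrt_gram t - 1) \<le> 2 * norm (gram_op t - 1)"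
    by eventually_elim (intro norm_inverse_root_minus_one inv_sqrt_gram_properties; simp)
qed simp

text \<open>\<open>crit_proj\<close> commutes with \<open>scal\<close>, so the conjugated Gram
  operator converges to the compression of X to the critical coordinates plus the identity on the
  others, that is, to 1.\<close>

lemma econv_conj_inv_sqrt_gram:
  assumes X: "econv (\<lambda>t. scal (- t) * W_proj t * scal t) X" and PXP: "crit_proj * X * crit_proj = crit_proj"
  shows "econv (\<lambda>t. scal (- t) * inv_sqrt_gram t * scal t) 1"
proof -
  obtain K where K: "expO K scal" "expO K (\<lambda>t. scal (- t))" by (rule expO_scal)
  have SSG: "\<forall>\<^sub>F t in at_top. inv_sqrt_gram t * inv_sqrt_gram t * gram_op t = 1"
    using eventually_lap_close eventually_gram_pos_def by eventually_elim (rule inv_sqrt_gram_properties(3))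
  have "scal (- t) * gram_op t * scal t = crit_proj * (scal (- t) * W_proj t * scal t) * crit_proj + (1 - crit_proj)" for t
  proof -
    have "scal (- t) * crit_proj * scal t = crit_proj" by (simp add: scal_crit_proj mult.assoc scal_inverse)
    moreover have "scal (- t) * (1 - crit_proj) * scal t = 1 - crit_proj"
      using calculation by (simp add: algebra_simps scal_inverse)
    ultimately show ?thesis
      unfolding gram_op_def distrib_left distrib_right conj_mult[OF scal_inverse(1)] by simp
  qed
  moreover have "econv (\<lambda>t. crit_proj * (scal (- t) * W_proj t * scal t) * crit_proj + (1 - crit_proj)) (crit_proj * X * crit_proj + (1 - crit_proj))"
    by (intro econv_add econv_mult econv_const X)
  ultimately have "econv (\<lambda>t. scal (- t) * gram_op t * scal t) 1" by (simp add: PXP)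
  then show ?thesis
    by (rule inverse_root_conj_esmall[OF scal_inverse K esmall_inv_sqrt_gram esmall_gram_op SSG])
qed

section \<open>Matrix entries of the deformed operator in the orthonormal basis\<close>

text \<open>The number sought is one entry of an operator Z whose conjugate converges. Undoing the
  conjugation restores the factor exp(t(f \<tau> - f \<sigma>)) and shifts the negative rate a by f
  \<tau> - f \<sigma>.\<close>

lemma deform_h_asymptotics:
  assumes \<sigma>: "\<sigma> \<in> C" and \<tau>: "\<tau> \<in> C"
  shows "\<exists>a. a < f \<tau> - f \<sigma> \<and>
    (\<lambda>t. deform T f t (h_vec T f t \<sigma>) \<bullet> h_vec T f t \<tau>
          - exp (t * (f \<tau> - f \<sigma>)) * (T (k_op T f \<sigma>) \<bullet> \<tau>)) \<in> O[at_top](\<lambda>t. exp (a * t))"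
proof -
  have B: "\<sigma> \<in> Basis" "\<tau> \<in> Basis" using \<sigma> \<tau> subsets by auto
  obtain X where X: "econv (\<lambda>t. scal (- t) * W_proj t * scal t) X"
    and XF: "\<And>v. v \<in> span F \<Longrightarrow> app X v = 0" and Xk: "\<And>\<sigma>. \<sigma> \<in> C \<Longrightarrow> app X \<sigma> = k_op T f \<sigma>"
    by (rule limit_projection) blast
  \<comment> \<open>k changes e only inside span F, which has no critical components.\<close>
  have PXP: "crit_proj * X * crit_proj = crit_proj"
  proof (rule endo_eq_Basis)
    fix e :: 'a assume e: "e \<in> Basis"
    show "app (crit_proj * X * crit_proj) e = app crit_proj e"
    proof (cases "e \<in> C")
      case True
      have "app crit_proj (k_op T f e - e) = 0"
      proof (rule euclidean_eqI)
        fix i :: 'a assume i: "i \<in> Basis"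
        have "(k_op T f e - e) \<bullet> i = 0" if "i \<in> C"
          using k_op(2)[of e] in_span_iff_Basis[OF subsets(2)] disjoint that i by blast
        then show "app crit_proj (k_op T f e - e) \<bullet> i = 0 \<bullet> i" by (simp only: inner_crit_proj[OF i] inner_zero_left if_cancel split: if_split) simp
      qed
      then show ?thesis using True by (simp add: app_crit_proj[OF e] Xk)
    qed (simp add: app_crit_proj[OF e])
  qed
  \<comment> \<open>The projection and the inverse root acting on \<tau> are self-adjoint and so
    move to the left of T_t.\<close>
  define Z where "Z = (\<lambda>t. inv_sqrt_gram t * W_proj t * T_deform t * W_proj t * inv_sqrt_gram t)"
  have "scal (- t) * Z t * scal t = (scal (- t) * inv_sqrt_gram t * scal t) * (scal (- t) * W_proj t * scal t) * T_endo
      * (scal (- t) * W_proj t * scal t) * (scal (- t) * inv_sqrt_gram t * scal t)" for t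
    unfolding Z_def conj_mult[OF scal_inverse(1)] conj_T_deform ..
  moreover note S = econv_conj_inv_sqrt_gram[OF X PXP]
  have "econv (\<lambda>t. (scal (- t) * inv_sqrt_gram t * scal t) * (scal (- t) * W_proj t * scal t) * T_endo
      * (scal (- t) * W_proj t * scal t) * (scal (- t) * inv_sqrt_gram t * scal t)) (1 * X * T_endo * X * 1)"
    by (intro econv_mult econv_const S X)
  ultimately have "econv (\<lambda>t. scal (- t) * Z t * scal t) (X * T_endo * X)" by simp
  then have "econv (\<lambda>t. ent (scal (- t) * Z t * scal t) \<tau> \<sigma>) (ent (X * T_endo * X) \<tau> \<sigma>)"
    by (rule econv_ent[OF _ B(2,1)])
  \<comment> \<open>w = T(k \<sigma>) has no S-components, so it differs from its critical part by
    an element of span F, which X kills; on critical coordinates X compresses to the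
    identity.\<close>
  moreover have "ent (X * T_endo * X) \<tau> \<sigma> = T (k_op T f \<sigma>) \<bullet> \<tau>"
  proof -
    define w where "w = T (k_op T f \<sigma>)"
    have "w - app crit_proj w \<in> span F"
      unfolding in_span_iff_Basis[OF subsets(2)]
    proof
      fix i assume i: "i \<in> Basis - F"
      then have "i \<in> C \<or> i \<in> S" using disjoint by blast
      then show "(w - app crit_proj w) \<bullet> i = 0"
        using i k_op(1)[of i \<sigma>] by (auto simp: inner_diff_left inner_crit_proj w_def)
    qed
    then have "app X (w - app crit_proj w) = 0" by (rule XF)
    then have "app X w \<bullet> \<tau> = app X (app crit_proj w) \<bullet> \<tau>" by simp
    also have "\<dots> = app (crit_proj * X * crit_proj) w \<bullet> \<tau>" using inner_crit_proj[OF B(2)] \<tau> by simp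
    also have "\<dots> = w \<bullet> \<tau>" unfolding PXP using inner_crit_proj[OF B(2)] \<tau> by simp
    finally show ?thesis by (simp add: ent_def Xk[OF \<sigma>] app_T_endo w_def)
  qed
  ultimately have "esmall (\<lambda>t. ent (scal (- t) * Z t * scal t) \<tau> \<sigma> - T (k_op T f \<sigma>) \<bullet> \<tau>)"
    by (simp add: econv_def)
  then obtain a where a: "a < 0" "expO a (\<lambda>t. ent (scal (- t) * Z t * scal t) \<tau> \<sigma> - T (k_op T f \<sigma>) \<bullet> \<tau>)"
    by (auto simp: esmall_def)
  have "expO (f \<tau> - f \<sigma>) (\<lambda>t. exp (t * (f \<tau> - f \<sigma>)))"
    unfolding expO_def by (intro exI[of _ 1]) (simp add: mult.commute)
  from expO_mult[OF this a(2)]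
  have "expO (f \<tau> - f \<sigma> + a) (\<lambda>t. exp (t * (f \<tau> - f \<sigma>)) *
      (ent (scal (- t) * Z t * scal t) \<tau> \<sigma> - T (k_op T f \<sigma>) \<bullet> \<tau>))" .
  then have "expO (f \<tau> - f \<sigma> + a) (\<lambda>t. deform T f t (h_vec T f t \<sigma>) \<bullet> h_vec T f t \<tau>
          - exp (t * (f \<tau> - f \<sigma>)) * (T (k_op T f \<sigma>) \<bullet> \<tau>))"
  proof (rule expO_cong[rotated])
    show "\<forall>\<^sub>F t in at_top. exp (t * (f \<tau> - f \<sigma>)) * (ent (scal (- t) * Z t * scal t) \<tau> \<sigma> - T (k_op T f \<sigma>) \<bullet> \<tau>)
      = deform T f t (h_vec T f t \<sigma>) \<bullet> h_vec T f t \<tau> - exp (t * (f \<tau> - f \<sigma>)) * (T (k_op T f \<sigma>) \<bullet> \<tau>)"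
      using eventually_lap_close eventually_gram_pos_def
    proof eventually_elim
      case (elim t)
      note Sp = inv_sqrt_gram_properties[OF elim]
      have "deform T f t (h_vec T f t \<sigma>) \<bullet> h_vec T f t \<tau>
          = app (T_deform t * W_proj t * inv_sqrt_gram t) \<sigma> \<bullet> app (W_proj t) (app (inv_sqrt_gram t) \<tau>)"
        by (simp add: Sp(4)[OF \<sigma>] Sp(4)[OF \<tau>] deform_eq)
      also have "\<dots> = ent (Z t) \<tau> \<sigma>"
        unfolding adj_inner[symmetric] Sp(1) W_proj_properties(3)[OF elim(1)] by (simp add: ent_def Z_def)
      finally have "deform T f t (h_vec T f t \<sigma>) \<bullet> h_vec T f t \<tau> = ent (Z t) \<tau> \<sigma>" .
      moreover have "exp (t * (f \<tau> - f \<sigma>)) * ent (scal (- t) * Z t * scal t) \<tau> \<sigma> = ent (Z t) \<tau> \<sigma>"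
        unfolding ent_scal[OF B(2,1)] mult.assoc[symmetric] exp_add[symmetric] by (simp add: algebra_simps)
      ultimately show ?case by (simp add: right_diff_distrib)
    qed
  qed
  then show ?thesis using a(1) unfolding expO_iff_bigo by (intro exI[of _ "f \<tau> - f \<sigma> + a"]) simp
qed

end

theorem theorem10p3p2:
  fixes T :: "'a::euclidean_space \<Rightarrow> 'a" and f :: "'a \<Rightarrow> real"
  assumes "linear T"
    and "monotone_fun T f"
    and "acyclic_fun T f"
    and "canted_fun T f"
  shows "\<forall>\<sigma>\<in>critical T f. \<forall>\<tau>\<in>critical T f. \<exists>a. a < f \<tau> - f \<sigma> \<and>
    (\<lambda>t. deform T f t (h_vec T f t \<sigma>) \<bullet> h_vec T f t \<tau>
          - exp (t * (f \<tau> - f \<sigma>)) * (T (k_op T f \<sigma>) \<bullet> \<tau>))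
      \<in> O[at_top](\<lambda>t. exp (a * t))"
proof -
  interpret canted_setting T f by (rule canted_setting.intro) (fact assms)+
  show ?thesis using deform_h_asymptotics by blast
qed

end
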